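(* Let $s,r,m$ be positive integers with $m\le s\le r-m-2$, let $S_1,\dots,S_m\in\mathbb{F}_q[Y_1,\dots,Y_s]$ satisfy hypotheses (H1), (H2), (H3) of the context, let $\Pi_1,\dots,\Pi_s$ be the first $s$ elementary symmetric polynomials of $\mathbb{F}_q[X_1,\dots,X_r]$, $R_i:=S_i(\Pi_1,\dots,\Pi_s)$ for $1\le i\le m$, and $V_r:=V(R_1,\dots,R_m)\subset\mathbb{A}^r$. Then the set of points $\boldsymbol{x}\in V_r$ for which the Jacobian matrix $(\partial R_i/\partial X_j)_{1\le i\le m,1\le j\le r}(\boldsymbol{x})$ does not have full rank has dimension at most $s-1$. In particular, the singular locus of $V_r$ has dimension at most $s-1$.
   Context: $\mathbb{F}_q$ is a finite field, $\overline{\mathbb{F}}_q$ an algebraic closure, $\mathbb{A}^n:=\overline{\mathbb{F}}_q^{\,n}$, and $V(F_1,\dots,F_k)$ is the set of common zeros in $\mathbb{A}^n$. Weight on $\mathbb{F}_q[Y_1,\dots,Y_s]$: $\mathrm{wt}(Y_j):=j$; $S^{\mathrm{wt}}$ is the component of highest weight of $S$. (H1) $S_1,\dots,S_m$ form a regular sequence of $\mathbb{F}_q[Y_1,\dots,Y_s]$; (H2) the Jacobian matrix $(\partial S_i/\partial Y_j)$ has rank $m$ at every point of $V(S_1,\dots,S_m)\subset\mathbb{A}^s$; (H3) $S_1^{\mathrm{wt}},\dots,S_m^{\mathrm{wt}}$ satisfy (H1) and (H2) (with $V(S_1^{\mathrm{wt}},\dots,S_m^{\mathrm{wt}})$ in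 place of $V(S_1,\dots,S_m)$). *)

theory Defs
  imports
    "HOL-Analysis.Abstract_Topology"
    "HOL-Library.Extended_Real"
    "HOL-Library.Function_Algebras"
    "HOL-Library.Poly_Mapping"
    "HOL-Algebra.Algebraic_Closure_Type"
    "HOL-Algebra.QuotRing"
    "Jordan_Normal_Form.DL_Rank"
begin

section \<open>Multivariate polynomials\<close>

text \<open>A monomial maps (the index of) each variable to its exponent. Variables are numbered
  from 1: the polynomial ring in \<open>n\<close> variables uses the variables with index in \<open>{1..n}\<close>.\<close>

type_synonym 'a mpoly = "(nat \<Rightarrow>\<^sub>0 nat) \<Rightarrow>\<^sub>0 'a"

definition Var :: "nat \<Rightarrow> 'a::comm_ring_1 mpoly" where
  "Var i = Poly_Mapping.single (Poly_Mapping.single i 1) 1"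

definition Const :: "'a::comm_ring_1 \<Rightarrow> 'a mpoly" where
  "Const c = Poly_Mapping.single 0 c"

text \<open>Substitution of \<open>x i\<close> for the \<open>i\<close>-th variable, with the coefficients mapped by \<open>h\<close>. It serves
  as evaluation at a point (\<open>h\<close> the inclusion of the coefficient field in a larger field, or the
  identity) and as composition of polynomials (\<open>h = Const\<close>).\<close>

definition mpoly_subst :: "('a::comm_ring_1 \<Rightarrow> 'b::comm_ring_1) \<Rightarrow> (nat \<Rightarrow> 'b) \<Rightarrow> 'a mpoly \<Rightarrow> 'b" where
  "mpoly_subst h x p =
     (\<Sum>\<alpha>\<in>Poly_Mapping.keys p. h (Poly_Mapping.lookup p \<alpha>) *
        (\<Prod>i\<in>Poly_Mapping.keys \<alpha>. x i ^ Poly_Mapping.lookup \<alpha> i))"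

definition mpoly_deriv :: "nat \<Rightarrow> 'a::comm_ring_1 mpoly \<Rightarrow> 'a mpoly" where
  "mpoly_deriv j p =
     (\<Sum>\<alpha>\<in>Poly_Mapping.keys p. Poly_Mapping.single (\<alpha> - Poly_Mapping.single j 1)
        (of_nat (Poly_Mapping.lookup \<alpha> j) * Poly_Mapping.lookup p \<alpha>))"

definition mpoly_ring :: "nat \<Rightarrow> 'a::comm_ring_1 mpoly ring" where
  "mpoly_ring n = \<lparr>carrier = {p. \<forall>\<alpha>\<in>Poly_Mapping.keys p. Poly_Mapping.keys \<alpha> \<subseteq> {1..n}},
     monoid.mult = (*), one = 1, ring.zero = 0, add = (+)\<rparr>"

definition elem_sym :: "nat \<Rightarrow> nat \<Rightarrow> 'a::comm_ring_1 mpoly" where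
  "elem_sym r k = (\<Sum>A | A \<subseteq> {1..r} \<and> card A = k. \<Prod>i\<in>A. Var i)"

text \<open>The weight of the variable with index \<open>j\<close> is \<open>j\<close>.\<close>

definition monom_wt :: "(nat \<Rightarrow>\<^sub>0 nat) \<Rightarrow> nat" where
  "monom_wt \<alpha> = (\<Sum>j\<in>Poly_Mapping.keys \<alpha>. j * Poly_Mapping.lookup \<alpha> j)"

definition top_wt :: "'a::comm_ring_1 mpoly \<Rightarrow> 'a mpoly" where
  "top_wt p = (\<Sum>\<alpha> | \<alpha> \<in> Poly_Mapping.keys p \<and> monom_wt \<alpha> = Max (monom_wt ` Poly_Mapping.keys p).
     Poly_Mapping.single \<alpha> (Poly_Mapping.lookup p \<alpha>))"

text \<open>\<open>F 1, \<dots>, F m\<close> generate a proper ideal, and each \<open>F i\<close> is a non-zero-divisor modulo the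
  ideal generated by its predecessors.\<close>

definition regular_seq :: "nat \<Rightarrow> nat \<Rightarrow> (nat \<Rightarrow> 'a::comm_ring_1 mpoly) \<Rightarrow> bool" where
  "regular_seq n m F \<longleftrightarrow>
     F ` {1..m} \<subseteq> carrier (mpoly_ring n) \<and>
     (\<forall>i\<in>{1..m}. \<forall>g\<in>carrier (mpoly_ring n).
        g * F i \<in> genideal (mpoly_ring n) (F ` {1..<i}) \<longrightarrow> g \<in> genideal (mpoly_ring n) (F ` {1..<i})) \<and>
     genideal (mpoly_ring n) (F ` {1..m}) \<noteq> carrier (mpoly_ring n)"


section \<open>Affine varieties\<close>

text \<open>Points of affine \<open>n\<close>-space are indexed by \<open>{1..n}\<close> and extended by 0, so that affine space
  is a linear subspace of the space of all functions.\<close>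

definition affine_space :: "nat \<Rightarrow> (nat \<Rightarrow> 'k::zero) set" where
  "affine_space n = {x. \<forall>i. i \<notin> {1..n} \<longrightarrow> x i = 0}"

definition zero_locus ::
    "('a::comm_ring_1 \<Rightarrow> 'k::comm_ring_1) \<Rightarrow> nat \<Rightarrow> 'a mpoly set \<Rightarrow> (nat \<Rightarrow> 'k) set" where
  "zero_locus h n P = {x \<in> affine_space n. \<forall>p\<in>P. mpoly_subst h x p = 0}"

text \<open>Matrix entries are numbered from 0, polynomials and variables from 1.\<close>

definition jacobian ::
    "('a::comm_ring_1 \<Rightarrow> 'k::comm_ring_1) \<Rightarrow> nat \<Rightarrow> nat \<Rightarrow> (nat \<Rightarrow> 'a mpoly) \<Rightarrow> (nat \<Rightarrow> 'k) \<Rightarrow> 'k mat" where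
  "jacobian h m n F x = mat m n (\<lambda>(i, j). mpoly_subst h x (mpoly_deriv (Suc j) (F (Suc i))))"

definition jacobian_full_rank_on_locus ::
    "('a::comm_ring_1 \<Rightarrow> 'k::field) \<Rightarrow> nat \<Rightarrow> nat \<Rightarrow> (nat \<Rightarrow> 'a mpoly) \<Rightarrow> bool" where
  "jacobian_full_rank_on_locus h n m F \<longleftrightarrow>
     (\<forall>x\<in>zero_locus h n (F ` {1..m}). vec_space.rank m (jacobian h m n F x) = m)"

definition zariski :: "nat \<Rightarrow> (nat \<Rightarrow> 'k::field) topology" where
  "zariski n = topology (\<lambda>U. \<exists>P\<subseteq>carrier (mpoly_ring n). U = affine_space n - zero_locus (\<lambda>c. c) n P)"

definition irreducible_space :: "'p topology \<Rightarrow> bool" where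
  "irreducible_space T \<longleftrightarrow> topspace T \<noteq> {} \<and>
     (\<forall>A B. closedin T A \<and> closedin T B \<and> A \<union> B = topspace T \<longrightarrow> A = topspace T \<or> B = topspace T)"

text \<open>The supremum of the lengths \<open>k\<close> of the strict chains \<open>Z 0 \<subset> \<dots> \<subset> Z k\<close> of irreducible closed
  subsets. The empty space has dimension \<open>-\<infinity>\<close>.\<close>

definition krull_dim :: "'p topology \<Rightarrow> ereal" where
  "krull_dim T = Sup {ereal (real k) | k. \<exists>Z.
     (\<forall>i\<le>k. closedin T (Z i) \<and> irreducible_space (subtopology T (Z i))) \<and> (\<forall>i<k. Z i \<subset> Z (Suc i))}"

definition irreducible_components :: "'p topology \<Rightarrow> 'p set set" where
  "irreducible_components T = {Z. Z \<subseteq> topspace T \<and> irreducible_space (subtopology T Z) \<and>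
     (\<forall>Y. Z \<subseteq> Y \<and> Y \<subseteq> topspace T \<and> irreducible_space (subtopology T Y) \<longrightarrow> Y = Z)}"

definition zdim :: "nat \<Rightarrow> (nat \<Rightarrow> 'k::field) set \<Rightarrow> ereal" where
  "zdim n W = krull_dim (subtopology (zariski n) W)"

text \<open>The maximum of the dimensions of the irreducible components of \<open>V\<close> through \<open>x\<close>.\<close>

definition local_dim :: "nat \<Rightarrow> (nat \<Rightarrow> 'k::field) set \<Rightarrow> (nat \<Rightarrow> 'k) \<Rightarrow> ereal" where
  "local_dim n V x =
     Sup (zdim n ` {Z \<in> irreducible_components (subtopology (zariski n) V). x \<in> Z})"

definition vanishing_ideal :: "nat \<Rightarrow> (nat \<Rightarrow> 'k::field) set \<Rightarrow> 'k mpoly set" where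
  "vanishing_ideal n V = {p \<in> carrier (mpoly_ring n). \<forall>x\<in>V. mpoly_subst (\<lambda>c. c) x p = 0}"

definition tangent_space :: "nat \<Rightarrow> (nat \<Rightarrow> 'k::field) set \<Rightarrow> (nat \<Rightarrow> 'k) \<Rightarrow> (nat \<Rightarrow> 'k) set" where
  "tangent_space n V x = {v \<in> affine_space n. \<forall>p\<in>vanishing_ideal n V.
     (\<Sum>j=1..n. mpoly_subst (\<lambda>c. c) x (mpoly_deriv j p) * v j) = 0}"

text \<open>A point is regular if the tangent space, taken with respect to the full vanishing ideal of \<open>V\<close>
  over the algebraically closed field, has the dimension of \<open>V\<close> at that point.\<close>

definition singular_locus :: "nat \<Rightarrow> (nat \<Rightarrow> 'k::field) set \<Rightarrow> (nat \<Rightarrow> 'k) set" where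
  "singular_locus n V = {x \<in> V.
     ereal (real (vector_space.dim (\<lambda>c v i. c * v i) (tangent_space n V x))) \<noteq> local_dim n V x}"


section \<open>Well-definedness\<close>

lemma carrier_mpoly_ring:
  "carrier (mpoly_ring n) = {p. \<forall>\<alpha>\<in>Poly_Mapping.keys p. Poly_Mapping.keys \<alpha> \<subseteq> {1..n}}"
  by (simp add: mpoly_ring_def)

lemma mpoly_ring_simps:
  "x \<oplus>\<^bsub>mpoly_ring n\<^esub> y = x + y" "x \<otimes>\<^bsub>mpoly_ring n\<^esub> y = x * y"
  "\<zero>\<^bsub>mpoly_ring n\<^esub> = 0" "\<one>\<^bsub>mpoly_ring n\<^esub> = 1"
  by (simp_all add: mpoly_ring_def)

lemma mpoly_ring_add_closed:
  "p \<in> carrier (mpoly_ring n) \<Longrightarrow> q \<in> carrier (mpoly_ring n) \<Longrightarrow> p + q \<in> carrier (mpoly_ring n)"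
  using Poly_Mapping.keys_add[of p q] by (auto simp: carrier_mpoly_ring)

lemma mpoly_ring_uminus_closed:
  "p \<in> carrier (mpoly_ring n) \<Longrightarrow> - p \<in> carrier (mpoly_ring n)"
  by (auto simp: carrier_mpoly_ring)

lemma mpoly_ring_mult_closed:
  assumes "p \<in> carrier (mpoly_ring n)" "q \<in> carrier (mpoly_ring n)"
  shows "p * q \<in> carrier (mpoly_ring n)"
proof -
  have "Poly_Mapping.keys \<gamma> \<subseteq> {1..n}" if "\<gamma> \<in> Poly_Mapping.keys (p * q)" for \<gamma>
  proof -
    from that keys_mult[of p q] obtain \<alpha> \<beta> where
      "\<gamma> = \<alpha> + \<beta>" "\<alpha> \<in> Poly_Mapping.keys p" "\<beta> \<in> Poly_Mapping.keys q" by blast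
    then show ?thesis
      using assms Poly_Mapping.keys_add[of \<alpha> \<beta>] by (fastforce simp: carrier_mpoly_ring)
  qed
  then show ?thesis by (simp add: carrier_mpoly_ring)
qed

lemma mpoly_ring_one_closed: "1 \<in> carrier (mpoly_ring n)"
  by (simp add: carrier_mpoly_ring)

lemma mpoly_ring_zero_closed: "0 \<in> carrier (mpoly_ring n)"
  by (simp add: carrier_mpoly_ring)

lemma cring_mpoly_ring: "cring (mpoly_ring n :: 'a::comm_ring_1 mpoly ring)"
proof (rule cringI)
  show "abelian_group (mpoly_ring n :: 'a mpoly ring)"
  proof (rule abelian_groupI)
    fix x :: "'a mpoly"
    assume "x \<in> carrier (mpoly_ring n)"
    then show "\<exists>y\<in>carrier (mpoly_ring n). y \<oplus>\<^bsub>mpoly_ring n\<^esub> x = \<zero>\<^bsub>mpoly_ring n\<^esub>"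
      by (intro bexI[of _ "- x"] mpoly_ring_uminus_closed) (simp_all add: mpoly_ring_simps)
  qed (use mpoly_ring_add_closed mpoly_ring_zero_closed in
       \<open>auto simp: mpoly_ring_simps add.assoc add.commute\<close>)
  show "comm_monoid (mpoly_ring n :: 'a mpoly ring)"
    by (rule comm_monoidI)
      (use mpoly_ring_mult_closed mpoly_ring_one_closed in
       \<open>auto simp: mpoly_ring_simps mult.assoc mult.commute\<close>)
qed (auto simp: mpoly_ring_simps distrib_right)

lemma mpoly_subst_superset:
  assumes "finite A" "Poly_Mapping.keys p \<subseteq> A" "h 0 = 0"
  shows "mpoly_subst h x p = (\<Sum>\<alpha>\<in>A. h (Poly_Mapping.lookup p \<alpha>) *
     (\<Prod>i\<in>Poly_Mapping.keys \<alpha>. x i ^ Poly_Mapping.lookup \<alpha> i))"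
  unfolding mpoly_subst_def using assms
  by (intro sum.mono_neutral_left) (auto simp: in_keys_iff)

lemma monom_subst_superset:
  fixes x :: "nat \<Rightarrow> 'b::comm_ring_1"
  assumes "finite A" "Poly_Mapping.keys \<alpha> \<subseteq> A"
  shows "(\<Prod>i\<in>Poly_Mapping.keys \<alpha>. x i ^ Poly_Mapping.lookup \<alpha> i) =
     (\<Prod>i\<in>A. x i ^ Poly_Mapping.lookup \<alpha> i)"
  using assms by (intro prod.mono_neutral_left) (auto simp: in_keys_iff)

lemma monom_subst_add:
  fixes x :: "nat \<Rightarrow> 'b::comm_ring_1"
  shows "(\<Prod>i\<in>Poly_Mapping.keys (\<alpha> + \<beta>). x i ^ Poly_Mapping.lookup (\<alpha> + \<beta>) i) =
     (\<Prod>i\<in>Poly_Mapping.keys \<alpha>. x i ^ Poly_Mapping.lookup \<alpha> i) *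
     (\<Prod>i\<in>Poly_Mapping.keys \<beta>. x i ^ Poly_Mapping.lookup \<beta> i)"
proof -
  let ?A = "Poly_Mapping.keys \<alpha> \<union> Poly_Mapping.keys \<beta>"
  show ?thesis
    using monom_subst_superset[of ?A "\<alpha> + \<beta>" x] monom_subst_superset[of ?A \<alpha> x]
      monom_subst_superset[of ?A \<beta> x] Poly_Mapping.keys_add[of \<alpha> \<beta>]
    by (simp add: lookup_add power_add prod.distrib)
qed

context
  fixes h :: "'a::comm_ring_1 \<Rightarrow> 'b::comm_ring_1"
  assumes h0: "h 0 = 0" and h1: "h 1 = 1"
    and hadd: "\<And>a b. h (a + b) = h a + h b" and hmult: "\<And>a b. h (a * b) = h a * h b"
begin

lemma mpoly_subst_zero: "mpoly_subst h x 0 = 0"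
  by (simp add: mpoly_subst_def)

lemma mpoly_subst_one: "mpoly_subst h x 1 = 1"
  by (simp add: mpoly_subst_def h1)

lemma mpoly_subst_single:
  "mpoly_subst h x (Poly_Mapping.single \<alpha> c) =
     h c * (\<Prod>i\<in>Poly_Mapping.keys \<alpha>. x i ^ Poly_Mapping.lookup \<alpha> i)"
  by (simp add: mpoly_subst_def h0)

lemma mpoly_subst_add: "mpoly_subst h x (p + q) = mpoly_subst h x p + mpoly_subst h x q"
proof -
  let ?A = "Poly_Mapping.keys p \<union> Poly_Mapping.keys q"
  show ?thesis
    using mpoly_subst_superset[of ?A "p + q" h x] mpoly_subst_superset[of ?A p h x]
      mpoly_subst_superset[of ?A q h x] Poly_Mapping.keys_add[of p q] h0
    by (simp add: lookup_add hadd distrib_right sum.distrib)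
qed

lemma mpoly_subst_sum: "mpoly_subst h x (sum f A) = (\<Sum>a\<in>A. mpoly_subst h x (f a))"
  by (induction A rule: infinite_finite_induct) (simp_all add: mpoly_subst_zero mpoly_subst_add)

lemma mpoly_subst_mult: "mpoly_subst h x (p * q) = mpoly_subst h x p * mpoly_subst h x q"
proof -
  have expand: "p = (\<Sum>\<alpha>\<in>Poly_Mapping.keys p. Poly_Mapping.single \<alpha> (Poly_Mapping.lookup p \<alpha>))"
    for p :: "'a mpoly"
    by (rule poly_mapping_eqI)
      (auto simp: lookup_sum lookup_single when_def in_keys_iff sum.delta')
  have "p * q = (\<Sum>\<alpha>\<in>Poly_Mapping.keys p. \<Sum>\<beta>\<in>Poly_Mapping.keys q.
      Poly_Mapping.single (\<alpha> + \<beta>) (Poly_Mapping.lookup p \<alpha> * Poly_Mapping.lookup q \<beta>))"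
    by (subst expand[of p], subst expand[of q]) (simp add: sum_product mult_single)
  then have "mpoly_subst h x (p * q) = (\<Sum>\<alpha>\<in>Poly_Mapping.keys p. \<Sum>\<beta>\<in>Poly_Mapping.keys q.
      mpoly_subst h x (Poly_Mapping.single (\<alpha> + \<beta>) (Poly_Mapping.lookup p \<alpha> * Poly_Mapping.lookup q \<beta>)))"
    by (simp only: mpoly_subst_sum)
  also have "\<dots> = mpoly_subst h x p * mpoly_subst h x q"
    unfolding mpoly_subst_single monom_subst_add
    by (simp add: mpoly_subst_def sum_product hmult mult_ac)
  finally show ?thesis .
qed

end

lemma istopology_zariski:
  "istopology (\<lambda>U. \<exists>P\<subseteq>carrier (mpoly_ring n).
     U = affine_space n - zero_locus (\<lambda>c::'k::field. c) n P)"
  unfolding istopology_def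
proof (intro conjI allI impI)
  fix S T :: "(nat \<Rightarrow> 'k) set"
  assume "\<exists>P\<subseteq>carrier (mpoly_ring n). S = affine_space n - zero_locus (\<lambda>c. c) n P"
    and "\<exists>P\<subseteq>carrier (mpoly_ring n). T = affine_space n - zero_locus (\<lambda>c. c) n P"
  then obtain P Q where P: "P \<subseteq> carrier (mpoly_ring n)" "S = affine_space n - zero_locus (\<lambda>c. c) n P"
    and Q: "Q \<subseteq> carrier (mpoly_ring n)" "T = affine_space n - zero_locus (\<lambda>c. c) n Q"
    by blast
  let ?R = "{p * q | p q. p \<in> P \<and> q \<in> Q}"
  have "?R \<subseteq> carrier (mpoly_ring n)"
    using P(1) Q(1) mpoly_ring_mult_closed by blast
  moreover have "mpoly_subst (\<lambda>c. c) x (p * q) = mpoly_subst (\<lambda>c. c) x p * mpoly_subst (\<lambda>c. c) x q"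
    for x and p q :: "'k mpoly"
    by (rule mpoly_subst_mult) auto
  then have "S \<inter> T = affine_space n - zero_locus (\<lambda>c. c) n ?R"
    unfolding P(2) Q(2) zero_locus_def by fastforce
  ultimately show "\<exists>P\<subseteq>carrier (mpoly_ring n). S \<inter> T = affine_space n - zero_locus (\<lambda>c. c) n P"
    by blast
next
  fix \<K> :: "(nat \<Rightarrow> 'k) set set"
  assume "\<forall>K\<in>\<K>. \<exists>P\<subseteq>carrier (mpoly_ring n). K = affine_space n - zero_locus (\<lambda>c. c) n P"
  then obtain f where f: "\<And>K. K \<in> \<K> \<Longrightarrow> f K \<subseteq> carrier (mpoly_ring n)"
    "\<And>K. K \<in> \<K> \<Longrightarrow> K = affine_space n - zero_locus (\<lambda>c. c) n (f K)"
    by metis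
  have "\<Union>\<K> = (\<Union>K\<in>\<K>. affine_space n - zero_locus (\<lambda>c. c) n (f K))"
    using f(2) by auto
  also have "\<dots> = affine_space n - zero_locus (\<lambda>c. c) n (\<Union>(f ` \<K>))"
    by (auto simp: zero_locus_def)
  finally show "\<exists>P\<subseteq>carrier (mpoly_ring n). \<Union>\<K> = affine_space n - zero_locus (\<lambda>c. c) n P"
    using f(1) by (intro exI[of _ "\<Union>(f ` \<K>)"]) auto
qed

lemma topspace_zariski: "topspace (zariski n :: (nat \<Rightarrow> 'k::field) topology) = affine_space n"
proof -
  have "zero_locus (\<lambda>c::'k. c) n {1} = {}"
    by (simp add: zero_locus_def mpoly_subst_one)
  then have "openin (zariski n) (affine_space n :: (nat \<Rightarrow> 'k) set)"
    unfolding zariski_def topology_inverse'[OF istopology_zariski]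
    by (intro exI[of _ "{1}"]) (simp add: mpoly_ring_one_closed)
  moreover have "U \<subseteq> affine_space n" if "openin (zariski n) U" for U :: "(nat \<Rightarrow> 'k) set"
    using that unfolding zariski_def topology_inverse'[OF istopology_zariski] by blast
  ultimately show ?thesis
    unfolding topspace_def by blast
qed

lemma closedin_zariski:
  "closedin (zariski n) (Z :: (nat \<Rightarrow> 'k::field) set) \<longleftrightarrow>
     (\<exists>P\<subseteq>carrier (mpoly_ring n). Z = zero_locus (\<lambda>c. c) n P)"
proof -
  have sub: "zero_locus (\<lambda>c::'k. c) n P \<subseteq> affine_space n" for P
    by (auto simp: zero_locus_def)
  have "closedin (zariski n) Z \<longleftrightarrow> Z \<subseteq> affine_space n \<and>
      (\<exists>P\<subseteq>carrier (mpoly_ring n). affine_space n - Z = affine_space n - zero_locus (\<lambda>c. c) n P)"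
    unfolding closedin_def topspace_zariski
    unfolding zariski_def topology_inverse'[OF istopology_zariski] ..
  also have "\<dots> \<longleftrightarrow> (\<exists>P\<subseteq>carrier (mpoly_ring n). Z = zero_locus (\<lambda>c. c) n P)"
    using sub by (metis double_diff order_refl)
  finally show ?thesis .
qed

lemma vector_space_functions: "vector_space (\<lambda>(c::'k::field) v (i::'i). c * v i)"
  by unfold_locales (auto simp: fun_eq_iff algebra_simps)

end

theory Submission
  imports Defs
begin

text \<open>
  \<^bold>\<open>Rank drop.\<close> By the chain rule the Jacobian matrix of the \<open>R\<^sub>i\<close> at \<open>x\<close> is the product of the
  Jacobian matrix of the \<open>S\<^sub>i\<close>, of full row rank by (H2), and the one of \<open>\<Pi>\<^sub>1, \<dots>, \<Pi>\<^sub>s\<close>. If the product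
  drops rank, the rows of the latter are dependent, and a dependency is a nonzero univariate polynomial
  of degree less than \<open>s\<close> vanishing at all coordinates of \<open>x\<close>. So \<open>x\<close> has at most \<open>s - 1\<close> distinct
  coordinates and lies in a finite union of linear subspaces of dimension \<open>s - 1\<close>.

  \<^bold>\<open>Upper bounds for the dimension.\<close> Along a chain \<open>Z\<^sub>0 \<subset> \<dots> \<subset> Z\<^sub>k\<close> of irreducible sets, polynomials
  vanishing on \<open>Z\<^sub>i\<close> but not on \<open>Z\<^sub>i\<^sub>+\<^sub>1\<close> are algebraically independent on \<open>Z\<^sub>k\<close>. So the dimension of a set
  is at most \<open>e\<close> if its polynomial functions of degree at most \<open>t\<close> span a space of dimension
  \<open>O(t\<^sup>e)\<close>. For \<open>V\<^sub>r\<close> this holds with \<open>e = r - m\<close>: regularity of \<open>S\<^sub>1, \<dots>, S\<^sub>m\<close> bounds the growth of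
  \<open>\<bbbF>\<^sub>q[Y] / (S\<^sub>1, \<dots>, S\<^sub>m)\<close>, and every \<open>X\<^sub>i\<close> is a root of \<open>\<Prod>\<^sub>j (T - X\<^sub>j)\<close>.

  \<^bold>\<open>Smooth points.\<close> Let \<open>A\<close> be the polynomial ring over the algebraic closure, \<open>\<mm>\<close> the ideal of a
  point \<open>x\<close> of full rank, and for an ideal \<open>I\<close> consider the growth of \<open>dim A / (I + \<mm>\<^sup>j)\<close> in \<open>j\<close>.
  An ideal maximal among those with growth of order \<open>j\<^sup>e\<close> is prime, and adding an element of \<open>\<mm>\<close> lowers
  the order by at most one. This yields a chain of primes between \<open>(R\<^sub>1, \<dots>, R\<^sub>m)\<close> and \<open>\<mm>\<close> of length
  \<open>r - m\<close>, hence by the Nullstellensatz \<open>V\<^sub>r\<close> has local dimension \<open>r - m\<close> at \<open>x\<close>. A polynomial vanishing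
  on \<open>V\<^sub>r\<close> with differential at \<open>x\<close> independent of those of the \<open>R\<^sub>i\<close> would lie in such a prime of order
  \<open>r - m\<close> and force growth of order at most \<open>r - m - 1\<close>; so the tangent space at \<open>x\<close> has dimension \<open>r - m\<close>.
\<close>

section \<open>Substitution and derivatives\<close>

text \<open>Only inequalities between growth rates are used; neither Hilbert polynomials nor
  transcendence degrees occur. Polynomial functions on a set, filtered by degree, bound its Krull
  dimension from above. Over the finite coefficient field, residue classes of bounded weight modulo
  (S_1, ..., S_m) are counted: a dimension d shows up as the cardinality q^d, a non-zero-divisor as
  an injection on pairs of classes, and a spanning set over the finite field still spans after
  extension of scalars. The weight j of Y_j is the degree of \<Pi>_j, so weights in Y turn into
  degrees in X. At a point, growth of order e is demanded for infinitely many j only, since this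
  form passes to one of two summands; that is what makes maximal ideals prime. The obstacle at
  smooth points is that the singular locus refers to the full vanishing ideal over the closure,
  while the R_i are not known to generate a radical ideal. It is met by comparing growth rates,
  without determining that ideal.\<close>

abbreviation keys where "keys \<equiv> Poly_Mapping.keys"
abbreviation lookup where "lookup \<equiv> Poly_Mapping.lookup"
abbreviation single where "single \<equiv> Poly_Mapping.single"

abbreviation polys :: "nat \<Rightarrow> 'a::comm_ring_1 mpoly set" where
  "polys n \<equiv> carrier (mpoly_ring n)"

lemma comm_ring_hom_mpoly_subst:
  assumes "comm_ring_hom h"
  shows "comm_ring_hom (mpoly_subst h x)"
proof -
  interpret comm_ring_hom h by fact
  note hom = hom_zero hom_one hom_add hom_mult
  show ?thesis
    by unfold_locales
      (simp_all add: mpoly_subst_add[OF hom] mpoly_subst_mult[OF hom] mpoly_subst_one[OF hom]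
        mpoly_subst_zero[OF hom])
qed

lemma comm_ring_hom_Const: "comm_ring_hom Const"
  by unfold_locales (simp_all add: Const_def single_add mult_single)

lemma comm_ring_hom_ident: "comm_ring_hom (\<lambda>c. c)"
  by unfold_locales simp_all

lemma comm_ring_hom_to_ac: "comm_ring_hom to_ac"
  by unfold_locales simp_all

lemma comm_ring_hom_comp: "comm_ring_hom f \<Longrightarrow> comm_ring_hom g \<Longrightarrow> comm_ring_hom (\<lambda>x. f (g x))"
proof -
  assume "comm_ring_hom f" "comm_ring_hom g"
  then interpret f: comm_ring_hom f + g: comm_ring_hom g .
  show ?thesis by unfold_locales (simp_all add: g.hom_add f.hom_add g.hom_mult f.hom_mult
      g.hom_zero g.hom_one f.hom_zero f.hom_one)
qed

lemma mpoly_subst_single_hom: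
  assumes "comm_ring_hom h"
  shows "mpoly_subst h x (single \<alpha> c) = h c * (\<Prod>i\<in>keys \<alpha>. x i ^ lookup \<alpha> i)"
proof -
  interpret comm_ring_hom h by fact
  show ?thesis by (simp add: mpoly_subst_def hom_zero)
qed

lemma mpoly_subst_Var [simp]:
  assumes "comm_ring_hom h"
  shows "mpoly_subst h x (Var i) = x i"
proof -
  interpret comm_ring_hom h by fact
  show ?thesis by (simp add: Var_def mpoly_subst_single_hom[OF assms] hom_one)
qed

lemma mpoly_subst_Const [simp]:
  assumes "comm_ring_hom h"
  shows "mpoly_subst h x (Const c) = h c"
  by (simp add: Const_def mpoly_subst_single_hom[OF assms])

lemma mpoly_sum_single: "p = (\<Sum>\<alpha>\<in>keys p. single \<alpha> (lookup p \<alpha>))"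
  by (rule poly_mapping_eqI) (auto simp: lookup_sum lookup_single when_def in_keys_iff sum.delta')

lemma Var_power: "Var i ^ n = single (single i n) 1"
  by (induction n) (simp_all add: Var_def mult_single single_add[symmetric])

lemma single_eq_prod_Var:
  fixes c :: "'a::comm_ring_1"
  shows "single \<alpha> c = Const c * (\<Prod>i\<in>keys \<alpha>. Var i ^ lookup \<alpha> i)"
proof -
  have "(\<Prod>i\<in>I. Var i ^ lookup \<alpha> i) = (single (\<Sum>i\<in>I. single i (lookup \<alpha> i)) 1 :: 'a mpoly)" if "finite I" for I
    using that by induction (simp_all add: Var_power mult_single)
  moreover have "(\<Sum>i\<in>keys \<alpha>. single i (lookup \<alpha> i)) = \<alpha>"
    using mpoly_sum_single[of \<alpha>] by simp
  ultimately have "(\<Prod>i\<in>keys \<alpha>. Var i ^ lookup \<alpha> i) = (single \<alpha> 1 :: 'a mpoly)"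
    by simp
  then show ?thesis by (simp add: Const_def mult_single)
qed

section \<open>Polynomials in the first \<open>n\<close> variables\<close>

lemmas polys_add = mpoly_ring_add_closed
  and polys_uminus = mpoly_ring_uminus_closed
  and polys_mult = mpoly_ring_mult_closed
  and polys_0 = mpoly_ring_zero_closed
  and polys_1 = mpoly_ring_one_closed

lemma polys_diff: "p \<in> polys n \<Longrightarrow> q \<in> polys n \<Longrightarrow> p - q \<in> polys n"
  using polys_add[of p n "- q"] polys_uminus[of q n] by simp

lemma polys_Const: "Const c \<in> polys n"
  by (auto simp: Const_def carrier_mpoly_ring)

lemma polys_Var: "i \<in> {1..n} \<Longrightarrow> Var i \<in> polys n"
  by (auto simp: Var_def carrier_mpoly_ring)

lemma polys_single: "keys \<alpha> \<subseteq> {1..n} \<Longrightarrow> single \<alpha> c \<in> polys n"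
  by (auto simp: carrier_mpoly_ring)

lemma polys_sum: "(\<And>i. i \<in> I \<Longrightarrow> f i \<in> polys n) \<Longrightarrow> sum f I \<in> polys n"
  by (induction I rule: infinite_finite_induct) (auto intro: polys_0 polys_add)

lemma polys_prod: "(\<And>i. i \<in> I \<Longrightarrow> f i \<in> polys n) \<Longrightarrow> prod f I \<in> polys n"
  by (induction I rule: infinite_finite_induct) (auto intro: polys_1 polys_mult)

lemma polys_power: "p \<in> polys n \<Longrightarrow> p ^ k \<in> polys n"
  by (induction k) (auto intro: polys_1 polys_mult)

lemmas polys_intros = polys_0 polys_1 polys_add polys_uminus polys_diff polys_mult polys_Const
  polys_Var polys_sum polys_prod polys_power

lemma polys_mono: "m \<le> n \<Longrightarrow> polys m \<subseteq> polys n"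
  by (fastforce simp: carrier_mpoly_ring)

text \<open>Every monomial is a constant times powers of variables, so constants and variables
  generate \<open>polys n\<close>. Statements compatible with sums and products, such as agreement
  of two homomorphisms, reduce to a check on these generators.\<close>

lemma polys_induct [consumes 1, case_names Const Var add mult]:
  assumes "p \<in> polys n"
    and C: "\<And>c. P (Const c)" and V: "\<And>i. i \<in> {1..n} \<Longrightarrow> P (Var i)"
    and add: "\<And>p q. p \<in> polys n \<Longrightarrow> q \<in> polys n \<Longrightarrow> P p \<Longrightarrow> P q \<Longrightarrow> P (p + q)"
    and mult: "\<And>p q. p \<in> polys n \<Longrightarrow> q \<in> polys n \<Longrightarrow> P p \<Longrightarrow> P q \<Longrightarrow> P (p * q)"
  shows "P p"
proof -
  have C0: "P 0" and C1: "P 1"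
    using C[of 0] C[of 1] by (simp_all add: Const_def)
  have pow: "P (p ^ k)" if "p \<in> polys n" "P p" for p k
    by (induction k) (use that in \<open>auto simp: C1 intro: mult polys_power\<close>)
  have prd: "P (prod f I)" if "\<And>i. i \<in> I \<Longrightarrow> f i \<in> polys n \<and> P (f i)" for f and I :: "nat set"
    using that by (induction I rule: infinite_finite_induct) (auto simp: C1 intro!: mult polys_prod)
  have sm: "P (sum f I)" if "\<And>i. i \<in> I \<Longrightarrow> f i \<in> polys n \<and> P (f i)" for f and I :: "(nat \<Rightarrow>\<^sub>0 nat) set"
    using that by (induction I rule: infinite_finite_induct) (auto simp: C0 intro!: add polys_sum)
  have "P (single \<alpha> (lookup p \<alpha>)) \<and> single \<alpha> (lookup p \<alpha>) \<in> polys n" if "\<alpha> \<in> keys p" for \<alpha>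
  proof -
    have "keys \<alpha> \<subseteq> {1..n}" using assms(1) that by (auto simp: carrier_mpoly_ring)
    then show ?thesis unfolding single_eq_prod_Var
      by (intro conjI mult prd pow V polys_intros C) auto
  qed
  then show ?thesis
    by (subst mpoly_sum_single) (auto intro!: sm)
qed

lemma mpoly_hom_eq:
  assumes "p \<in> polys n" "comm_ring_hom f" "comm_ring_hom g"
    and "\<And>c. f (Const c) = g (Const c)" "\<And>i. i \<in> {1..n} \<Longrightarrow> f (Var i) = g (Var i)"
  shows "f p = g p"
proof -
  interpret f: comm_ring_hom f by fact
  interpret g: comm_ring_hom g by fact
  show ?thesis using assms(1)
    by (induction rule: polys_induct) (simp_all add: assms f.hom_add g.hom_add f.hom_mult g.hom_mult)
qed

lemma mpoly_subst_mpoly_subst: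
  assumes "comm_ring_hom h" "p \<in> polys n"
  shows "mpoly_subst h x (mpoly_subst Const g p) = mpoly_subst h (\<lambda>i. mpoly_subst h x (g i)) p"
  using assms(2) comm_ring_hom_comp[OF comm_ring_hom_mpoly_subst[OF assms(1)]
      comm_ring_hom_mpoly_subst[OF comm_ring_hom_Const]]
    comm_ring_hom_mpoly_subst[OF assms(1)]
  by (rule mpoly_hom_eq) (simp_all add: assms comm_ring_hom_Const)

lemma mpoly_subst_cong:
  assumes "comm_ring_hom h" "p \<in> polys n" "\<And>i. i \<in> {1..n} \<Longrightarrow> x i = y i"
  shows "mpoly_subst h x p = mpoly_subst h y p"
  using assms(2) comm_ring_hom_mpoly_subst[OF assms(1)] comm_ring_hom_mpoly_subst[OF assms(1)]
  by (rule mpoly_hom_eq) (simp_all add: assms)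

lemma mpoly_subst_Const_closed:
  assumes "p \<in> polys n" "\<And>i. i \<in> {1..n} \<Longrightarrow> g i \<in> polys k"
  shows "mpoly_subst Const g p \<in> polys k"
proof -
  interpret comm_ring_hom "mpoly_subst Const g"
    by (rule comm_ring_hom_mpoly_subst[OF comm_ring_hom_Const])
  show ?thesis using assms(1)
    by (induction rule: polys_induct)
      (auto simp: comm_ring_hom_Const hom_add hom_mult assms intro: polys_intros)
qed

section \<open>Formal partial derivatives and the chain rule\<close>

lemma mpoly_deriv_superset:
  assumes "finite A" "keys p \<subseteq> A"
  shows "mpoly_deriv j p = (\<Sum>\<alpha>\<in>A. single (\<alpha> - single j 1) (of_nat (lookup \<alpha> j) * lookup p \<alpha>))"
  unfolding mpoly_deriv_def using assms
  by (intro sum.mono_neutral_left) (auto simp: in_keys_iff)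

lemma mpoly_deriv_add: "mpoly_deriv j (p + q) = mpoly_deriv j p + mpoly_deriv j q"
  using mpoly_deriv_superset[of "keys p \<union> keys q" "p + q" j]
    mpoly_deriv_superset[of "keys p \<union> keys q" p j] mpoly_deriv_superset[of "keys p \<union> keys q" q j]
    Poly_Mapping.keys_add[of p q]
  by (simp add: lookup_add distrib_left single_add sum.distrib)

lemma mpoly_deriv_0 [simp]: "mpoly_deriv j 0 = 0"
  by (simp add: mpoly_deriv_def)

lemma mpoly_deriv_sum: "mpoly_deriv j (sum f I) = (\<Sum>i\<in>I. mpoly_deriv j (f i))"
  by (induction I rule: infinite_finite_induct) (simp_all add: mpoly_deriv_add)

lemma mpoly_deriv_single:
  "mpoly_deriv j (single \<alpha> c) = single (\<alpha> - single j 1) (of_nat (lookup \<alpha> j) * c)"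
  by (simp add: mpoly_deriv_def)

lemma mpoly_deriv_mult_single:
  "mpoly_deriv j (single \<alpha> c * single \<beta> d) =
     mpoly_deriv j (single \<alpha> c) * single \<beta> d + single \<alpha> c * mpoly_deriv j (single \<beta> d)"
proof -
  \<comment> \<open>Subtraction of exponents is truncated, so it commutes with addition only where
    the exponent of \<open>j\<close> is positive; elsewhere the factor \<open>of_nat 0\<close>
    removes the term.\<close>
  have minus: "\<gamma> - single j 1 + \<delta> = \<gamma> + \<delta> - single j (1::nat)" if "lookup \<gamma> j \<noteq> 0" for \<gamma> \<delta> :: "nat \<Rightarrow>\<^sub>0 nat"
    by (rule poly_mapping_eqI) (use that in \<open>auto simp: lookup_add lookup_minus lookup_single when_def\<close>)
  have \<alpha>: "single (\<alpha> - single j 1 + \<beta>) (of_nat (lookup \<alpha> j) * c * d) =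
      single (\<alpha> + \<beta> - single j 1) (of_nat (lookup \<alpha> j) * c * d)"
    by (cases "lookup \<alpha> j = 0") (simp_all add: minus[unfolded One_nat_def])
  have \<beta>: "single (\<alpha> + (\<beta> - single j 1)) (c * (of_nat (lookup \<beta> j) * d)) =
      single (\<alpha> + \<beta> - single j 1) (of_nat (lookup \<beta> j) * c * d)"
    using minus[of \<beta> \<alpha>, unfolded One_nat_def] by (cases "lookup \<beta> j = 0") (simp_all add: add.commute mult_ac)
  show ?thesis
    unfolding mpoly_deriv_single mult_single \<alpha> \<beta> single_add[symmetric]
    by (simp add: lookup_add algebra_simps)
qed

lemma mpoly_deriv_mult: "mpoly_deriv j (p * q) = mpoly_deriv j p * q + p * mpoly_deriv j q"
proof -
  have 1: "mpoly_deriv j (single \<alpha> c * q) = mpoly_deriv j (single \<alpha> c) * q + single \<alpha> c * mpoly_deriv j q" for \<alpha> c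
    by (subst (1 2 3) mpoly_sum_single[of q])
      (simp add: sum_distrib_left mpoly_deriv_sum mpoly_deriv_mult_single sum.distrib)
  show ?thesis
    by (subst (1 2 3) mpoly_sum_single[of p])
      (simp add: sum_distrib_right mpoly_deriv_sum 1 sum.distrib)
qed

lemma mpoly_deriv_Const [simp]: "mpoly_deriv j (Const c) = 0"
  by (simp add: Const_def mpoly_deriv_single)

lemma mpoly_deriv_Var [simp]: "mpoly_deriv j (Var i) = (if i = j then 1 else 0)"
  by (simp add: Var_def mpoly_deriv_single lookup_single)

lemma mpoly_deriv_closed: "p \<in> polys n \<Longrightarrow> mpoly_deriv j p \<in> polys n"
  by (induction rule: polys_induct)
    (auto simp: mpoly_deriv_add mpoly_deriv_mult intro: polys_intros)

lemma mpoly_deriv_notin_polys: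
  assumes "p \<in> polys n" "j \<notin> {1..n}"
  shows "mpoly_deriv j p = 0"
  using assms by (induction rule: polys_induct) (auto simp: mpoly_deriv_add mpoly_deriv_mult)

text \<open>Both sides are additive in \<open>p\<close> and satisfy the same product rule over the
  substitution homomorphism, hence agreement on constants and variables suffices.\<close>

lemma mpoly_deriv_chain:
  assumes h: "comm_ring_hom h" and "p \<in> polys n"
  shows "mpoly_subst h x (mpoly_deriv j (mpoly_subst Const g p)) =
    (\<Sum>l=1..n. mpoly_subst h (\<lambda>i. mpoly_subst h x (g i)) (mpoly_deriv l p) *
       mpoly_subst h x (mpoly_deriv j (g l)))"
proof -
  interpret sg: comm_ring_hom "mpoly_subst Const g"
    by (rule comm_ring_hom_mpoly_subst[OF comm_ring_hom_Const])
  interpret x: comm_ring_hom "mpoly_subst h x"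
    by (rule comm_ring_hom_mpoly_subst[OF h])
  interpret gx: comm_ring_hom "mpoly_subst h (\<lambda>i. mpoly_subst h x (g i))"
    by (rule comm_ring_hom_mpoly_subst[OF h])
  show ?thesis using assms(2)
  proof (induction rule: polys_induct)
    case (Const c)
    then show ?case by (simp add: comm_ring_hom_Const)
  next
    case (Var i)
    have "(\<Sum>l=1..n. mpoly_subst h (\<lambda>i. mpoly_subst h x (g i)) (mpoly_deriv l (Var i)) *
        mpoly_subst h x (mpoly_deriv j (g l))) =
      (\<Sum>l=1..n. if i = l then mpoly_subst h x (mpoly_deriv j (g l)) else 0)"
      by (intro sum.cong) auto
    with Var show ?case by (simp add: comm_ring_hom_Const)
  next
    case (add p q)
    then show ?case
      by (simp add: sg.hom_add x.hom_add gx.hom_add mpoly_deriv_add distrib_right sum.distrib)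
  next
    case (mult p q)
    then show ?case
      by (simp add: sg.hom_mult x.hom_mult x.hom_add gx.hom_add gx.hom_mult mpoly_deriv_mult
          mpoly_subst_mpoly_subst[OF h] distrib_right sum.distrib sum_distrib_left sum_distrib_right
          algebra_simps)
  qed
qed

text \<open>Two weights occur: the constant 1 gives the total degree, and \<open>w i = i\<close>
  counts \<open>Y_j\<close> as much as the elementary symmetric polynomial of degree
  \<open>j\<close>.\<close>

definition wdeg :: "(nat \<Rightarrow> nat) \<Rightarrow> (nat \<Rightarrow>\<^sub>0 nat) \<Rightarrow> nat" where
  "wdeg w \<alpha> = (\<Sum>i\<in>keys \<alpha>. w i * lookup \<alpha> i)"

lemma wdeg_superset:
  assumes "finite A" "keys \<alpha> \<subseteq> A"
  shows "wdeg w \<alpha> = (\<Sum>i\<in>A. w i * lookup \<alpha> i)"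
  unfolding wdeg_def using assms by (intro sum.mono_neutral_left) (auto simp: in_keys_iff)

lemma wdeg_add: "wdeg w (\<alpha> + \<beta>) = wdeg w \<alpha> + wdeg w \<beta>"
  using wdeg_superset[of "keys \<alpha> \<union> keys \<beta>" "\<alpha> + \<beta>" w] wdeg_superset[of "keys \<alpha> \<union> keys \<beta>" \<alpha> w]
    wdeg_superset[of "keys \<alpha> \<union> keys \<beta>" \<beta> w] Poly_Mapping.keys_add[of \<alpha> \<beta>]
  by (simp add: lookup_add distrib_left sum.distrib)

lemma wdeg_single [simp]: "wdeg w (single i n) = w i * n"
  by (simp add: wdeg_def)

lemma wdeg_0 [simp]: "wdeg w 0 = 0"
  by (simp add: wdeg_def)


section \<open>Growth of polynomial functions bounds the dimension\<close>

lemma (in vector_space) family_independent: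
  assumes "finite I" and *: "\<forall>c. (\<Sum>i\<in>I. scale (c i) (\<phi> i)) = 0 \<longrightarrow> (\<forall>i\<in>I. c i = 0)"
  shows "inj_on \<phi> I" "independent (\<phi> ` I)"
proof -
  show inj: "inj_on \<phi> I"
  proof (rule inj_onI, rule ccontr)
    fix i j assume ij: "i \<in> I" "j \<in> I" "\<phi> i = \<phi> j" "i \<noteq> j"
    let ?c = "\<lambda>l. if l = i then 1 else if l = j then - 1 else (0::'a)"
    have "(\<Sum>l\<in>I. scale (?c l) (\<phi> l)) = (\<Sum>l\<in>{i, j}. scale (?c l) (\<phi> l))"
      using ij assms(1) by (intro sum.mono_neutral_right) auto
    also have "\<dots> = 0" using ij by simp
    finally have "(\<Sum>l\<in>I. scale (?c l) (\<phi> l)) = 0" .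
    from *[THEN spec, THEN mp, OF this] ij(1) have "?c i = 0" by (rule bspec)
    then show False by simp
  qed
  show "independent (\<phi> ` I)"
  proof (rule independent_if_scalars_zero)
    fix f x assume "(\<Sum>x\<in>\<phi> ` I. scale (f x) x) = 0" and "x \<in> \<phi> ` I"
    then show "f x = 0" using *[rule_format, of "\<lambda>i. f (\<phi> i)"] by (auto simp: sum.reindex[OF inj])
  qed (use assms in auto)
qed

text \<open>An exchange bound for indexed families; injectivity of the family is itself a
  consequence of the coefficient condition.\<close>

lemma (in vector_space) family_card_le:
  assumes "finite I" "finite B" "\<And>i. i \<in> I \<Longrightarrow> \<phi> i \<in> span B"
    and *: "\<And>c i. (\<Sum>i\<in>I. scale (c i) (\<phi> i)) = 0 \<Longrightarrow> i \<in> I \<Longrightarrow> c i = 0"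
  shows "card I \<le> card B"
proof -
  have "\<forall>c. (\<Sum>i\<in>I. scale (c i) (\<phi> i)) = 0 \<longrightarrow> (\<forall>i\<in>I. c i = 0)"
    using * by blast
  note family_independent[OF assms(1) this]
  then show ?thesis
    using independent_span_bound[OF assms(2), of "\<phi> ` I"] assms(3) by (auto simp: card_image)
qed

lemma sum_fun_apply: "sum f A x = (\<Sum>a\<in>A. f a x)"
  by (induction A rule: infinite_finite_induct) simp_all

interpretation fun_vs: vector_space "\<lambda>(c::'k::field) v (i::'i). c * v i"
  by (rule vector_space_functions)

abbreviation ev :: "(nat \<Rightarrow> 'k::comm_ring_1) \<Rightarrow> 'k mpoly \<Rightarrow> 'k" where
  "ev \<equiv> mpoly_subst (\<lambda>c. c)"

interpretation ev: comm_ring_hom "ev x"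
  by (rule comm_ring_hom_mpoly_subst[OF comm_ring_hom_ident])

lemma ev_Const [simp]: "ev x (Const c) = c"
  by (simp add: comm_ring_hom_ident)

lemma ev_Var [simp]: "ev x (Var i) = x i"
  by (simp add: comm_ring_hom_ident)

abbreviation mdeg :: "(nat \<Rightarrow>\<^sub>0 nat) \<Rightarrow> nat" where
  "mdeg \<equiv> wdeg (\<lambda>_. 1)"

definition wdeg_le :: "(nat \<Rightarrow> nat) \<Rightarrow> 'a::comm_ring_1 mpoly \<Rightarrow> nat \<Rightarrow> bool" where
  "wdeg_le w p d \<longleftrightarrow> (\<forall>\<alpha>\<in>keys p. wdeg w \<alpha> \<le> d)"

lemma wdeg_le_mult:
  assumes "wdeg_le w p a" "wdeg_le w q b"
  shows "wdeg_le w (p * q) (a + b)"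
  unfolding wdeg_le_def
proof
  fix \<gamma> assume "\<gamma> \<in> keys (p * q)"
  then obtain \<alpha> \<beta> where "\<gamma> = \<alpha> + \<beta>" "\<alpha> \<in> keys p" "\<beta> \<in> keys q"
    using keys_mult[of p q] by blast
  then show "wdeg w \<gamma> \<le> a + b" using assms by (auto simp: wdeg_le_def wdeg_add intro!: add_mono)
qed

lemma wdeg_le_1: "wdeg_le w 1 0"
  by (auto simp: wdeg_le_def)

lemma wdeg_le_0: "wdeg_le w 0 d"
  by (auto simp: wdeg_le_def)

lemma wdeg_le_mono: "wdeg_le w p a \<Longrightarrow> a \<le> b \<Longrightarrow> wdeg_le w p b"
  by (auto simp: wdeg_le_def)

lemma wdeg_le_add: "wdeg_le w p a \<Longrightarrow> wdeg_le w q a \<Longrightarrow> wdeg_le w (p + q) a"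
  using Poly_Mapping.keys_add[of p q] by (auto simp: wdeg_le_def)

lemma wdeg_le_Const: "wdeg_le w (Const c) 0"
  by (auto simp: wdeg_le_def Const_def)

lemma wdeg_le_power: "wdeg_le w p a \<Longrightarrow> wdeg_le w (p ^ k) (k * a)"
  by (induction k) (auto simp: wdeg_le_1 intro: wdeg_le_mult)

lemma wdeg_le_exists: "\<exists>d. wdeg_le w p d"
proof -
  have "finite (wdeg w ` keys p)" by simp
  then show ?thesis unfolding wdeg_le_def
    by (metis Max_ge image_eqI)
qed

lemma ev_sum_keys: "ev x p = (\<Sum>\<alpha>\<in>keys p. lookup p \<alpha> * (\<Prod>i\<in>keys \<alpha>. x i ^ lookup \<alpha> i))"
  by (simp add: mpoly_subst_def)

lemma closedin_zariski_zeros: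
  assumes "p \<in> polys n"
  shows "closedin (zariski n) {x \<in> affine_space n. ev x p = (0::'k::field)}"
  unfolding closedin_zariski
  by (intro exI[of _ "{p}"]) (use assms in \<open>auto simp: zero_locus_def\<close>)

text \<open>Polynomial functions on an irreducible set have no zero divisors: the zero sets of the
  two factors are closed and cover \<open>Z\<close>.\<close>

lemma irreducible_vanishing:
  fixes Z :: "(nat \<Rightarrow> 'k::field) set"
  assumes irr: "irreducible_space (subtopology (zariski n) Z)" and Z: "Z \<subseteq> affine_space n"
    and p: "p \<in> polys n" and q: "q \<in> polys n"
    and pq: "\<And>x. x \<in> Z \<Longrightarrow> ev x (p * q) = 0"
  shows "(\<forall>x\<in>Z. ev x p = 0) \<or> (\<forall>x\<in>Z. ev x q = 0)"
proof -
  let ?A = "\<lambda>p. {x \<in> affine_space n. ev x p = 0} \<inter> Z"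
  have "closedin (subtopology (zariski n) Z) (?A p)" "closedin (subtopology (zariski n) Z) (?A q)"
    using closedin_zariski_zeros[OF p] closedin_zariski_zeros[OF q]
    by (auto simp: closedin_subtopology)
  moreover have "topspace (subtopology (zariski n) Z) = Z"
    using Z by (auto simp: topspace_zariski)
  moreover have "?A p \<union> ?A q = Z"
    using Z pq by (auto simp: ev.hom_mult)
  ultimately have or: "?A p = Z \<or> ?A q = Z"
    using irr unfolding irreducible_space_def by (elim conjE allE[of _ "?A p"] allE[of _ "?A q"]) simp
  have *: "\<forall>x\<in>Z. ev x p = 0" if "?A p = Z" for p
  proof
    fix x assume "x \<in> Z"
    then have "x \<in> ?A p" by (simp only: that)
    then show "ev x p = 0" by simp
  qed
  from or show ?thesis
  proof
    assume "?A p = Z"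
    from *[OF this] show ?thesis by (rule disjI1)
  next
    assume "?A q = Z"
    from *[OF this] show ?thesis by (rule disjI2)
  qed
qed

text \<open>Along a chain \<open>Z 0 \<subset> \<dots> \<subset> Z k\<close> of irreducible sets, polynomials \<open>f i\<close> vanishing on
  \<open>Z i\<close> but not on \<open>Z (i + 1)\<close> are algebraically independent as functions on \<open>Z k\<close>.\<close>

lemma chain_monomials_independent:
  fixes Z :: "nat \<Rightarrow> (nat \<Rightarrow> 'k::field) set" and f :: "nat \<Rightarrow> 'k mpoly"
    and T :: nat
  defines "L \<equiv> \<lambda>j. {as. set as \<subseteq> {..T} \<and> length as = j}"
    and "M \<equiv> \<lambda>as. \<Prod>i<length as. f i ^ (as ! i)"
  assumes irr: "\<And>i. i \<le> k \<Longrightarrow> irreducible_space (subtopology (zariski n) (Z i))"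
    and Z: "\<And>i. i \<le> k \<Longrightarrow> Z i \<subseteq> affine_space n" and chain: "\<And>i. i < k \<Longrightarrow> Z i \<subseteq> Z (Suc i)"
    and f: "\<And>i. i < k \<Longrightarrow> f i \<in> polys n" "\<And>i x. i < k \<Longrightarrow> x \<in> Z i \<Longrightarrow> ev x (f i) = 0"
      "\<And>i. i < k \<Longrightarrow> \<exists>x\<in>Z (Suc i). ev x (f i) \<noteq> 0"
  shows "j \<le> k \<Longrightarrow> (\<And>x. x \<in> Z j \<Longrightarrow> (\<Sum>as\<in>L j. c as * ev x (M as)) = 0) \<Longrightarrow> as \<in> L j \<Longrightarrow> c as = 0"
proof (induction j arbitrary: c as)
  case 0
  have "Z 0 \<noteq> {}"
    using irr[of 0] by (auto simp: irreducible_space_def)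
  then obtain x where "x \<in> Z 0" by blast
  with 0 show ?case by (simp add: L_def M_def cong: conj_cong)
next
  case (Suc j)
  have fin: "finite (L j)" for j
    unfolding L_def using finite_lists_length_eq[of "{..T}" j] by (simp add: conj_commute)
  have LSuc: "L (Suc j) = (\<lambda>(as, a). as @ [a]) ` (L j \<times> {..T})"
  proof (intro equalityI subsetI)
    fix as assume "as \<in> L (Suc j)"
    then show "as \<in> (\<lambda>(as, a). as @ [a]) ` (L j \<times> {..T})"
      by (cases as rule: rev_cases) (auto simp: L_def)
  qed (auto simp: L_def)
  have Mapp: "M (as @ [a]) = M as * f j ^ a" if "as \<in> L j" for as a
    using that by (auto simp: L_def M_def nth_append intro!: prod.cong)
  have Mpoly: "M as \<in> polys n" if "as \<in> L j" for as
    using that Suc.prems(1) f(1) by (auto simp: L_def M_def intro!: polys_prod polys_power)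
  \<comment> \<open>A relation one level up is regrouped as a polynomial in \<open>f j\<close>; its
    coefficients \<open>G a\<close> are combinations of monomials in the earlier
    polynomials.\<close>
  define G where "G = (\<lambda>a. \<Sum>as\<in>L j. Const (c (as @ [a])) * M as)"
  have Gpoly: "G a \<in> polys n" for a
    by (auto simp: G_def intro!: polys_intros Mpoly)
  have fp: "f j \<in> polys n" using f(1) Suc.prems(1) by simp
  have vanish: "ev x (\<Sum>a\<le>T. f j ^ a * G a) = 0" if "x \<in> Z (Suc j)" for x
  proof -
    have "inj_on (\<lambda>(as::nat list, a). as @ [a]) (L j \<times> {..T})" by (auto intro!: inj_onI)
    then have "0 = (\<Sum>(as, a)\<in>L j \<times> {..T}. c (as @ [a]) * ev x (M (as @ [a])))"
      using Suc.prems(2)[OF that] unfolding LSuc by (simp add: sum.reindex case_prod_unfold)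
    also have "\<dots> = (\<Sum>as\<in>L j. \<Sum>a\<le>T. c (as @ [a]) * ev x (M (as @ [a])))"
      by (simp add: sum.cartesian_product)
    also have "\<dots> = (\<Sum>a\<le>T. \<Sum>as\<in>L j. c (as @ [a]) * ev x (M (as @ [a])))"
      by (rule sum.swap)
    also have "\<dots> = (\<Sum>a\<le>T. ev x (f j ^ a * G a))"
      by (intro sum.cong refl) (simp add: G_def ev.hom_mult ev.hom_sum Mapp sum_distrib_left mult_ac)
    finally show ?thesis by (simp add: ev.hom_sum)
  qed
  have cancel: "\<forall>x\<in>Z (Suc j). ev x q = 0"
    if "q \<in> polys n" "\<And>x. x \<in> Z (Suc j) \<Longrightarrow> ev x (f j ^ a * q) = 0" for q a
  proof -
    have "(\<forall>x\<in>Z (Suc j). ev x (f j ^ a) = 0) \<or> (\<forall>x\<in>Z (Suc j). ev x q = 0)"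
      using Suc.prems(1) by (intro irreducible_vanishing[where n = n] irr Z that polys_power fp) auto
    moreover have "\<not> (\<forall>x\<in>Z (Suc j). ev x (f j ^ a) = 0)"
      using f(3)[of j] Suc.prems(1) by (auto simp: ev.hom_power)
    ultimately show ?thesis by blast
  qed
  \<comment> \<open>Coefficients are killed from the lowest power upwards: irreducibility of
    \<open>Z (Suc j)\<close> cancels \<open>f j ^ a\<close>, and restriction to \<open>Z j\<close>,
    where \<open>f j\<close> vanishes, isolates \<open>G a\<close> for the induction
    hypothesis.\<close>
  have zero: "\<forall>as\<in>L j. c (as @ [a]) = 0" if "a \<le> T" for a
    using that
  proof (induction a rule: less_induct)
    case (less a)
    have G0: "G a' = 0" if "a' < a" for a'
      using less that by (simp add: G_def Const_def)
    define H where "H = (\<Sum>b\<in>{Suc a..T}. f j ^ (b - Suc a) * G b)"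
    have "(\<Sum>b\<le>T. f j ^ b * G b) = (\<Sum>b\<in>{a..T}. f j ^ b * G b)"
      by (rule sum.mono_neutral_right) (auto simp: G0)
    also have "\<dots> = f j ^ a * G a + (\<Sum>b\<in>{Suc a..T}. f j ^ b * G b)"
      using less.prems by (simp add: sum.atLeast_Suc_atMost)
    also have "(\<Sum>b\<in>{Suc a..T}. f j ^ b * G b) = f j ^ a * (f j * H)"
      unfolding H_def sum_distrib_left
    proof (intro sum.cong refl)
      fix b assume "b \<in> {Suc a..T}"
      then have "b = a + Suc (b - Suc a)" by auto
      then have "f j ^ b = f j ^ a * (f j * f j ^ (b - Suc a))"
        by (metis power_add power_Suc)
      then show "f j ^ b * G b = f j ^ a * (f j * (f j ^ (b - Suc a) * G b))"
        by (simp add: mult.assoc)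
    qed
    finally have eq: "(\<Sum>b\<le>T. f j ^ b * G b) = f j ^ a * (G a + f j * H)"
      by (simp add: distrib_left)
    have Hpoly: "G a + f j * H \<in> polys n"
      unfolding H_def by (intro polys_intros Gpoly fp)
    have 0: "\<forall>x\<in>Z (Suc j). ev x (G a + f j * H) = 0"
      using vanish by (intro cancel Hpoly) (auto simp: eq)
    have "ev x (G a) = 0" if "x \<in> Z j" for x
    proof -
      have "x \<in> Z (Suc j)" using that chain[of j] Suc.prems(1) by auto
      with 0 have "ev x (G a + f j * H) = 0" by blast
      then show ?thesis using f(2)[of j x] that Suc.prems(1) by (simp add: ev.hom_add ev.hom_mult)
    qed
    then have 1: "(\<Sum>as\<in>L j. c (as @ [a]) * ev x (M as)) = 0" if "x \<in> Z j" for x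
      using that by (simp add: G_def ev.hom_sum ev.hom_mult)
    have "j \<le> k" using Suc.prems(1) by simp
    from Suc.IH[of "\<lambda>as. c (as @ [a])", OF this 1] show ?case by blast
  qed
  then show ?case using Suc.prems(3) unfolding LSuc by auto
qed

definition growth_le :: "nat \<Rightarrow> (nat \<Rightarrow> 'k::field) set \<Rightarrow> nat \<Rightarrow> bool" where
  "growth_le n W e \<longleftrightarrow> (\<exists>C. \<forall>t. \<exists>B. finite B \<and> card B \<le> C * (t + 1) ^ e \<and>
     (\<forall>\<alpha>. keys \<alpha> \<subseteq> {1..n} \<and> mdeg \<alpha> \<le> t \<longrightarrow>
       (\<exists>g\<in>fun_vs.span B. \<forall>x\<in>W. (\<Prod>i\<in>keys \<alpha>. x i ^ lookup \<alpha> i) = g x)))"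

text \<open>A chain of length \<open>k\<close> produces \<open>(T + 1) ^ k\<close> independent
  monomials in the separating polynomials, of degree at most \<open>k * T * d\<close>. The growth
  condition has room for \<open>O(T^e)\<close> of them, so \<open>k\<close> cannot exceed
  \<open>e\<close>.\<close>

lemma zdim_le_growth:
  fixes W :: "(nat \<Rightarrow> 'k::field) set"
  assumes W: "W \<subseteq> affine_space n" and growth: "growth_le n W e"
  shows "zdim n W \<le> ereal (real e)"
  unfolding zdim_def krull_dim_def
proof (rule Sup_least, clarify)
  fix k :: nat and Z
  assume Z: "\<forall>i\<le>k. closedin (subtopology (zariski n) W) (Z i) \<and>
      irreducible_space (subtopology (subtopology (zariski n) W) (Z i))"
    and chain: "\<forall>i<k. Z i \<subset> Z (Suc i)"
  have ZW: "Z i \<subseteq> W" if "i \<le> k" for i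
  proof -
    have "Z i \<subseteq> topspace (subtopology (zariski n) W)"
      using Z[rule_format, OF that] closedin_subset by blast
    then show ?thesis by simp
  qed
  have irr: "irreducible_space (subtopology (zariski n) (Z i))" if "i \<le> k" for i
    using Z[rule_format, OF that] by (simp add: subtopology_subtopology Int_absorb1[OF ZW[OF that]])
  have "\<exists>f. f \<in> polys n \<and> (\<forall>x\<in>Z i. ev x f = 0) \<and> (\<exists>x\<in>Z (Suc i). ev x f \<noteq> 0)" if i: "i < k" for i
  proof -
    have "closedin (subtopology (zariski n) W) (Z i)"
      using Z i by simp
    then obtain P where P: "P \<subseteq> polys n" "Z i = zero_locus (\<lambda>c. c) n P \<inter> W"
      unfolding closedin_subtopology closedin_zariski by blast
    obtain x where x: "x \<in> Z (Suc i)" "x \<notin> Z i" using chain i by blast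
    then have "x \<in> W" using ZW[of "Suc i"] i by auto
    with x P W obtain p where "p \<in> P" "ev x p \<noteq> 0" by (auto simp: zero_locus_def)
    with P x show ?thesis by (intro exI[of _ p]) (auto simp: zero_locus_def)
  qed
  then obtain f where f: "\<And>i. i < k \<Longrightarrow> f i \<in> polys n" "\<And>i x. i < k \<Longrightarrow> x \<in> Z i \<Longrightarrow> ev x (f i) = 0"
      "\<And>i. i < k \<Longrightarrow> \<exists>x\<in>Z (Suc i). ev x (f i) \<noteq> 0"
    by metis
  obtain d where d: "wdeg_le (\<lambda>_. 1) (f i) d" if "i < k" for i
  proof -
    have "\<forall>i. \<exists>d. wdeg_le (\<lambda>_. 1) (f i) d"
      using wdeg_le_exists by blast
    then obtain d' where d': "\<And>i. wdeg_le (\<lambda>_. 1) (f i) (d' i)"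
      by metis
    have "wdeg_le (\<lambda>_. 1) (f i) (\<Sum>i<k. d' i)" if "i < k" for i
      by (rule wdeg_le_mono[OF d']) (use that in \<open>auto intro: member_le_sum\<close>)
    then show ?thesis using that by blast
  qed
  define M where "M = (\<lambda>as. \<Prod>i<length as. f i ^ (as ! i))"
  have Mdeg: "wdeg_le (\<lambda>_. 1) (\<Prod>i<l. f i ^ (as ! i)) (l * T * d)" if "l \<le> length as" "set as \<subseteq> {..T}" "l \<le> k" for l as T
    using that
  proof (induction l)
    case (Suc l)
    have "as ! l \<in> set as" using Suc.prems by auto
    then have "as ! l \<in> {..T}" using Suc.prems(2) by blast
    then have "as ! l \<le> T" by simp
    then have "wdeg_le (\<lambda>_. 1) (f l ^ (as ! l)) (T * d)"
      using wdeg_le_power[OF d, of l "as ! l"] Suc.prems by (auto elim!: wdeg_le_mono)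
    then have "wdeg_le (\<lambda>_. 1) ((\<Prod>i<l. f i ^ (as ! i)) * f l ^ (as ! l)) (l * T * d + T * d)"
      using Suc by (intro wdeg_le_mult) auto
    moreover have "l * T * d + T * d = Suc l * T * d" by (simp add: algebra_simps)
    ultimately show ?case by simp
  qed (simp add: wdeg_le_1)
  obtain C where C: "\<And>t. \<exists>B. finite B \<and> card B \<le> C * (t + 1) ^ e \<and>
     (\<forall>\<alpha>. keys \<alpha> \<subseteq> {1..n} \<and> mdeg \<alpha> \<le> t \<longrightarrow>
       (\<exists>g\<in>fun_vs.span B. \<forall>x\<in>W. (\<Prod>i\<in>keys \<alpha>. x i ^ lookup \<alpha> i) = g x))"
    using growth unfolding growth_le_def by blast
  have bound: "(T + 1) ^ k \<le> C * (k * T * d + 1) ^ e" for T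
  proof -
    obtain B where B: "finite B" "card B \<le> C * (k * T * d + 1) ^ e"
      and Bspan: "\<And>\<alpha>. keys \<alpha> \<subseteq> {1..n} \<Longrightarrow> mdeg \<alpha> \<le> k * T * d \<Longrightarrow>
        \<exists>g\<in>fun_vs.span B. \<forall>x\<in>W. (\<Prod>i\<in>keys \<alpha>. x i ^ lookup \<alpha> i) = g x"
      using C[of "k * T * d"] by blast
    define L where "L = {as. set as \<subseteq> {..T} \<and> length as = k}"
    \<comment> \<open>Restriction to the largest member of the chain, extended by 0, turns agreement
      on \<open>Z k\<close> into equality of functions.\<close>
    define res where "res = (\<lambda>(g :: (nat \<Rightarrow> 'k) \<Rightarrow> 'k) x. if x \<in> Z k then g x else 0)"
    have resspan: "res g \<in> fun_vs.span (res ` B)" if "g \<in> fun_vs.span B" for g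
      using that
    proof (induction rule: fun_vs.span_induct_alt)
      case base
      have "res 0 = 0" by (auto simp: res_def)
      then show ?case by (metis fun_vs.span_zero)
    next
      case (step c x y)
      have "res ((\<lambda>i. c * x i) + y) = (\<lambda>i. c * res x i) + res y"
        by (auto simp: res_def)
      moreover have "(\<lambda>i. c * res x i) + res y \<in> fun_vs.span (res ` B)"
        by (intro fun_vs.span_add fun_vs.span_scale fun_vs.span_base imageI step)
      ultimately show ?case by (simp only:)
    qed
    have polyspan: "\<exists>g\<in>fun_vs.span B. \<forall>x\<in>W. ev x p = g x"
      if p: "p \<in> polys n" "wdeg_le (\<lambda>_. 1) p (k * T * d)" for p
    proof -
      have "\<forall>\<alpha>\<in>keys p. \<exists>g\<in>fun_vs.span B. \<forall>x\<in>W. (\<Prod>i\<in>keys \<alpha>. x i ^ lookup \<alpha> i) = g x"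
        using p by (intro ballI Bspan) (simp_all add: carrier_mpoly_ring wdeg_le_def)
      then obtain g where g: "\<And>\<alpha>. \<alpha> \<in> keys p \<Longrightarrow> g \<alpha> \<in> fun_vs.span B"
        "\<And>\<alpha> x. \<alpha> \<in> keys p \<Longrightarrow> x \<in> W \<Longrightarrow> (\<Prod>i\<in>keys \<alpha>. x i ^ lookup \<alpha> i) = g \<alpha> x"
        by metis
      have "(\<Sum>\<alpha>\<in>keys p. (\<lambda>x. lookup p \<alpha> * g \<alpha> x)) \<in> fun_vs.span B"
        by (intro fun_vs.span_sum fun_vs.span_scale g)
      moreover have "ev x p = (\<Sum>\<alpha>\<in>keys p. (\<lambda>x. lookup p \<alpha> * g \<alpha> x)) x" if "x \<in> W" for x
        using g(2) that by (simp add: ev_sum_keys sum_fun_apply)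
      ultimately show ?thesis by blast
    qed
    have "card L \<le> card (res ` B)"
    proof (rule fun_vs.family_card_le[where \<phi> = "\<lambda>as. res (\<lambda>x. ev x (M as))"])
      show "finite L"
        unfolding L_def using finite_lists_length_eq[of "{..T}" k] by (simp add: conj_commute)
      show "finite (res ` B)" using B by simp
      show "res (\<lambda>x. ev x (M as)) \<in> fun_vs.span (res ` B)" if "as \<in> L" for as
      proof -
        have "M as \<in> polys n"
          using that f(1) by (auto simp: L_def M_def intro!: polys_prod polys_power)
        moreover have "wdeg_le (\<lambda>_. 1) (M as) (k * T * d)"
          using Mdeg[of k as T] that by (auto simp: L_def M_def)
        ultimately obtain g where g: "g \<in> fun_vs.span B" "\<And>x. x \<in> W \<Longrightarrow> ev x (M as) = g x"
          using polyspan by blast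
        then have "res (\<lambda>x. ev x (M as)) = res g"
          using ZW[of k] by (auto simp: res_def fun_eq_iff)
        then show ?thesis using resspan[OF g(1)] by simp
      qed
      show "c as = 0" if "(\<Sum>as\<in>L. (\<lambda>x. c as * res (\<lambda>x. ev x (M as)) x)) = 0" "as \<in> L" for c as
      proof -
        have 0: "(\<Sum>as\<in>L. c as * ev x (M as)) = 0" if "x \<in> Z k" for x
          using fun_cong[OF \<open>(\<Sum>as\<in>L. (\<lambda>x. c as * res (\<lambda>x. ev x (M as)) x)) = 0\<close>, of x] that
          by (simp add: sum_fun_apply res_def)
        show ?thesis
          by (rule chain_monomials_independent[where Z = Z and k = k and f = f and n = n and T = T and j = k])
            (use irr ZW W chain f 0 \<open>as \<in> L\<close> in \<open>auto simp: L_def M_def\<close>)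
      qed
    qed
    also have "\<dots> \<le> card B" using B by (simp add: card_image_le)
    also note B(2)
    also have "card L = (T + 1) ^ k"
      unfolding L_def using card_lists_length_eq[of "{..T}" k] by (simp add: conj_commute)
    finally show ?thesis .
  qed
  show "ereal (real k) \<le> ereal (real e)"
  proof (rule ccontr)
    assume "\<not> ?thesis"
    then have ke: "e < k" by simp
    \<comment> \<open>\<open>K\<close> absorbs all constants: the bound is at most
      \<open>K * (T + 1) ^ e\<close>, and \<open>T = K\<close> contradicts it once
      \<open>k > e\<close>.\<close>
    define K where "K = C * (k * d + 1) ^ e"
    have "(K + 1) * (K + 1) ^ e \<le> (K + 1) ^ k"
      using ke power_increasing[of "Suc e" k "K + 1"] by simp
    also have "\<dots> \<le> C * (k * K * d + 1) ^ e" by (rule bound)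
    also have "\<dots> \<le> C * ((k * d + 1) * (K + 1)) ^ e"
      by (intro mult_left_mono power_mono) (auto simp: algebra_simps)
    also have "\<dots> = K * (K + 1) ^ e"
      unfolding power_mult_distrib K_def by (simp only: mult.assoc)
    finally show False by simp
  qed
qed


section \<open>The Nullstellensatz for prime ideals\<close>

text \<open>Phrased with the operations of the type rather than those of the ring record;
  \<open>poly_ideal_iff_ideal\<close> identifies the two notions.\<close>

definition poly_ideal :: "nat \<Rightarrow> 'k::comm_ring_1 mpoly set \<Rightarrow> bool" where
  "poly_ideal n I \<longleftrightarrow> I \<subseteq> polys n \<and> 0 \<in> I \<and> (\<forall>p\<in>I. \<forall>q\<in>I. p + q \<in> I) \<and> (\<forall>p\<in>I. \<forall>q\<in>polys n. q * p \<in> I)"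

definition poly_prime :: "nat \<Rightarrow> 'k::comm_ring_1 mpoly set \<Rightarrow> bool" where
  "poly_prime n P \<longleftrightarrow> poly_ideal n P \<and> 1 \<notin> P \<and> (\<forall>p\<in>polys n. \<forall>q\<in>polys n. p * q \<in> P \<longrightarrow> p \<in> P \<or> q \<in> P)"

lemma poly_idealD:
  assumes "poly_ideal n I"
  shows "I \<subseteq> polys n" "0 \<in> I" "\<And>p q. p \<in> I \<Longrightarrow> q \<in> I \<Longrightarrow> p + q \<in> I"
    "\<And>p q. p \<in> I \<Longrightarrow> q \<in> polys n \<Longrightarrow> q * p \<in> I" "\<And>p q. p \<in> I \<Longrightarrow> q \<in> polys n \<Longrightarrow> p * q \<in> I"
    "\<And>p. p \<in> I \<Longrightarrow> - p \<in> I" "\<And>p q. p \<in> I \<Longrightarrow> q \<in> I \<Longrightarrow> p - q \<in> I"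
proof -
  show 1: "I \<subseteq> polys n" "0 \<in> I" "\<And>p q. p \<in> I \<Longrightarrow> q \<in> I \<Longrightarrow> p + q \<in> I"
    and 4: "\<And>p q. p \<in> I \<Longrightarrow> q \<in> polys n \<Longrightarrow> q * p \<in> I"
    using assms by (auto simp: poly_ideal_def)
  then show "p * q \<in> I" if "p \<in> I" "q \<in> polys n" for p q
    using that by (subst mult.commute) blast
  have "-1 \<in> polys n" by (intro polys_uminus polys_1)
  then show 6: "- p \<in> I" if "p \<in> I" for p
    using 4[OF that, of "-1"] by simp
  show "p - q \<in> I" if "p \<in> I" "q \<in> I" for p q
    using 1(3)[OF that(1) 6[OF that(2)]] by simp
qed

lemma poly_ideal_sum:
  assumes "poly_ideal n I" "\<And>i. i \<in> A \<Longrightarrow> f i \<in> I"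
  shows "sum f A \<in> I"
  using assms(2) poly_idealD(2,3)[OF assms(1)] by (induction A rule: infinite_finite_induct) auto

lemma poly_primeD:
  assumes "poly_prime n P"
  shows "poly_ideal n P" "1 \<notin> P" "\<And>p q. p \<in> polys n \<Longrightarrow> q \<in> polys n \<Longrightarrow> p * q \<in> P \<Longrightarrow> p \<in> P \<or> q \<in> P"
  using assms by (auto simp: poly_prime_def)

lemma poly_prime_power:
  assumes P: "poly_prime n P" and p: "p \<in> polys n" "p ^ k \<in> P"
  shows "p \<in> P"
  using p(2) by (induction k) (use poly_primeD[OF P] p in \<open>auto dest: poly_primeD(3)[OF P p(1) polys_power[OF p(1)]]\<close>)

text \<open>An element of \<open>polys (Suc n)\<close> is represented by a univariate polynomial
  over the type of all multivariate polynomials, to be evaluated at the last variable.\<close>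

definition coeffs_in :: "nat \<Rightarrow> 'k::comm_ring_1 mpoly poly \<Rightarrow> bool" where
  "coeffs_in n G \<longleftrightarrow> (\<forall>j. coeff G j \<in> polys n)"

abbreviation last_eval :: "nat \<Rightarrow> 'k::comm_ring_1 mpoly poly \<Rightarrow> 'k mpoly" where
  "last_eval n G \<equiv> poly G (Var (Suc n))"

lemma coeffs_in_intros:
  "coeffs_in n 0" "coeffs_in n G \<Longrightarrow> coeffs_in n H \<Longrightarrow> coeffs_in n (G + H)"
  "coeffs_in n G \<Longrightarrow> coeffs_in n H \<Longrightarrow> coeffs_in n (G - H)"
  "coeffs_in n G \<Longrightarrow> coeffs_in n H \<Longrightarrow> coeffs_in n (G * H)"
  "c \<in> polys n \<Longrightarrow> coeffs_in n G \<Longrightarrow> coeffs_in n (smult c G)"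
  "c \<in> polys n \<Longrightarrow> coeffs_in n (monom c d)"
  by (auto simp: coeffs_in_def coeff_mult intro!: polys_intros)

lemma last_eval_closed:
  assumes "coeffs_in n G"
  shows "last_eval n G \<in> polys (Suc n)"
  unfolding poly_altdef
  using assms polys_mono[of n "Suc n"]
  by (intro polys_sum polys_mult polys_power polys_Var) (auto simp: coeffs_in_def)

lemma last_eval_exists:
  assumes "p \<in> polys (Suc n)"
  obtains G where "coeffs_in n G" "last_eval n G = p"
proof -
  have "\<exists>G. coeffs_in n G \<and> last_eval n G = p" using assms
  proof (induction rule: polys_induct)
    case (Const c)
    show ?case by (rule exI[of _ "monom (Const c) 0"]) (simp add: coeffs_in_intros polys_Const poly_monom)
  next
    case (Var i)
    show ?case
    proof (cases "i = Suc n")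
      case True
      then show ?thesis
        by (intro exI[of _ "monom 1 1"]) (simp add: coeffs_in_intros polys_1 poly_monom)
    next
      case False
      with Var show ?thesis
        by (intro exI[of _ "monom (Var i) 0"] conjI coeffs_in_intros polys_Var) (auto simp: poly_monom)
    qed
  next
    case (add p q)
    then obtain G H where "coeffs_in n G \<and> last_eval n G = p" "coeffs_in n H \<and> last_eval n H = q"
      by blast
    then show ?case by (intro exI[of _ "G + H"]) (auto intro: coeffs_in_intros)
  next
    case (mult p q)
    then obtain G H where "coeffs_in n G \<and> last_eval n G = p" "coeffs_in n H \<and> last_eval n H = q"
      by blast
    then show ?case by (intro exI[of _ "G * H"]) (auto intro: coeffs_in_intros)
  qed
  with that show ?thesis by blast
qed

lemma last_eval_in_ideal:
  assumes "poly_ideal (Suc n) P" "coeffs_in n G" "\<And>j. coeff G j \<in> P"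
  shows "last_eval n G \<in> P"
  unfolding poly_altdef
  by (intro poly_ideal_sum[OF assms(1)] poly_idealD(5)[OF assms(1)] polys_power polys_Var assms) auto

lemma ev_last_eval:
  assumes "coeffs_in n G"
  shows "ev (x(Suc n := t)) (last_eval n G) = poly (map_poly (ev x) G) t"
proof -
  let ?x = "x(Suc n := t)"
  have *: "poly (map_poly (ev ?x) G) (ev ?x p) = ev ?x (poly G p)" for G p
    by (induction G) (simp_all add: map_poly_pCons ev.hom_add ev.hom_mult ev.hom_zero)
  have "map_poly (ev ?x) G = map_poly (ev x) G"
  proof (rule poly_eqI)
    fix j
    show "coeff (map_poly (ev ?x) G) j = coeff (map_poly (ev x) G) j"
      using assms by (auto simp: coeffs_in_def ev.hom_zero coeff_map_poly
          intro!: mpoly_subst_cong[OF comm_ring_hom_ident, of _ n])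
  qed
  then show ?thesis using *[of G "Var (Suc n)"] by simp
qed

lemma strip_leading_coeffs:
  assumes P: "poly_ideal (Suc n) P" and J: "poly_ideal (Suc n) J" and "P \<subseteq> J"
    and K: "coeffs_in n K" "last_eval n K \<in> J" "\<exists>j. coeff K j \<notin> P"
  obtains K' where "coeffs_in n K'" "last_eval n K' \<in> J" "lead_coeff K' \<notin> P" "degree K' \<le> degree K"
proof -
  have "\<exists>K'. coeffs_in n K' \<and> last_eval n K' \<in> J \<and> lead_coeff K' \<notin> P \<and> degree K' \<le> degree K"
    using K
  proof (induction "degree K" arbitrary: K rule: less_induct)
    case less
    show ?case
    proof (cases "lead_coeff K \<in> P")
      case True
      define K1 where "K1 = K - monom (lead_coeff K) (degree K)"
      have lc: "lead_coeff K \<in> polys n" using less.prems by (auto simp: coeffs_in_def)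
      have "monom (lead_coeff K) (degree K) = smult (lead_coeff K) (monom 1 (degree K))"
        by (simp add: smult_monom)
      then have "last_eval n (monom (lead_coeff K) (degree K)) \<in> P"
        using True by (auto simp: poly_monom intro!: poly_idealD(5)[OF P] polys_power polys_Var)
      then have K1J: "last_eval n K1 \<in> J"
        unfolding K1_def poly_diff using \<open>P \<subseteq> J\<close> less.prems by (intro poly_idealD(7)[OF J]) auto
      obtain j where j: "coeff K j \<notin> P" using less.prems by blast
      then have "j \<noteq> degree K" using True by auto
      moreover have "j \<le> degree K" using j poly_idealD(2)[OF P] by (metis coeff_eq_0 not_less)
      ultimately have j': "coeff K1 j \<notin> P" "j < degree K" using j by (auto simp: K1_def coeff_monom)
      have "degree K1 \<le> degree K"
        unfolding K1_def by (intro degree_diff_le) (auto simp: degree_monom_le)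
      moreover have "coeff K1 (degree K) = 0" by (simp add: K1_def)
      ultimately have "degree K1 < degree K"
        using j'(2) by (metis (no_types, lifting) eq_zero_or_degree_less gr_implies_not0 le_neq_implies_less degree_0 not_gr_zero)
      moreover have "coeffs_in n K1" unfolding K1_def using less.prems lc by (intro coeffs_in_intros)
      ultimately obtain K' where "coeffs_in n K' \<and> last_eval n K' \<in> J \<and> lead_coeff K' \<notin> P \<and> degree K' \<le> degree K1"
        using less.hyps[of K1] K1J j'(1) by blast
      then show ?thesis using \<open>degree K1 \<le> degree K\<close> by (intro exI[of _ K']) auto
    qed (use less.prems in blast)
  qed
  with that show ?thesis by blast
qed

text \<open>The leading coefficient of \<open>H\<close> may fail to be invertible, so each division
  step first multiplies by it; \<open>N\<close> counts the steps. The bound on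
  \<open>degree Q\<close> lets minimality of a degree be applied to the quotient.\<close>

lemma pseudo_division:
  assumes H: "coeffs_in n H" "0 < degree H" and "coeffs_in n G"
  obtains N Q R where "coeffs_in n Q" "coeffs_in n R" "smult (lead_coeff H ^ N) G = H * Q + R"
    "degree R < degree H" "degree Q \<le> degree G - degree H"
proof -
  let ?b = "lead_coeff H"
  have b: "?b \<in> polys n" using H by (auto simp: coeffs_in_def)
  have "\<exists>N Q R. coeffs_in n Q \<and> coeffs_in n R \<and> smult (?b ^ N) G = H * Q + R \<and>
    degree R < degree H \<and> degree Q \<le> degree G - degree H"
    using assms(3)
  proof (induction "degree G" arbitrary: G rule: less_induct)
    case less
    show ?case
    proof (cases "degree G < degree H")
      case True
      then show ?thesis using less.prems
        by (intro exI[of _ 0] exI[of _ G] exI[of _ "0::_ poly"]) (simp add: coeffs_in_intros)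
    next
      case False
      let ?M = "monom (lead_coeff G) (degree G - degree H)"
      define G1 where "G1 = smult ?b G - H * ?M"
      have lc: "lead_coeff G \<in> polys n" using less.prems by (auto simp: coeffs_in_def)
      have G1: "coeffs_in n G1" unfolding G1_def using H less.prems b lc by (intro coeffs_in_intros)
      have dM: "degree (H * ?M) \<le> degree G"
        using degree_mult_le[of H ?M] degree_monom_le[of "lead_coeff G" "degree G - degree H"] False by linarith
      have "degree G1 \<le> degree G"
        unfolding G1_def using dM degree_smult_le[of ?b G] by (intro degree_diff_le) auto
      moreover have "coeff G1 (degree G) = 0"
        using False coeff_mult_degree_sum[of H ?M] coeff_monom_mult[of "lead_coeff G" "degree G - degree H" H "degree G"]
        by (simp add: G1_def mult.commute[of H])
      ultimately have less1: "degree G1 < degree G"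
        using False H(2) by (metis (no_types, lifting) eq_zero_or_degree_less gr_implies_not0 le_neq_implies_less degree_0 not_gr_zero)
      then obtain N Q R where NQR: "coeffs_in n Q" "coeffs_in n R" "smult (?b ^ N) G1 = H * Q + R"
        "degree R < degree H" "degree Q \<le> degree G1 - degree H"
        using less.hyps[OF less1 G1] by blast
      let ?Q = "Q + smult (?b ^ N) ?M"
      have "smult (?b ^ Suc N) G = smult (?b ^ N) (G1 + H * ?M)"
        by (simp add: G1_def mult.commute)
      also have "\<dots> = H * ?Q + R"
        using NQR(3) by (simp add: smult_add_right algebra_simps)
      finally have "smult (?b ^ Suc N) G = H * ?Q + R" .
      moreover have "coeffs_in n ?Q" using NQR b lc by (intro coeffs_in_intros polys_power)
      moreover have "degree ?Q \<le> degree G - degree H"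
        using NQR(5) less1 degree_smult_le[of "?b ^ N" ?M] degree_monom_le[of "lead_coeff G" "degree G - degree H"]
        by (intro degree_add_le) linarith+
      ultimately show ?thesis using NQR by blast
    qed
  qed
  with that show ?thesis by blast
qed

text \<open>Over a finite field the product of all \<open>T - a\<close> takes the value 0
  everywhere, so adding 1 gives a nonconstant polynomial without roots.\<close>

lemma infinite_alg_closed: "infinite (UNIV :: 'k::alg_closed_field set)"
proof
  assume fin: "finite (UNIV :: 'k set)"
  define p where "p = (\<Prod>a\<in>(UNIV :: 'k set). [:- a, 1:]) + 1"
  have d: "degree (\<Prod>a\<in>(UNIV :: 'k set). [:- a, 1:]) = card (UNIV :: 'k set)"
    by (subst degree_prod_eq_sum_degree) auto
  have "0 < card (UNIV :: 'k set)" using fin by (simp add: card_gt_0_iff)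
  then have "degree p > 0" unfolding p_def using d by (subst degree_add_eq_left) auto
  then obtain x where "poly p x = 0" using alg_closed_imp_poly_has_root by blast
  moreover have "poly p x = 1" using fin by (auto simp: p_def poly_prod)
  ultimately show False by simp
qed

text \<open>Projection along the last coordinate: away from the zeros of \<open>u\<close>, a zero of
  the contracted ideal extends to a zero of \<open>P\<close> at which \<open>f\<close> is nonzero.
  Modulo \<open>P\<close> the last variable is either transcendental, and all but finitely many
  values \<open>t\<close> serve, or algebraic over the fractions of the contracted quotient, and a
  root \<open>t\<close> of its minimal polynomial serves. In the second case \<open>u\<close>
  collects the denominators.\<close>

lemma nullstellensatz_step:
  fixes P :: "'k::alg_closed_field mpoly set"
  assumes P: "poly_prime (Suc n) P" and f: "f \<in> polys (Suc n)" "f \<notin> P"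
  obtains u where "u \<in> polys n" "u \<notin> P"
    "\<And>x. (\<And>q. q \<in> P \<inter> polys n \<Longrightarrow> ev x q = 0) \<Longrightarrow> ev x u \<noteq> 0 \<Longrightarrow>
      \<exists>t. (\<forall>q\<in>P. ev (x(Suc n := t)) q = 0) \<and> ev (x(Suc n := t)) f \<noteq> 0"
proof -
  note PI = poly_primeD(1)[OF P] note PD = poly_idealD[OF PI]
  have up: "p \<in> polys (Suc n)" if "p \<in> polys n" for p :: "'k mpoly" using polys_mono[of n "Suc n"] that by auto
  have npow: "a ^ N \<notin> P" if "a \<in> polys (Suc n)" "a \<notin> P" for a N
    using poly_prime_power[OF P] that by blast
  obtain F where F: "coeffs_in n F" "last_eval n F = f" using last_eval_exists[OF f(1)] .
  let ?map = "\<lambda>x. map_poly (ev x) :: 'k mpoly poly \<Rightarrow> 'k poly"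
  have cf: "coeff (?map x G) j = ev x (coeff G j)" for x G j by (simp add: coeff_map_poly)
  have map0: "?map x K = 0" if "coeffs_in n K" "\<And>j. coeff K j \<in> P" "\<And>q. q \<in> P \<inter> polys n \<Longrightarrow> ev x q = 0" for x K
    by (rule poly_eqI) (use that in \<open>auto simp: cf coeffs_in_def\<close>)
  show ?thesis
  proof (cases "\<exists>G. coeffs_in n G \<and> last_eval n G \<in> P \<and> lead_coeff G \<notin> P")
    \<comment> \<open>No relation for the last variable holds modulo \<open>P\<close>: every element
      of \<open>P\<close> has all its coefficients in \<open>P\<close>, and any \<open>t\<close>
      that is not a root of \<open>F\<close> at \<open>x\<close> works.\<close>
    case False
    have all: "coeff K j \<in> P" if K: "coeffs_in n K" "last_eval n K \<in> P" for K j
      using strip_leading_coeffs[OF PI PI order_refl K] False by blast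
    obtain j where j: "coeff F j \<notin> P" using last_eval_in_ideal[OF PI F(1)] F(2) f(2) by blast
    show ?thesis
    proof (rule that[of "coeff F j"])
      show "coeff F j \<in> polys n" using F(1) by (simp add: coeffs_in_def)
      fix x :: "nat \<Rightarrow> 'k" assume x: "\<And>q. q \<in> P \<inter> polys n \<Longrightarrow> ev x q = 0" "ev x (coeff F j) \<noteq> 0"
      have "?map x F \<noteq> 0" using x(2) cf[of x F j] by auto
      then have "finite {t. poly (?map x F) t = 0}" by (rule poly_roots_finite)
      then obtain t where t: "poly (?map x F) t \<noteq> 0"
        using infinite_alg_closed by (metis (mono_tags, lifting) UNIV_eq_I mem_Collect_eq)
      have "ev (x(Suc n := t)) q = 0" if q: "q \<in> P" for q
      proof -
        obtain K where K: "coeffs_in n K" "last_eval n K = q" using last_eval_exists q PD(1) by blast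
        show ?thesis using map0[OF K(1) all[OF K(1)] x(1)] K(2) q ev_last_eval[OF K(1), of x t] by auto
      qed
      then show "\<exists>t. (\<forall>q\<in>P. ev (x(Suc n := t)) q = 0) \<and> ev (x(Suc n := t)) f \<noteq> 0"
        using t ev_last_eval[OF F(1), of x t] F(2) by metis
    qed (use j in auto)
  next
    case True
    \<comment> \<open>Up to denominators, \<open>G\<close> is the minimal polynomial of the last
      variable modulo \<open>P\<close>.\<close>
    define G where "G = arg_min degree (\<lambda>G. coeffs_in n G \<and> last_eval n G \<in> P \<and> lead_coeff G \<notin> P)"
    have G: "coeffs_in n G" "last_eval n G \<in> P" "lead_coeff G \<notin> P"
      using True arg_min_natI[of "\<lambda>G. coeffs_in n G \<and> last_eval n G \<in> P \<and> lead_coeff G \<notin> P" _ degree]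
      unfolding G_def by blast+
    have Gmin: "degree G \<le> degree K" if "coeffs_in n K" "last_eval n K \<in> P" "lead_coeff K \<notin> P" for K
      unfolding G_def using that by (intro arg_min_nat_le) auto
    have min: "coeff K j \<in> P" if K: "coeffs_in n K" "last_eval n K \<in> P" "degree K < degree G" for K j
    proof (rule ccontr)
      assume "coeff K j \<notin> P"
      then obtain K' where "coeffs_in n K'" "last_eval n K' \<in> P" "lead_coeff K' \<notin> P" "degree K' \<le> degree K"
        using strip_leading_coeffs[OF PI PI order_refl K(1,2)] by blast
      then show False using Gmin[of K'] K(3) by linarith
    qed
    have dG: "0 < degree G"
    proof (rule ccontr)
      assume "\<not> 0 < degree G"
      then obtain c where "G = [:c:]" by (metis degree_eq_zeroE gr_zeroI)
      then show False using G by auto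
    qed
    define a where "a = lead_coeff G"
    have a: "a \<in> polys n" "a \<in> polys (Suc n)" "a \<notin> P"
      using G up by (auto simp: a_def coeffs_in_def)
    \<comment> \<open>The ideal generated by \<open>P\<close> and \<open>f\<close>. Inverting
      \<open>f\<close> modulo \<open>P\<close> amounts to finding in it an element \<open>b\<close>
      of \<open>polys n\<close> outside \<open>P\<close>.\<close>
    define J where "J = {p \<in> polys (Suc n). \<exists>w\<in>polys (Suc n). p - f * w \<in> P}"
    have J: "poly_ideal (Suc n) J"
      unfolding poly_ideal_def
    proof (intro conjI ballI)
      show "0 \<in> J" unfolding J_def using PD(2) by (auto intro!: bexI[of _ 0] polys_0)
    next
      fix p q assume "p \<in> J" "q \<in> J"
      then obtain v w where vw: "p \<in> polys (Suc n)" "q \<in> polys (Suc n)" "v \<in> polys (Suc n)" "w \<in> polys (Suc n)"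
        "p - f * v \<in> P" "q - f * w \<in> P" by (auto simp: J_def)
      have "p + q - f * (v + w) \<in> P" using PD(3)[OF vw(5,6)] by (simp add: algebra_simps)
      with vw show "p + q \<in> J" unfolding J_def by (auto intro!: polys_add bexI[of _ "v + w"])
    next
      fix p q :: "'k mpoly" assume "p \<in> J" "q \<in> polys (Suc n)"
      then obtain v where v: "p \<in> polys (Suc n)" "q \<in> polys (Suc n)" "v \<in> polys (Suc n)" "p - f * v \<in> P"
        by (auto simp: J_def)
      have "q * p - f * (q * v) \<in> P" using PD(4)[OF v(4,2)] by (simp add: algebra_simps)
      with v show "q * p \<in> J" unfolding J_def by (auto intro!: polys_mult bexI[of _ "q * v"])
    qed (auto simp: J_def)
    note JD = poly_idealD[OF J]
    have PJ: "P \<subseteq> J" unfolding J_def using PD(1) by (auto intro!: bexI[of _ 0] polys_0)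
    have fJ: "f \<in> J" unfolding J_def using f PD(2) by (auto intro!: bexI[of _ 1] polys_1)
    obtain N S F1 where F1: "coeffs_in n S" "coeffs_in n F1" "smult (a ^ N) F = G * S + F1" "degree F1 < degree G"
      using pseudo_division[OF G(1) dG F(1)] unfolding a_def by metis
    have "last_eval n (smult (a ^ N) F) = last_eval n (G * S + F1)" using F1(3) by simp
    then have eqF1: "last_eval n F1 = a ^ N * f - last_eval n G * last_eval n S"
      using F(2) by (simp add: algebra_simps)
    have GS: "last_eval n G * last_eval n S \<in> P" using G(2) last_eval_closed[OF F1(1)] by (rule PD(5))
    have "last_eval n F1 \<in> J" unfolding eqF1
      by (rule JD(7)[OF JD(4)[OF fJ polys_power[OF a(2)]] subsetD[OF PJ GS]])
    moreover have "last_eval n F1 \<notin> P"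
    proof
      assume "last_eval n F1 \<in> P"
      then have "a ^ N * f \<in> P" using PD(3)[OF _ GS] eqF1 by (metis diff_add_cancel)
      then show False using poly_primeD(3)[OF P polys_power[OF a(2)] f(1)] npow[OF a(2,3)] f(2) by blast
    qed
    ultimately obtain H0 where H0: "coeffs_in n H0" "last_eval n H0 \<in> J" "lead_coeff H0 \<notin> P" "degree H0 < degree G"
      using strip_leading_coeffs[OF PI J PJ F1(2)] last_eval_in_ideal[OF PI F1(2)] F1(4) by (metis le_less_trans)
    define H where "H = arg_min degree (\<lambda>H. coeffs_in n H \<and> last_eval n H \<in> J \<and> lead_coeff H \<notin> P)"
    have H: "coeffs_in n H" "last_eval n H \<in> J" "lead_coeff H \<notin> P"
      using H0 arg_min_natI[of "\<lambda>H. coeffs_in n H \<and> last_eval n H \<in> J \<and> lead_coeff H \<notin> P" H0 degree]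
      unfolding H_def by blast+
    have Hmin: "degree H \<le> degree K" if "coeffs_in n K" "last_eval n K \<in> J" "lead_coeff K \<notin> P" for K
      unfolding H_def using that by (intro arg_min_nat_le) auto
    have dH: "degree H < degree G" using Hmin[OF H0(1-3)] H0(4) by linarith
    define b where "b = lead_coeff H"
    have b: "b \<in> polys n" "b \<in> polys (Suc n)" "b \<notin> P"
      using H up by (auto simp: b_def coeffs_in_def)
    \<comment> \<open>If \<open>H\<close> had positive degree, it would divide \<open>G\<close>
      modulo \<open>P\<close> up to a power of \<open>b\<close>. Primality and the minimality of
      \<open>G\<close> then force the quotient \<open>Q\<close> to have coefficients in
      \<open>P\<close>, hence also \<open>b ^ M * a \<in> P\<close>.\<close>
    have "degree H = 0"
    proof (rule ccontr)
      assume "degree H \<noteq> 0"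
      then have dH0: "0 < degree H" by simp
      obtain M Q R where Q: "coeffs_in n Q" "coeffs_in n R" "smult (b ^ M) G = H * Q + R" "degree R < degree H"
         "degree Q \<le> degree G - degree H"
        using pseudo_division[OF H(1) dH0 G(1)] unfolding b_def by metis
      have "last_eval n (smult (b ^ M) G) = last_eval n (H * Q + R)" using Q(3) by simp
      then have eqR: "last_eval n R = b ^ M * last_eval n G - last_eval n H * last_eval n Q"
        by (simp add: algebra_simps)
      have bG: "b ^ M * last_eval n G \<in> P" by (intro PD(4) G polys_power b)
      have "last_eval n R \<in> J" unfolding eqR
        by (rule JD(7)[OF subsetD[OF PJ bG] JD(5)[OF H(2) last_eval_closed[OF Q(1)]]])
      have Rc: "coeff R j \<in> P" for j
      proof (rule ccontr)
        assume "coeff R j \<notin> P"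
        then obtain K' where "coeffs_in n K'" "last_eval n K' \<in> J" "lead_coeff K' \<notin> P" "degree K' \<le> degree R"
          using strip_leading_coeffs[OF PI J PJ Q(2) \<open>last_eval n R \<in> J\<close>] by blast
        then show False using Hmin[of K'] Q(4) by linarith
      qed
      have "last_eval n R \<in> P" by (rule last_eval_in_ideal[OF PI Q(2) Rc])
      then have "b ^ M * last_eval n G - last_eval n R \<in> P" by (rule PD(7)[OF bG])
      then have "last_eval n H * last_eval n Q \<in> P" by (simp add: eqR)
      moreover have "last_eval n H \<notin> P" using min[OF H(1) _ dH] H(3) by blast
      ultimately have "last_eval n Q \<in> P"
        using poly_primeD(3)[OF P last_eval_closed[OF H(1)] last_eval_closed[OF Q(1)]] by blast
      then have Qc: "coeff Q j \<in> P" for j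
        using min[OF Q(1)] Q(5) dH dH0 by (metis diff_less le_less_trans less_trans)
      have "coeff (H * Q) j \<in> P" for j
        unfolding coeff_mult using H(1) up Qc
        by (intro poly_ideal_sum[OF PI] PD(4)) (auto simp: coeffs_in_def)
      then have "coeff (smult (b ^ M) G) (degree G) \<in> P" unfolding Q(3) using Rc PD(3) by simp
      then have "b ^ M * a \<in> P" by (simp add: a_def)
      then show False
        using poly_primeD(3)[OF P polys_power[OF b(2)] a(2)] npow[OF b(2,3)] a(3) by blast
    qed
    then obtain c where "H = [:c:]" by (rule degree_eq_zeroE)
    then have "last_eval n H = b" by (simp add: b_def)
    then obtain w where w: "w \<in> polys (Suc n)" "b - f * w \<in> P" using H(2) by (auto simp: J_def)
    show ?thesis
    proof (rule that[of "a * b"])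
      show "a * b \<in> polys n" by (intro polys_mult a b)
      show "a * b \<notin> P" using poly_primeD(3)[OF P a(2) b(2)] a(3) b(3) by blast
      fix x :: "nat \<Rightarrow> 'k" assume x: "\<And>q. q \<in> P \<inter> polys n \<Longrightarrow> ev x q = 0" "ev x (a * b) \<noteq> 0"
      then have ab: "ev x a \<noteq> 0" "ev x b \<noteq> 0" by (auto simp: ev.hom_mult)
      have "degree (?map x G) \<ge> degree G"
        using ab(1) by (intro le_degree) (simp add: cf a_def)
      then obtain t where t: "poly (?map x G) t = 0"
        using alg_closed_imp_poly_has_root[of "?map x G"] dG by auto
      let ?x = "x(Suc n := t)"
      have evn: "ev ?x c = ev x c" if "c \<in> polys n" for c
        by (rule mpoly_subst_cong[OF comm_ring_hom_ident that]) auto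
      \<comment> \<open>Division by \<open>G\<close> leaves a remainder with coefficients in
        \<open>P\<close>, and \<open>G\<close> vanishes at the new point; so
        \<open>a ^ M * q\<close> vanishes there, while \<open>ev x a\<close> is nonzero.\<close>
      have van: "ev ?x q = 0" if q: "q \<in> P" for q
      proof -
        obtain K where K: "coeffs_in n K" "last_eval n K = q" using last_eval_exists q PD(1) by blast
        obtain M S' R where R: "coeffs_in n S'" "coeffs_in n R" "smult (a ^ M) K = G * S' + R" "degree R < degree G"
          using pseudo_division[OF G(1) dG K(1)] unfolding a_def by metis
        have "last_eval n (smult (a ^ M) K) = last_eval n (G * S' + R)" using R(3) by simp
        then have eqR: "a ^ M * q = last_eval n G * last_eval n S' + last_eval n R"
          using K(2) by simp
        then have "last_eval n R = a ^ M * q - last_eval n G * last_eval n S'" by simp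
        moreover have "a ^ M * q \<in> P" using q a by (intro PD(4) polys_power)
        moreover have "last_eval n G * last_eval n S' \<in> P" by (intro PD(5) G last_eval_closed R)
        ultimately have "last_eval n R \<in> P" by (metis PD(7))
        then have "?map x R = 0" using map0[OF R(2) min[OF R(2) _ R(4)] x(1)] by blast
        then have "ev ?x (last_eval n R) = 0" using ev_last_eval[OF R(2), of x t] by simp
        moreover have "ev ?x (last_eval n G) = 0" using ev_last_eval[OF G(1), of x t] t by simp
        ultimately have "ev ?x (a ^ M * q) = 0" unfolding eqR by (simp add: ev.hom_add ev.hom_mult)
        then show ?thesis using ab(1) evn[OF a(1)] by (simp add: ev.hom_mult ev.hom_power)
      qed
      have "ev ?x (b - f * w) = 0" using van w by blast
      then have "ev ?x f \<noteq> 0" using evn[OF b(1)] ab(2) by (auto simp: ev.hom_minus ev.hom_mult)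
      with van show "\<exists>t. (\<forall>q\<in>P. ev (x(Suc n := t)) q = 0) \<and> ev (x(Suc n := t)) f \<noteq> 0" by blast
    qed
  qed
qed

lemma polys_0_eq:
  assumes "p \<in> polys 0"
  obtains c where "p = Const c"
proof -
  have "\<exists>c. p = Const c" using assms
  proof (induction rule: polys_induct)
    case (add p q)
    then obtain c d where "p = Const c" "q = Const d" by blast
    then show ?case by (intro exI[of _ "c + d"]) (simp add: Const_def single_add)
  next
    case (mult p q)
    then obtain c d where "p = Const c" "q = Const d" by blast
    then show ?case by (intro exI[of _ "c * d"]) (simp add: Const_def mult_single)
  qed auto
  with that show ?thesis by blast
qed

lemma poly_prime_restrict:
  assumes "poly_prime (Suc n) P"
  shows "poly_prime n (P \<inter> polys n)"
proof -
  note PI = poly_primeD[OF assms] note PD = poly_idealD[OF PI(1)]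
  have up: "p \<in> polys (Suc n)" if "p \<in> polys n" for p using polys_mono[of n "Suc n"] that by auto
  show ?thesis
    unfolding poly_prime_def poly_ideal_def using PI(2) PI(3)[OF up up] PD(2,3) PD(4)[OF _ up]
    by (auto intro: polys_0 polys_add polys_mult)
qed

text \<open>Coordinates are chosen one after the other. The polynomial \<open>f\<close> belongs to
  the statement because the induction must avoid the zeros of the auxiliary polynomial
  \<open>u\<close> in fewer variables.\<close>

theorem nullstellensatz_prime:
  fixes P :: "'k::alg_closed_field mpoly set"
  assumes "poly_prime n P" "f \<in> polys n" "f \<notin> P"
  obtains x where "x \<in> zero_locus (\<lambda>c. c) n P" "ev x f \<noteq> 0"
proof -
  have "\<exists>x \<in> zero_locus (\<lambda>c. c) n P. ev x f \<noteq> 0"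
    using assms
  proof (induction n arbitrary: P f)
    case 0
    note PD = poly_idealD[OF poly_primeD(1)[OF 0(1)]]
    have eq0: "c = 0" if c: "Const c \<in> P" for c
    proof (rule ccontr)
      assume "c \<noteq> 0"
      then have "Const (inverse c) * Const c = 1" by (simp add: Const_def mult_single)
      then have "1 \<in> P" using PD(4)[OF c polys_Const, of "inverse c"] by simp
      then show False using 0 by (simp add: poly_prime_def)
    qed
    have "ev (\<lambda>_. 0) q = 0" if q: "q \<in> P" for q
    proof -
      have "q \<in> polys 0" using q PD(1) by blast
      then obtain c where "q = Const c" by (rule polys_0_eq)
      then show ?thesis using eq0 q by simp
    qed
    moreover have "ev (\<lambda>_. 0) f \<noteq> 0"
    proof -
      obtain c where c: "f = Const c" using 0(2) by (rule polys_0_eq)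
      have "c \<noteq> 0" using c 0(3) PD(2) by (auto simp: Const_def)
      then show ?thesis using c by simp
    qed
    ultimately show ?case by (auto simp: zero_locus_def affine_space_def)
  next
    case (Suc n)
    obtain u where u: "u \<in> polys n" "u \<notin> P"
      "\<And>x. (\<And>q. q \<in> P \<inter> polys n \<Longrightarrow> ev x q = 0) \<Longrightarrow> ev x u \<noteq> 0 \<Longrightarrow>
        \<exists>t. (\<forall>q\<in>P. ev (x(Suc n := t)) q = 0) \<and> ev (x(Suc n := t)) f \<noteq> 0"
      using nullstellensatz_step[OF Suc.prems] by blast
    obtain x where x: "x \<in> zero_locus (\<lambda>c. c) n (P \<inter> polys n)" "ev x u \<noteq> 0"
      using Suc.IH[OF poly_prime_restrict[OF Suc.prems(1)], of u] u by blast
    then obtain t where t: "\<forall>q\<in>P. ev (x(Suc n := t)) q = 0" "ev (x(Suc n := t)) f \<noteq> 0"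
      using u(3)[of x] by (auto simp: zero_locus_def)
    have "x(Suc n := t) \<in> affine_space (Suc n)"
      using x(1) by (auto simp: zero_locus_def affine_space_def)
    with t show ?case unfolding zero_locus_def by blast
  qed
  with that show ?thesis by blast
qed


section \<open>Noetherianity of polynomial rings\<close>

text \<open>The condition \<open>degree G \<le> d\<close> instead of equality lets the coefficient
  at \<open>d\<close> be 0, which makes the set an ideal.\<close>

definition lead_ideal :: "nat \<Rightarrow> 'k::comm_ring_1 mpoly set \<Rightarrow> nat \<Rightarrow> 'k mpoly set" where
  "lead_ideal n I d = {c. \<exists>G. coeffs_in n G \<and> degree G \<le> d \<and> coeff G d = c \<and> last_eval n G \<in> I}"

lemma poly_ideal_lead_ideal:
  assumes I: "poly_ideal (Suc n) I"
  shows "poly_ideal n (lead_ideal n I d)"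
proof -
  note ID = poly_idealD[OF I]
  show ?thesis
    unfolding poly_ideal_def
  proof (intro conjI ballI)
    show "lead_ideal n I d \<subseteq> polys n" by (auto simp: lead_ideal_def coeffs_in_def)
    show "0 \<in> lead_ideal n I d"
      unfolding lead_ideal_def using ID(2) by (auto intro!: exI[of _ 0] coeffs_in_intros)
  next
    fix p q assume "p \<in> lead_ideal n I d" "q \<in> lead_ideal n I d"
    then obtain G H where
      "coeffs_in n G" "degree G \<le> d" "coeff G d = p" "last_eval n G \<in> I"
      "coeffs_in n H" "degree H \<le> d" "coeff H d = q" "last_eval n H \<in> I"
      unfolding lead_ideal_def by blast
    then show "p + q \<in> lead_ideal n I d" unfolding lead_ideal_def
      by (auto intro!: exI[of _ "G + H"] coeffs_in_intros degree_add_le ID(3))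
  next
    fix p q :: "'a mpoly" assume q: "q \<in> polys n" and "p \<in> lead_ideal n I d"
    then obtain G where
      "coeffs_in n G" "degree G \<le> d" "coeff G d = p" "last_eval n G \<in> I"
      unfolding lead_ideal_def by blast
    moreover have "q \<in> polys (Suc n)" using q polys_mono[of n "Suc n"] by auto
    ultimately show "q * p \<in> lead_ideal n I d" unfolding lead_ideal_def using q
      by (auto intro!: exI[of _ "smult q G"] coeffs_in_intros ID(4) intro: order_trans[OF degree_smult_le])
  qed
qed

lemma lead_ideal_mono:
  assumes I: "poly_ideal (Suc n) I" and "I \<subseteq> J" "d \<le> d'"
  shows "lead_ideal n I d \<subseteq> lead_ideal n J d'"
proof
  fix c assume "c \<in> lead_ideal n I d"
  then obtain G where G: "coeffs_in n G" "degree G \<le> d" "coeff G d = c" "last_eval n G \<in> I"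
    unfolding lead_ideal_def by blast
  let ?G = "monom 1 (d' - d) * G"
  have "coeffs_in n ?G" by (intro coeffs_in_intros G polys_1)
  moreover have "degree ?G \<le> d'"
    using degree_mult_le[of "monom 1 (d' - d)" G] degree_monom_le[of "1 :: 'a mpoly" "d' - d"] G(2) assms(3)
    by linarith
  moreover have "coeff ?G d' = c" using assms(3) G(3) by (simp add: coeff_monom_mult)
  moreover have "last_eval n ?G \<in> I"
    using poly_idealD(4)[OF I G(4) polys_power[OF polys_Var], of "Suc n" "d' - d"] by (simp add: poly_monom)
  ultimately show "c \<in> lead_ideal n J d'" unfolding lead_ideal_def using \<open>I \<subseteq> J\<close> by blast
qed

text \<open>Subtracting an element of \<open>I\<close> with the same coefficient in degree
  \<open>d\<close> lowers the degree of an element of \<open>J\<close>; iteration ends in degree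
  0.\<close>

lemma ideal_eqI_lead_ideal:
  assumes I: "poly_ideal (Suc n) I" and J: "poly_ideal (Suc n) J" and "I \<subseteq> J"
    and lead: "\<And>d. lead_ideal n J d \<subseteq> lead_ideal n I d"
  shows "I = J"
proof
  have "last_eval n G \<in> I" if "coeffs_in n G" "degree G \<le> d" "last_eval n G \<in> J" for G d
    using that
  proof (induction d arbitrary: G)
    case 0
    have "coeff G 0 \<in> lead_ideal n J 0" unfolding lead_ideal_def using 0 by blast
    then obtain H where "degree H \<le> 0" "coeff H 0 = coeff G 0" "last_eval n H \<in> I"
      using lead unfolding lead_ideal_def by blast
    moreover from this 0 have "H = G" by (metis degree_eq_zeroE coeff_pCons_0 le_zero_eq)
    ultimately show ?case by simp
  next
    case (Suc d)
    have "coeff G (Suc d) \<in> lead_ideal n J (Suc d)" unfolding lead_ideal_def using Suc by blast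
    then obtain H where H: "coeffs_in n H" "degree H \<le> Suc d" "coeff H (Suc d) = coeff G (Suc d)" "last_eval n H \<in> I"
      using lead unfolding lead_ideal_def by blast
    have "degree (G - H) \<le> Suc d" using Suc.prems(2) H(2) by (intro degree_diff_le) auto
    moreover have "coeff (G - H) (Suc d) = 0" using H(3) by simp
    ultimately have dGH: "degree (G - H) \<le> d"
      by (metis degree_0 le_SucE leading_coeff_0_iff zero_le)
    have "last_eval n H \<in> J" using H(4) \<open>I \<subseteq> J\<close> by blast
    then have "last_eval n G - last_eval n H \<in> J" using Suc.prems(3) by (rule poly_idealD(7)[OF J, rotated])
    then have "last_eval n (G - H) \<in> J" by simp
    then have "last_eval n (G - H) \<in> I"
      using Suc.IH[of "G - H"] dGH coeffs_in_intros(3)[OF Suc.prems(1) H(1)] by blast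
    then have "last_eval n (G - H) + last_eval n H \<in> I" using H(4) by (rule poly_idealD(3)[OF I])
    then show ?case by simp
  qed
  note * = this
  show "J \<subseteq> I"
  proof
    fix p assume p: "p \<in> J"
    then have "p \<in> polys (Suc n)" using poly_idealD(1)[OF J] by blast
    then obtain G where "coeffs_in n G" "last_eval n G = p" by (rule last_eval_exists)
    with *[of G "degree G"] p show "p \<in> I" by simp
  qed
qed fact

text \<open>The ideals of leading coefficients increase in both indices. The diagonal settles all
  degrees from \<open>N0\<close> on at once, and the finitely many smaller degrees settle one by
  one.\<close>

theorem hilbert_basis:
  fixes I :: "nat \<Rightarrow> 'k::field mpoly set"
  assumes "\<And>k. poly_ideal n (I k)" "\<And>k. I k \<subseteq> I (Suc k)"
  shows "\<exists>N. \<forall>k\<ge>N. I k = I N"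
  using assms
proof (induction n arbitrary: I)
  case 0
  have mono: "I k \<subseteq> I l" if "k \<le> l" for k l
    using that lift_Suc_mono_le[of I] 0(2) by blast
  show ?case
  proof (cases "\<exists>N. \<exists>p\<in>I N. p \<noteq> 0")
    case True
    then obtain N p where p: "p \<in> I N" "p \<noteq> 0" by blast
    obtain c where c: "p = Const c" using poly_idealD(1)[OF 0(1)] p(1) polys_0_eq by blast
    have "c \<noteq> 0" using p(2) c by (auto simp: Const_def)
    then have inv: "Const (inverse c) * p = 1" by (simp add: c Const_def mult_single)
    have "I k = polys 0" if "N \<le> k" for k
    proof -
      have "p \<in> I k" using mono[OF that] p by blast
      then have "1 \<in> I k" using poly_idealD(4)[OF 0(1) _ polys_Const, of p k "inverse c"] inv by simp
      then have "q \<in> I k" if "q \<in> polys 0" for q using poly_idealD(4)[OF 0(1) _ that, of 1 k] by simp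
      then show ?thesis using poly_idealD(1)[OF 0(1)] by blast
    qed
    then show ?thesis by (intro exI[of _ N]) auto
  next
    case False
    then have "I k = {0}" for k using poly_idealD(2)[OF 0(1), of k] by auto
    then show ?thesis by auto
  qed
next
  case (Suc n)
  have mono: "I k \<subseteq> I l" if "k \<le> l" for k l
    using that lift_Suc_mono_le[of I] Suc.prems(2) by blast
  let ?L = "\<lambda>k d. lead_ideal n (I k) d"
  have L: "poly_ideal n (?L k d)" for k d by (rule poly_ideal_lead_ideal[OF Suc.prems(1)])
  have Lmono: "?L k d \<subseteq> ?L k' d'" if "k \<le> k'" "d \<le> d'" for k k' d d'
    using lead_ideal_mono[OF Suc.prems(1) mono[OF that(1)] that(2)] .
  obtain N0 where N0: "\<And>k. k \<ge> N0 \<Longrightarrow> ?L k k = ?L N0 N0"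
    using Suc.IH[of "\<lambda>k. ?L k k"] L Lmono by (metis le_Suc_eq order_refl)
  have "\<forall>d. \<exists>N. \<forall>k\<ge>N. ?L k d = ?L N d"
    using Suc.IH[of "\<lambda>k. ?L k d" for d] L Lmono by (metis le_Suc_eq order_refl)
  then obtain M where M: "\<And>d k. k \<ge> M d \<Longrightarrow> ?L k d = ?L (M d) d" by metis
  define N where "N = N0 + (\<Sum>d<N0. M d)"
  have MN: "M d \<le> N" if "d < N0" for d
    using that member_le_sum[of d "{..<N0}" M] by (auto simp: N_def)
  have "?L k d \<subseteq> ?L N d" if "k \<ge> N" for k d
  proof (cases "d < N0")
    case True
    then show ?thesis using M[of d k] M[of d N] MN[of d] that by auto
  next
    case False
    have "?L k d \<subseteq> ?L (max k d) (max k d)" by (intro Lmono) auto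
    also have "\<dots> = ?L N0 N0" using False by (intro N0) auto
    also have "\<dots> \<subseteq> ?L N d" using False by (intro Lmono) (auto simp: N_def)
    finally show ?thesis .
  qed
  note * = this
  have "I N = I k" if "k \<ge> N" for k
    by (rule ideal_eqI_lead_ideal[OF Suc.prems(1) Suc.prems(1) mono[OF that]]) (use * that in blast)
  then show ?case by metis
qed

corollary maximal_ideal_with_property:
  fixes I :: "'k::field mpoly set"
  assumes "poly_ideal n I" "\<Phi> I"
  obtains J where "poly_ideal n J" "\<Phi> J" "I \<subseteq> J"
    "\<And>K. poly_ideal n K \<Longrightarrow> \<Phi> K \<Longrightarrow> J \<subseteq> K \<Longrightarrow> K = J"
proof (rule ccontr)
  assume no: "\<not> thesis"
  have "\<exists>f. \<forall>k. (poly_ideal n (f k) \<and> \<Phi> (f k) \<and> I \<subseteq> f k) \<and> f k \<subset> f (Suc k)"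
  proof (rule dependent_nat_choice[where P = "\<lambda>_ J. poly_ideal n J \<and> \<Phi> J \<and> I \<subseteq> J"
        and Q = "\<lambda>_ J K. J \<subset> K"])
    show "\<exists>J. poly_ideal n J \<and> \<Phi> J \<and> I \<subseteq> J" using assms by blast
  next
    fix J :: "'k mpoly set"
    assume J: "poly_ideal n J \<and> \<Phi> J \<and> I \<subseteq> J"
    have "\<exists>K. poly_ideal n K \<and> \<Phi> K \<and> J \<subseteq> K \<and> K \<noteq> J"
      using that[of J] J no by blast
    then show "\<exists>K. (poly_ideal n K \<and> \<Phi> K \<and> I \<subseteq> K) \<and> J \<subset> K"
      using J by blast
  qed
  then obtain f where "\<forall>k. (poly_ideal n (f k) \<and> \<Phi> (f k) \<and> I \<subseteq> f k) \<and> f k \<subset> f (Suc k)" ..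
  then have f: "poly_ideal n (f k)" "f k \<subset> f (Suc k)" for k by simp_all
  have "f k \<subseteq> f (Suc k)" for k using f(2)[of k] by (rule psubset_imp_subset)
  from hilbert_basis[of n f, OF f(1) this] obtain N where N: "\<forall>k\<ge>N. f k = f N" ..
  have "f (Suc N) = f N" by (rule N[rule_format]) simp
  then show False using f(2)[of N] by simp
qed


section \<open>Growth of quotients at a point\<close>

lemma Const_simps:
  "Const 0 = 0" "Const 1 = 1" "Const (a + b) = Const a + Const b" "Const (a * b) = Const a * Const b"
  "Const (- a) = - Const a" "Const (a - b) = Const a - Const b"
proof -
  interpret comm_ring_hom Const by (rule comm_ring_hom_Const)
  show "Const 0 = 0" "Const 1 = 1" "Const (a + b) = Const a + Const b" "Const (a * b) = Const a * Const b"
    "Const (- a) = - Const a" "Const (a - b) = Const a - Const b"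
    by (simp_all add: hom_zero hom_one hom_add hom_mult hom_uminus hom_minus)
qed

interpretation mp: vector_space "\<lambda>(c::'k::field) p. Const c * p"
  by unfold_locales (simp_all add: Const_simps algebra_simps)

section \<open>Taylor expansion at a point\<close>

definition shift :: "(nat \<Rightarrow> 'k) \<Rightarrow> 'k::comm_ring_1 mpoly \<Rightarrow> 'k mpoly" where
  "shift x = mpoly_subst Const (\<lambda>i. Var i + Const (x i))"

interpretation shift: comm_ring_hom "shift x"
  unfolding shift_def by (rule comm_ring_hom_mpoly_subst[OF comm_ring_hom_Const])

lemma shift_Const [simp]: "shift x (Const c) = Const c"
  by (simp add: shift_def comm_ring_hom_Const)

lemma shift_Var [simp]: "shift x (Var i) = Var i + Const (x i)"
  by (simp add: shift_def comm_ring_hom_Const)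

lemma shift_closed: "p \<in> polys n \<Longrightarrow> shift x p \<in> polys n"
  unfolding shift_def by (erule mpoly_subst_Const_closed) (intro polys_add polys_Var polys_Const)

lemma shift_shift:
  assumes "p \<in> polys n"
  shows "shift x (shift (\<lambda>i. - x i) p) = p" "shift (\<lambda>i. - x i) (shift x p) = p"
  using mpoly_hom_eq[OF assms, of "\<lambda>p. shift x (shift (\<lambda>i. - x i) p)" "\<lambda>p. p"]
    mpoly_hom_eq[OF assms, of "\<lambda>p. shift (\<lambda>i. - x i) (shift x p)" "\<lambda>p. p"]
  by (simp_all add: comm_ring_hom_comp shift.comm_ring_hom_axioms comm_ring_hom_ident shift.hom_add
      shift.hom_minus Const_simps)

text \<open>The power \<open>\<mm>^j\<close> of the ideal of \<open>x\<close>, described by the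
  exponents of the Taylor expansion at \<open>x\<close> instead of by generators.\<close>

definition ord_ge :: "nat \<Rightarrow> (nat \<Rightarrow> 'k) \<Rightarrow> nat \<Rightarrow> 'k::comm_ring_1 mpoly set" where
  "ord_ge n x j = {p \<in> polys n. \<forall>\<alpha>\<in>keys (shift x p). j \<le> mdeg \<alpha>}"

lemma ord_ge_0 [simp]: "ord_ge n x 0 = polys n"
  by (simp add: ord_ge_def)

lemma ord_ge_antimono: "i \<le> j \<Longrightarrow> ord_ge n x j \<subseteq> ord_ge n x i"
  by (fastforce simp: ord_ge_def)

lemma ord_ge_mult:
  assumes "p \<in> ord_ge n x a" "q \<in> ord_ge n x b"
  shows "p * q \<in> ord_ge n x (a + b)"
proof -
  have "a + b \<le> mdeg \<gamma>" if "\<gamma> \<in> keys (shift x p * shift x q)" for \<gamma>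
  proof -
    from that obtain \<alpha> \<beta> where "\<gamma> = \<alpha> + \<beta>" "\<alpha> \<in> keys (shift x p)" "\<beta> \<in> keys (shift x q)"
      using keys_mult[of "shift x p" "shift x q"] by blast
    then show ?thesis using assms by (auto simp: ord_ge_def wdeg_add intro: add_mono)
  qed
  then show ?thesis using assms by (auto simp: ord_ge_def shift.hom_mult intro: polys_mult)
qed

lemma poly_ideal_ord_ge: "poly_ideal n (ord_ge n x j)"
  unfolding poly_ideal_def
proof (intro conjI ballI)
  show "p + q \<in> ord_ge n x j" if "p \<in> ord_ge n x j" "q \<in> ord_ge n x j" for p q
    using that Poly_Mapping.keys_add[of "shift x p" "shift x q"]
    by (auto simp: ord_ge_def shift.hom_add intro: polys_add)
  show "q * p \<in> ord_ge n x j" if "p \<in> ord_ge n x j" "q \<in> polys n" for p q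
    using ord_ge_mult[of q n x 0 p j] that by simp
qed (auto simp: ord_ge_def shift.hom_zero polys_0)

lemma ord_ge_power: "p \<in> ord_ge n x 1 \<Longrightarrow> p ^ j \<in> ord_ge n x j"
  by (induction j) (use ord_ge_mult[of p n x 1] in \<open>auto simp: polys_1\<close>)

lemma lookup_0_eq_ev: "lookup p 0 = ev (\<lambda>_. 0) p"
proof -
  have z: "(\<Prod>i\<in>keys \<alpha>. 0 ^ lookup \<alpha> i) = (if \<alpha> = 0 then 1 else (0::'a))" for \<alpha> :: "nat \<Rightarrow>\<^sub>0 nat"
  proof (cases "\<alpha> = 0")
    case False
    then obtain i where i: "i \<in> keys \<alpha>" by (metis keys_eq_empty ex_in_conv)
    then have "0 ^ lookup \<alpha> i = (0::'a)" by (intro zero_power) (simp add: in_keys_iff)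
    then show ?thesis using i False by (auto intro!: prod_zero)
  qed simp
  have "ev (\<lambda>_. 0) p = (\<Sum>\<alpha>\<in>keys p. if \<alpha> = 0 then lookup p 0 else 0)"
    unfolding ev_sum_keys by (intro sum.cong refl) (simp add: z)
  then show ?thesis by (simp add: in_keys_iff)
qed

lemma ev_shift:
  assumes "p \<in> polys n"
  shows "ev y (shift x p) = ev (\<lambda>i. y i + x i) p"
  unfolding shift_def
  by (subst mpoly_subst_mpoly_subst[OF comm_ring_hom_ident assms]) (simp add: ev.hom_add)

lemma ord_ge_1_iff:
  assumes "p \<in> polys n"
  shows "p \<in> ord_ge n x 1 \<longleftrightarrow> ev x p = 0"
proof -
  have "ev x p = lookup (shift x p) 0"
    using ev_shift[OF assms, of "\<lambda>_. 0" x] by (simp add: lookup_0_eq_ev)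
  moreover have "1 \<le> mdeg \<alpha> \<longleftrightarrow> \<alpha> \<noteq> 0" for \<alpha>
    by (auto simp: wdeg_def Suc_le_eq in_keys_iff intro!: poly_mapping_eqI)
  ultimately show ?thesis using assms by (auto simp: ord_ge_def in_keys_iff)
qed

lemma lookup_single_eq_ev:
  fixes p :: "'k::comm_ring_1 mpoly"
  shows "lookup p (single i 1) = ev (\<lambda>_. 0) (mpoly_deriv i p)"
proof -
  have "lookup (mpoly_deriv i p) 0 = (\<Sum>\<alpha>\<in>keys p. if \<alpha> = single i 1 then lookup p (single i 1) else 0)"
    unfolding mpoly_deriv_def lookup_sum
  proof (intro sum.cong refl)
    fix \<alpha> assume "\<alpha> \<in> keys p"
    have "\<alpha> = single i 1" if "\<alpha> - single i 1 = 0" "lookup \<alpha> i \<noteq> 0"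
    proof (rule poly_mapping_eqI)
      fix l
      have "lookup (\<alpha> - single i 1) l = 0" using that by simp
      then show "lookup \<alpha> l = lookup (single i 1) l"
        using that(2) by (auto simp: lookup_minus lookup_single when_def split: if_splits)
    qed
    then show "lookup (single (\<alpha> - single i 1) (of_nat (lookup \<alpha> i) * lookup p \<alpha>)) 0 =
        (if \<alpha> = single i 1 then lookup p (single i 1) else 0)"
      by (cases "lookup \<alpha> i = 0") (auto simp: lookup_single when_def)
  qed
  also have "\<dots> = lookup p (single i 1)" by (auto simp: in_keys_iff)
  finally show ?thesis by (simp add: lookup_0_eq_ev)
qed

text \<open>The Taylor coefficients of degree at most 1 at \<open>x\<close> are the value and the
  first partial derivatives; no division occurs, so this holds in every characteristic.\<close>

lemma ord_ge_2I:
  assumes p: "p \<in> polys n" and "ev x p = 0" "\<And>i. i \<in> {1..n} \<Longrightarrow> ev x (mpoly_deriv i p) = 0"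
  shows "p \<in> ord_ge n x 2"
proof -
  have "ev (\<lambda>_. 0) (mpoly_deriv i (shift x p)) = ev x (mpoly_deriv i p)" for i
  proof -
    have "ev (\<lambda>_. 0) (mpoly_deriv i (shift x p)) = (\<Sum>l=1..n. ev x (mpoly_deriv l p) *
        ev (\<lambda>_. 0) (mpoly_deriv i (Var l + Const (x l))))"
      unfolding shift_def mpoly_deriv_chain[OF comm_ring_hom_ident p] by (simp add: ev.hom_add)
    also have "\<dots> = (\<Sum>l=1..n. if l = i then ev x (mpoly_deriv i p) else 0)"
      by (intro sum.cong) (auto simp: mpoly_deriv_add)
    also have "\<dots> = ev x (mpoly_deriv i p)"
      using mpoly_deriv_notin_polys[OF p] by (auto simp: ev.hom_zero)
    finally show ?thesis .
  qed
  then have d: "lookup (shift x p) (single i 1) = 0" for i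
    using assms(3) mpoly_deriv_notin_polys[OF p, of i]
    by (cases "i \<in> {1..n}") (auto simp: lookup_single_eq_ev ev.hom_zero simp del: One_nat_def)
  have 0: "lookup (shift x p) 0 = 0"
    using ev_shift[OF p, of "\<lambda>_. 0" x] assms(2) by (simp add: lookup_0_eq_ev)
  have "2 \<le> mdeg \<alpha>" if "\<alpha> \<in> keys (shift x p)" for \<alpha>
  proof (rule ccontr)
    assume "\<not> 2 \<le> mdeg \<alpha>"
    then have less: "(\<Sum>i\<in>keys \<alpha>. lookup \<alpha> i) \<le> 1" by (simp add: wdeg_def)
    have "\<alpha> \<noteq> 0" using that 0 by (auto simp: in_keys_iff)
    then obtain i where i: "i \<in> keys \<alpha>" by (metis keys_eq_empty ex_in_conv)
    have "(\<Sum>i\<in>keys \<alpha>. lookup \<alpha> i) = lookup \<alpha> i + (\<Sum>l\<in>keys \<alpha> - {i}. lookup \<alpha> l)"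
      using i by (simp add: sum.remove)
    moreover have "1 \<le> lookup \<alpha> i" using i by (simp add: in_keys_iff Suc_le_eq)
    ultimately have 1: "lookup \<alpha> i = 1" and 2: "(\<Sum>l\<in>keys \<alpha> - {i}. lookup \<alpha> l) = 0" using less by linarith+
    have 3: "lookup \<alpha> l = 0" if "l \<in> keys \<alpha> - {i}" for l
      using 2 that sum_eq_0_iff[of "keys \<alpha> - {i}" "lookup \<alpha>"] by simp
    have "lookup \<alpha> l = (if l = i then 1 else 0)" for l
      using 1 3[of l] by (cases "l = i"; cases "l \<in> keys \<alpha>") (simp_all add: in_keys_iff)
    then have "\<alpha> = single i 1"
      by (intro poly_mapping_eqI) (simp add: lookup_single when_def)
    then show False using d[of i] that by (simp add: in_keys_iff)
  qed
  then show ?thesis using p by (simp add: ord_ge_def)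
qed

text \<open>The monomial with exponent \<open>\<alpha>\<close> in the local coordinates
  \<open>Var i - Const (x i)\<close>.\<close>

definition lmonom :: "(nat \<Rightarrow> 'k) \<Rightarrow> (nat \<Rightarrow>\<^sub>0 nat) \<Rightarrow> 'k::comm_ring_1 mpoly" where
  "lmonom x \<alpha> = shift (\<lambda>i. - x i) (single \<alpha> 1)"

lemma lmonom_0: "lmonom x 0 = 1"
  by (simp add: lmonom_def shift.hom_one)

lemma lmonom_add: "lmonom x (\<alpha> + \<beta>) = lmonom x \<alpha> * lmonom x \<beta>"
  unfolding lmonom_def shift.hom_mult[symmetric] by (simp add: mult_single)

lemma lmonom_single: "lmonom x (single i 1) = Var i - Const (x i)"
proof -
  have "lmonom x (single i 1) = shift (\<lambda>i. - x i) (Var i)" by (simp only: lmonom_def Var_def)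
  then show ?thesis by (simp add: Const_simps)
qed

lemma lmonom_closed: "keys \<alpha> \<subseteq> {1..n} \<Longrightarrow> lmonom x \<alpha> \<in> polys n"
  unfolding lmonom_def by (intro shift_closed polys_single)

lemma shift_lmonom:
  assumes "keys \<alpha> \<subseteq> {1..n}"
  shows "shift x (lmonom x \<alpha>) = single \<alpha> 1"
  unfolding lmonom_def using shift_shift(1)[OF polys_single[OF assms]] .

lemma lmonom_ord_ge:
  assumes "keys \<alpha> \<subseteq> {1..n}" "j \<le> mdeg \<alpha>"
  shows "lmonom x \<alpha> \<in> ord_ge n x j"
  using assms lmonom_closed[OF assms(1), of x] by (auto simp: ord_ge_def shift_lmonom[OF assms(1)])

lemma lmonom_expansion:
  assumes "p \<in> polys n"
  shows "p = (\<Sum>\<alpha>\<in>keys (shift x p). Const (lookup (shift x p) \<alpha>) * lmonom x \<alpha>)"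
proof -
  have "p = shift (\<lambda>i. - x i) (\<Sum>\<alpha>\<in>keys (shift x p). Const (lookup (shift x p) \<alpha>) * single \<alpha> 1)"
    using shift_shift(2)[OF assms, of x] mpoly_sum_single[of "shift x p"]
    by (simp add: Const_def mult_single)
  then show ?thesis by (simp add: shift.hom_sum shift.hom_mult lmonom_def)
qed

text \<open>Spanning of the quotient of \<open>polys n\<close> by \<open>I + \<mm>^j\<close>,
  written without forming the quotient.\<close>

definition spans_mod :: "nat \<Rightarrow> (nat \<Rightarrow> 'k) \<Rightarrow> 'k::field mpoly set \<Rightarrow> nat \<Rightarrow> 'k mpoly set \<Rightarrow> bool" where
  "spans_mod n x I j B \<longleftrightarrow> (\<forall>p\<in>polys n. \<exists>b\<in>mp.span B. \<exists>i\<in>I. \<exists>f\<in>ord_ge n x j. p = b + i + f)"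

text \<open>An approximation as in Nakayama's lemma: if the local coordinates in \<open>U\<close>
  span \<open>\<mm>\<close> modulo \<open>I + \<mm>^2\<close>, their monomials of degree
  \<open>j\<close> span \<open>\<mm>^j\<close> modulo \<open>I + \<mm>^(j+1)\<close>, and the
  degrees below \<open>j\<close> add up.\<close>

lemma spans_mod_lmonom:
  assumes I: "poly_ideal n I" and U: "U \<subseteq> {1..n}"
    and lin: "\<And>i. i \<in> {1..n} \<Longrightarrow> \<exists>l\<in>mp.span ((\<lambda>u. Var u - Const (x u)) ` U). \<exists>q\<in>I. \<exists>f\<in>ord_ge n x 2.
      Var i - Const (x i) = l + q + f"
  shows "spans_mod n x I j (lmonom x ` {\<beta>. keys \<beta> \<subseteq> U \<and> mdeg \<beta> < j})"
proof -
  note ID = poly_idealD[OF I]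
  note FD = poly_idealD[OF poly_ideal_ord_ge[of n x]]
  let ?T = "\<lambda>j. lmonom x ` {\<beta>. keys \<beta> \<subseteq> U \<and> mdeg \<beta> = j}"
  \<comment> \<open>The target in degree \<open>j\<close>: the span of the monomials of degree
    \<open>j\<close> plus \<open>I + \<mm>^(j+1)\<close>. The claim \<open>FS\<close> is that it
    contains \<open>\<mm>^j\<close>.\<close>
  define S where "S = (\<lambda>j. {p \<in> polys n. \<exists>b\<in>mp.span (?T j). \<exists>q\<in>I. \<exists>f\<in>ord_ge n x (Suc j). p = b + q + f})"
  have T: "mp.span (?T j) \<subseteq> ord_ge n x j" for j
  proof (rule mp.span_minimal)
    show "?T j \<subseteq> ord_ge n x j"
    proof clarify
      fix \<beta> :: "nat \<Rightarrow>\<^sub>0 nat" assume "keys \<beta> \<subseteq> U"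
      then have "keys \<beta> \<subseteq> {1..n}" using U by blast
      then show "lmonom x \<beta> \<in> ord_ge n x (mdeg \<beta>)" by (rule lmonom_ord_ge) simp
    qed
    show "mp.subspace (ord_ge n x j)"
      unfolding mp.subspace_def using FD(2,3) FD(4)[OF _ polys_Const] by auto
  qed
  have TT: "l * b \<in> mp.span (?T (Suc j))" if "l \<in> mp.span ((\<lambda>u. Var u - Const (x u)) ` U)" "b \<in> mp.span (?T j)" for l b j
    using that(1)
  proof (induction rule: mp.span_induct_alt)
    case base
    then show ?case by (simp add: mp.span_zero)
  next
    case (step c y z)
    then obtain u where u: "u \<in> U" "y = Var u - Const (x u)" by blast
    have "y * b \<in> mp.span (?T (Suc j))" using that(2)
    proof (induction rule: mp.span_induct_alt)
      case base
      then show ?case by (simp add: mp.span_zero)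
    next
      case (step d w v)
      then obtain \<beta> where \<beta>: "w = lmonom x \<beta>" "keys \<beta> \<subseteq> U" "mdeg \<beta> = j" by blast
      have "y * w = lmonom x (single u 1 + \<beta>)" unfolding \<beta>(1) u(2) lmonom_add lmonom_single ..
      moreover have "keys (single u 1 + \<beta>) \<subseteq> U"
        using Poly_Mapping.keys_add[of "single u 1" \<beta>] \<beta>(2) u(1) by auto
      moreover have "mdeg (single u 1 + \<beta>) = Suc j"
        using \<beta>(3) unfolding wdeg_add wdeg_single by simp
      ultimately have "y * w \<in> ?T (Suc j)" by blast
      then have "Const d * (y * w) + y * v \<in> mp.span (?T (Suc j))"
        using step by (intro mp.span_add mp.span_scale) (auto intro: mp.span_base)
      then show ?case by (simp add: algebra_simps)
    qed
    then have "Const c * (y * b) + z * b \<in> mp.span (?T (Suc j))"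
      using step by (intro mp.span_add mp.span_scale)
    then show ?case by (simp add: algebra_simps)
  qed
  have S_add: "p + q \<in> S j" if pq: "p \<in> S j" "q \<in> S j" for p q j
  proof -
    from pq obtain b b' i i' f f' where *: "b \<in> mp.span (?T j)" "b' \<in> mp.span (?T j)" "i \<in> I" "i' \<in> I"
      "f \<in> ord_ge n x (Suc j)" "f' \<in> ord_ge n x (Suc j)" "p = b + i + f" "q = b' + i' + f'" "p \<in> polys n" "q \<in> polys n"
      by (auto simp: S_def)
    have "p + q = (b + b') + (i + i') + (f + f')" using * by simp
    then show ?thesis unfolding S_def
      using mp.span_add[OF *(1,2)] ID(3)[OF *(3,4)] FD(3)[OF *(5,6)] polys_add[OF *(9,10)] by blast
  qed
  have S_scale: "Const c * p \<in> S j" if p: "p \<in> S j" for p c j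
  proof -
    from p obtain b i f where *: "b \<in> mp.span (?T j)" "i \<in> I"
      "f \<in> ord_ge n x (Suc j)" "p = b + i + f" "p \<in> polys n"
      by (auto simp: S_def)
    have "Const c * p = Const c * b + Const c * i + Const c * f" using * by (simp add: distrib_left)
    then show ?thesis unfolding S_def
      using mp.span_scale[OF *(1), of c] ID(4)[OF *(2) polys_Const, of c] FD(4)[OF *(3) polys_Const, of c]
        polys_mult[OF polys_Const *(5), of c] by blast
  qed
  have S_I: "I \<subseteq> S j" and S_F: "ord_ge n x (Suc j) \<subseteq> S j" and S_T: "mp.span (?T j) \<subseteq> S j" for j
  proof -
    show "I \<subseteq> S j"
    proof
      fix p assume p: "p \<in> I"
      have "p = 0 + p + 0" by simp
      then show "p \<in> S j" unfolding S_def using p ID(1) FD(2) mp.span_zero by blast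
    qed
    show "ord_ge n x (Suc j) \<subseteq> S j"
    proof
      fix p assume p: "p \<in> ord_ge n x (Suc j)"
      have "p = 0 + 0 + p" by simp
      then show "p \<in> S j" unfolding S_def using p ID(2) FD(1) mp.span_zero by blast
    qed
    show "mp.span (?T j) \<subseteq> S j"
    proof
      fix p assume p: "p \<in> mp.span (?T j)"
      have "p = p + 0 + 0" by simp
      moreover have "p \<in> polys n" using T p FD(1) by blast
      ultimately show "p \<in> S j" unfolding S_def using p ID(2) FD(2) mp.span_zero by blast
    qed
  qed
  have S_sum: "sum f A \<in> S j" if "\<And>a. a \<in> A \<Longrightarrow> f a \<in> S j" for f and A :: "(nat \<Rightarrow>\<^sub>0 nat) set" and j
    using that S_I ID(2) by (induction A rule: infinite_finite_induct) (auto intro: S_add)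
  have FS: "ord_ge n x j \<subseteq> S j" for j
  proof (induction j)
    case 0
    show ?case
    proof
      fix p assume "p \<in> ord_ge n x 0"
      then have p: "p \<in> polys n" by simp
      have "p - Const (ev x p) \<in> ord_ge n x 1"
        using p by (subst ord_ge_1_iff) (auto simp: ev.hom_minus intro: polys_intros)
      then have "p - Const (ev x p) \<in> S 0" using S_F[of 0] by auto
      moreover have "1 \<in> ?T 0" by (intro image_eqI[of _ _ 0]) (simp_all add: lmonom_0)
      then have "Const (ev x p) * 1 \<in> mp.span (?T 0)" by (intro mp.span_scale mp.span_base)
      then have "Const (ev x p) \<in> S 0" using S_T[of 0] by auto
      ultimately have "(p - Const (ev x p)) + Const (ev x p) \<in> S 0" by (rule S_add)
      then show "p \<in> S 0" by simp
    qed
  next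
    case (Suc j)
    have mon: "lmonom x \<alpha> \<in> S (Suc j)" if \<alpha>: "keys \<alpha> \<subseteq> {1..n}" "Suc j \<le> mdeg \<alpha>" for \<alpha>
    proof -
      have "keys \<alpha> \<noteq> {}" using \<alpha>(2) by (auto simp: wdeg_def)
      then obtain i where i: "i \<in> keys \<alpha>" by blast
      define \<beta> where "\<beta> = \<alpha> - single i 1"
      have \<alpha>\<beta>: "\<alpha> = single i 1 + \<beta>"
        by (rule poly_mapping_eqI) (use i in \<open>auto simp: \<beta>_def lookup_add lookup_minus lookup_single when_def in_keys_iff\<close>)
      then have "keys \<beta> \<subseteq> keys \<alpha>" by (auto simp: in_keys_iff lookup_add)
      then have \<beta>: "keys \<beta> \<subseteq> {1..n}" using \<alpha>(1) by blast
      have "mdeg \<alpha> = Suc (mdeg \<beta>)" unfolding \<alpha>\<beta> wdeg_add wdeg_single by simp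
      then have "j \<le> mdeg \<beta>" using \<alpha>(2) by simp
      then have b\<beta>: "lmonom x \<beta> \<in> ord_ge n x j" by (rule lmonom_ord_ge[OF \<beta>])
      then obtain b q f where *: "b \<in> mp.span (?T j)" "q \<in> I" "f \<in> ord_ge n x (Suc j)" "lmonom x \<beta> = b + q + f"
        using Suc unfolding S_def by blast
      have i': "i \<in> {1..n}" using i \<alpha>(1) by blast
      obtain l q' f' where l: "l \<in> mp.span ((\<lambda>u. Var u - Const (x u)) ` U)" "q' \<in> I" "f' \<in> ord_ge n x 2"
        "Var i - Const (x i) = l + q' + f'"
        using lin[OF i'] by blast
      have Xi: "Var i - Const (x i) \<in> polys n" using i' by (intro polys_intros)
      have XF: "Var i - Const (x i) \<in> ord_ge n x 1"
        unfolding ord_ge_1_iff[OF Xi] by (simp add: ev.hom_minus)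
      have bF: "b \<in> ord_ge n x j" using T *(1) by blast
      have bp: "b \<in> polys n" using bF FD(1) by blast
      have "lmonom x \<alpha> = (Var i - Const (x i)) * (b + q + f)"
        unfolding \<alpha>\<beta> lmonom_add lmonom_single *(4) ..
      also have "\<dots> = (l + q' + f') * b + (Var i - Const (x i)) * q + (Var i - Const (x i)) * f"
        unfolding l(4)[symmetric] by (simp add: distrib_left)
      \<comment> \<open>The first product is a combination of monomials of degree
        \<open>Suc j\<close> in \<open>U\<close>; the next two lie in \<open>I\<close>, the last two
        in \<open>\<mm>^(j+2)\<close>.\<close>
      also have "\<dots> = l * b + (q' * b + ((Var i - Const (x i)) * q + (f' * b + (Var i - Const (x i)) * f)))"
        by (simp add: distrib_right)
      also have "\<dots> \<in> S (Suc j)"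
      proof (intro S_add)
        show "l * b \<in> S (Suc j)" using TT[OF l(1) *(1)] S_T by blast
        show "q' * b \<in> S (Suc j)" using ID(5)[OF l(2) bp] S_I by blast
        show "(Var i - Const (x i)) * q \<in> S (Suc j)" using ID(4)[OF *(2) Xi] S_I by blast
        show "f' * b \<in> S (Suc j)" using ord_ge_mult[OF l(3) bF] S_F[of "Suc j"] by auto
        show "(Var i - Const (x i)) * f \<in> S (Suc j)" using ord_ge_mult[OF XF *(3)] S_F[of "Suc j"] by auto
      qed
      finally show ?thesis .
    qed
    show ?case
    proof
      fix p assume p: "p \<in> ord_ge n x (Suc j)"
      then have pp: "p \<in> polys n" "shift x p \<in> polys n" by (auto simp: ord_ge_def shift_closed)
      have "lmonom x \<alpha> \<in> S (Suc j)" if "\<alpha> \<in> keys (shift x p)" for \<alpha>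
        by (rule mon) (use p pp that in \<open>simp_all add: ord_ge_def carrier_mpoly_ring\<close>)
      then have "(\<Sum>\<alpha>\<in>keys (shift x p). Const (lookup (shift x p) \<alpha>) * lmonom x \<alpha>) \<in> S (Suc j)"
        by (intro S_sum S_scale)
      then show "p \<in> S (Suc j)" using lmonom_expansion[OF pp(1), of x] by simp
    qed
  qed
  show ?thesis
  proof (induction j)
    case 0
    show ?case unfolding spans_mod_def
    proof
      fix p :: "'a mpoly" assume "p \<in> polys n"
      then have "p = 0 + 0 + p" "p \<in> ord_ge n x 0" by auto
      then show "\<exists>b\<in>mp.span (lmonom x ` {\<beta>. keys \<beta> \<subseteq> U \<and> mdeg \<beta> < 0}). \<exists>i\<in>I. \<exists>f\<in>ord_ge n x 0. p = b + i + f"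
        using ID(2) mp.span_zero by blast
    qed
  next
    case (Suc j)
    let ?B = "\<lambda>j. lmonom x ` {\<beta>. keys \<beta> \<subseteq> U \<and> mdeg \<beta> < j}"
    show ?case unfolding spans_mod_def
    proof
      fix p :: "'a mpoly" assume p: "p \<in> polys n"
      obtain b i f where *: "b \<in> mp.span (?B j)" "i \<in> I" "f \<in> ord_ge n x j" "p = b + i + f"
        using Suc p unfolding spans_mod_def by blast
      obtain b' i' f' where **: "b' \<in> mp.span (?T j)" "i' \<in> I" "f' \<in> ord_ge n x (Suc j)" "f = b' + i' + f'"
        using FS *(3) unfolding S_def by blast
      have "mp.span (?B j) \<subseteq> mp.span (?B (Suc j))" "mp.span (?T j) \<subseteq> mp.span (?B (Suc j))"
        by (intro mp.span_mono image_mono; auto)+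
      then have "b + b' \<in> mp.span (?B (Suc j))" using *(1) **(1) by (intro mp.span_add) auto
      moreover have "i + i' \<in> I" using *(2) **(2) by (rule ID(3))
      moreover have "p = (b + b') + (i + i') + f'" using *(4) **(4) by simp
      ultimately show "\<exists>b\<in>mp.span (?B (Suc j)). \<exists>i\<in>I. \<exists>f\<in>ord_ge n x (Suc j). p = b + i + f"
        using **(3) by blast
    qed
  qed
qed

lemma finite_exponents:
  assumes "finite U"
  shows "finite {\<beta> :: nat \<Rightarrow>\<^sub>0 nat. keys \<beta> \<subseteq> U \<and> mdeg \<beta> < j}"
    "card {\<beta> :: nat \<Rightarrow>\<^sub>0 nat. keys \<beta> \<subseteq> U \<and> mdeg \<beta> < j} \<le> j ^ card U"
proof -
  let ?E = "{\<beta> :: nat \<Rightarrow>\<^sub>0 nat. keys \<beta> \<subseteq> U \<and> mdeg \<beta> < j}"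
  have inj: "inj_on (\<lambda>\<beta>. restrict (lookup \<beta>) U) ?E"
  proof (rule inj_onI, rule poly_mapping_eqI)
    fix \<beta> \<gamma> l assume *: "\<beta> \<in> ?E" "\<gamma> \<in> ?E" "restrict (lookup \<beta>) U = restrict (lookup \<gamma>) U"
    show "lookup \<beta> l = lookup \<gamma> l"
    proof (cases "l \<in> U")
      case True
      then show ?thesis using fun_cong[OF *(3), of l] by simp
    next
      case False
      then have "l \<notin> keys \<beta>" "l \<notin> keys \<gamma>" using * by auto
      then show ?thesis by (simp add: in_keys_iff)
    qed
  qed
  have sub: "(\<lambda>\<beta>. restrict (lookup \<beta>) U) ` ?E \<subseteq> PiE U (\<lambda>_. {..<j})"
  proof clarify
    fix \<beta> :: "nat \<Rightarrow>\<^sub>0 nat" assume \<beta>: "keys \<beta> \<subseteq> U" "mdeg \<beta> < j"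
    have "lookup \<beta> i < j" for i
    proof (cases "i \<in> keys \<beta>")
      case True
      then have "lookup \<beta> i \<le> mdeg \<beta>" unfolding wdeg_def
        using member_le_sum[of i "keys \<beta>" "\<lambda>i. 1 * lookup \<beta> i"] by simp
      then show ?thesis using \<beta>(2) by simp
    qed (use \<beta>(2) in \<open>auto simp: in_keys_iff\<close>)
    then show "restrict (lookup \<beta>) U \<in> PiE U (\<lambda>_. {..<j})" by auto
  qed
  have fin: "finite (PiE U (\<lambda>_. {..<j}))" by (intro finite_PiE assms) auto
  show "finite ?E" using finite_subset[OF sub fin] inj by (rule finite_imageD)
  have "card ?E = card ((\<lambda>\<beta>. restrict (lookup \<beta>) U) ` ?E)" using inj by (simp add: card_image)
  also have "\<dots> \<le> card (PiE U (\<lambda>_. {..<j}))" using fin sub by (rule card_mono)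
  finally show "card ?E \<le> j ^ card U" using assms by (simp add: card_PiE)
qed

text \<open>The dimension of the quotient by \<open>I + \<mm>^j\<close>, taken as the least size of
  a spanning set. A finite one exists for every ideal by \<open>qdim_witness\<close>, so
  \<open>LEAST\<close> has a genuine value.\<close>

definition qdim :: "nat \<Rightarrow> (nat \<Rightarrow> 'k) \<Rightarrow> 'k::field mpoly set \<Rightarrow> nat \<Rightarrow> nat" where
  "qdim n x I j = (LEAST N. \<exists>B. finite B \<and> card B = N \<and> spans_mod n x I j B)"

lemma qdim_le: "finite B \<Longrightarrow> spans_mod n x I j B \<Longrightarrow> qdim n x I j \<le> card B"
  unfolding qdim_def by (rule Least_le) blast

lemma qdim_witness:
  assumes "poly_ideal n I"
  obtains B where "finite B" "card B = qdim n x I j" "spans_mod n x I j B"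
proof -
  have "\<exists>l\<in>mp.span ((\<lambda>u. Var u - Const (x u)) ` {1..n}). \<exists>q\<in>I. \<exists>f\<in>ord_ge n x 2.
      Var i - Const (x i) = l + q + f" if "i \<in> {1..n}" for i
  proof -
    have "Var i - Const (x i) = (Var i - Const (x i)) + 0 + 0" by simp
    moreover have "Var i - Const (x i) \<in> mp.span ((\<lambda>u. Var u - Const (x u)) ` {1..n})"
      using that by (intro mp.span_base) auto
    ultimately show ?thesis
      using poly_idealD(2)[OF assms] poly_idealD(2)[OF poly_ideal_ord_ge] by blast
  qed
  from spans_mod_lmonom[OF assms order_refl this]
  have "\<exists>N B. finite B \<and> card B = N \<and> spans_mod n x I j B"
    using finite_exponents(1)[of "{1..n}" j] by blast
  from LeastI_ex[OF this] show ?thesis using that unfolding qdim_def by blast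
qed

section \<open>Enlarging an ideal by an element and by a colon\<close>

definition add_elem :: "nat \<Rightarrow> 'k::comm_ring_1 mpoly set \<Rightarrow> 'k mpoly \<Rightarrow> 'k mpoly set" where
  "add_elem n I a = {i + a * w | i w. i \<in> I \<and> w \<in> polys n}"

definition colon :: "nat \<Rightarrow> 'k::comm_ring_1 mpoly set \<Rightarrow> 'k mpoly \<Rightarrow> 'k mpoly set" where
  "colon n I a = {w \<in> polys n. a * w \<in> I}"

lemma poly_ideal_add_elem:
  assumes I: "poly_ideal n I" and a: "a \<in> polys n"
  shows "poly_ideal n (add_elem n I a)" "I \<subseteq> add_elem n I a" "a \<in> add_elem n I a"
proof -
  note ID = poly_idealD[OF I]
  show sub: "I \<subseteq> add_elem n I a"
  proof
    fix i assume "i \<in> I"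
    moreover have "i = i + a * 0" by simp
    ultimately show "i \<in> add_elem n I a" unfolding add_elem_def using polys_0 by blast
  qed
  have "a = 0 + a * 1" by simp
  then show "a \<in> add_elem n I a" unfolding add_elem_def using ID(2) polys_1 by blast
  show "poly_ideal n (add_elem n I a)"
    unfolding poly_ideal_def
  proof (intro conjI ballI)
    show "add_elem n I a \<subseteq> polys n" using ID(1) a by (auto simp: add_elem_def intro!: polys_add polys_mult)
    show "0 \<in> add_elem n I a" using sub ID(2) by blast
  next
    fix p q assume "p \<in> add_elem n I a" "q \<in> add_elem n I a"
    then obtain i w i' w' where *: "i \<in> I" "w \<in> polys n" "i' \<in> I" "w' \<in> polys n" "p = i + a * w" "q = i' + a * w'"
      unfolding add_elem_def by blast
    then have "p + q = (i + i') + a * (w + w')" by (simp add: algebra_simps)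
    then show "p + q \<in> add_elem n I a" unfolding add_elem_def
      using ID(3)[OF *(1,3)] polys_add[OF *(2,4)] by blast
  next
    fix p q :: "'a mpoly" assume "p \<in> add_elem n I a" and q: "q \<in> polys n"
    then obtain i w where *: "i \<in> I" "w \<in> polys n" "p = i + a * w"
      unfolding add_elem_def by blast
    then have "q * p = q * i + a * (q * w)" by (simp add: algebra_simps)
    then show "q * p \<in> add_elem n I a" unfolding add_elem_def
      using ID(4)[OF *(1) q] polys_mult[OF q *(2)] by blast
  qed
qed

lemma poly_ideal_colon:
  assumes I: "poly_ideal n I" and a: "a \<in> polys n"
  shows "poly_ideal n (colon n I a)" "I \<subseteq> colon n I a"
proof -
  note ID = poly_idealD[OF I]
  show "I \<subseteq> colon n I a" using ID(1) ID(4)[OF _ a] by (auto simp: colon_def)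
  show "poly_ideal n (colon n I a)"
    unfolding poly_ideal_def colon_def
    using ID(2) ID(3) ID(4)
    by (auto simp: distrib_left intro: polys_0 polys_add polys_mult) (metis mult.left_commute)
qed

text \<open>The exact sequence behind the inequality is
  \<open>0 \<rightarrow> A / (I : a) \<rightarrow> A / I \<rightarrow> A / (I + (a)) \<rightarrow> 0\<close>.\<close>

lemma qdim_split:
  assumes I: "poly_ideal n I" and a: "a \<in> ord_ge n x d" "d \<le> j"
    and K: "poly_ideal n K" "\<And>w. w \<in> K \<Longrightarrow> a * w \<in> I"
  shows "qdim n x I j \<le> qdim n x (add_elem n I a) j + qdim n x K (j - d)"
proof -
  note ID = poly_idealD[OF I]
  note FD = poly_idealD[OF poly_ideal_ord_ge[of n x]]
  have ap: "a \<in> polys n" using a by (auto simp: ord_ge_def)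
  obtain B where B: "finite B" "card B = qdim n x (add_elem n I a) j" "spans_mod n x (add_elem n I a) j B"
    by (rule qdim_witness[OF poly_ideal_add_elem(1)[OF I ap]])
  \<comment> \<open>Since \<open>a\<close> maps \<open>K\<close> into \<open>I\<close> and
    \<open>\<mm>^(j-d)\<close> into \<open>\<mm>^j\<close>, the multiples of \<open>a\<close> are
    spanned by \<open>a\<close> times a spanning set modulo \<open>K + \<mm>^(j-d)\<close>.\<close>
  obtain C where C: "finite C" "card C = qdim n x K (j - d)" "spans_mod n x K (j - d) C"
    by (rule qdim_witness[OF K(1)])
  have aC: "a * c \<in> mp.span ((*) a ` C)" if "c \<in> mp.span C" for c
    using that
  proof (induction rule: mp.span_induct_alt)
    case base
    then show ?case by (simp add: mp.span_zero)
  next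
    case (step c y z)
    then have "Const c * (a * y) + a * z \<in> mp.span ((*) a ` C)"
      by (intro mp.span_add mp.span_scale) (auto intro: mp.span_base)
    then show ?case by (simp add: algebra_simps)
  qed
  have "spans_mod n x I j (B \<union> (*) a ` C)"
    unfolding spans_mod_def
  proof
    fix p :: "'a mpoly" assume "p \<in> polys n"
    then obtain b i f where *: "b \<in> mp.span B" "i \<in> add_elem n I a" "f \<in> ord_ge n x j" "p = b + i + f"
      using B(3) unfolding spans_mod_def by blast
    obtain i' w where w: "i' \<in> I" "w \<in> polys n" "i = i' + a * w" using *(2) unfolding add_elem_def by blast
    obtain c k g where c: "c \<in> mp.span C" "k \<in> K" "g \<in> ord_ge n x (j - d)" "w = c + k + g"
      using C(3) w(2) unfolding spans_mod_def by blast
    have "p = (b + a * c) + (i' + a * k) + (a * g + f)"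
      unfolding *(4) w(3) c(4) by (simp add: algebra_simps)
    moreover have "b + a * c \<in> mp.span (B \<union> (*) a ` C)"
      using *(1) aC[OF c(1)] mp.span_mono[of B "B \<union> (*) a ` C"] mp.span_mono[of "(*) a ` C" "B \<union> (*) a ` C"]
      by (intro mp.span_add) auto
    moreover have "i' + a * k \<in> I" by (intro ID(3) w K(2) c)
    moreover have "a * g + f \<in> ord_ge n x j"
      using ord_ge_mult[OF a(1) c(3)] a(2) *(3) by (intro FD(3)) auto
    ultimately show "\<exists>b\<in>mp.span (B \<union> (*) a ` C). \<exists>i\<in>I. \<exists>f\<in>ord_ge n x j. p = b + i + f"
      by blast
  qed
  then have "qdim n x I j \<le> card (B \<union> (*) a ` C)" using B(1) C(1) by (intro qdim_le) auto
  also have "\<dots> \<le> card B + card ((*) a ` C)" by (rule card_Un_le)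
  also have "\<dots> \<le> card B + card C" using C(1) by (intro add_left_mono card_image_le)
  finally show ?thesis using B(2) C(2) by simp
qed

lemma qdim_antimono:
  assumes "poly_ideal n I" "I \<subseteq> J" "i \<le> j"
  shows "qdim n x J i \<le> qdim n x I j"
proof -
  obtain B where B: "finite B" "card B = qdim n x I j" "spans_mod n x I j B"
    by (rule qdim_witness[OF assms(1)])
  have "spans_mod n x J i B"
    using B(3) assms(2) ord_ge_antimono[OF assms(3), of n x] unfolding spans_mod_def by blast
  then show ?thesis using qdim_le[OF B(1)] B(2) by metis
qed

lemma qdim_0:
  assumes "poly_ideal n I"
  shows "qdim n x I 0 = 0"
proof -
  have "spans_mod n x I 0 {}" unfolding spans_mod_def
  proof
    fix p :: "'a mpoly" assume "p \<in> polys n"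
    then have "p = 0 + 0 + p" "p \<in> ord_ge n x 0" by auto
    then show "\<exists>b\<in>mp.span {}. \<exists>i\<in>I. \<exists>f\<in>ord_ge n x 0. p = b + i + f"
      using poly_idealD(2)[OF assms] mp.span_zero by blast
  qed
  then show ?thesis using qdim_le[of "{}" n x I 0] by simp
qed

lemma qdim_trivial:
  assumes I: "poly_ideal n I" and f: "1 - f \<in> I" "f \<in> ord_ge n x j"
  shows "qdim n x I j = 0"
proof -
  have "spans_mod n x I j {}" unfolding spans_mod_def
  proof
    fix p :: "'a mpoly" assume p: "p \<in> polys n"
    have "p = 0 + p * (1 - f) + p * f" by (simp add: algebra_simps)
    then show "\<exists>b\<in>mp.span {}. \<exists>i\<in>I. \<exists>f\<in>ord_ge n x j. p = b + i + f"
      using poly_idealD(4)[OF I f(1) p] poly_idealD(4)[OF poly_ideal_ord_ge f(2) p] mp.span_zero by blast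
  qed
  then show ?thesis using qdim_le[of "{}" n x I j] by simp
qed

text \<open>Growth of order at least \<open>j ^ e\<close> along infinitely many \<open>j\<close>.
  Its negation bounds \<open>qdim\<close> for all large \<open>j\<close>, so that two failures hold
  at a common \<open>j\<close>.\<close>

definition big :: "nat \<Rightarrow> (nat \<Rightarrow> 'k) \<Rightarrow> nat \<Rightarrow> 'k::field mpoly set \<Rightarrow> bool" where
  "big n x e I \<longleftrightarrow> (\<exists>C. \<forall>k. \<exists>j>k. j ^ e \<le> C * qdim n x I j)"

text \<open>Subadditivity of \<open>qdim\<close> along the colon sequence leaves at least half of
  the growth to one of the two ideals.\<close>

lemma big_split:
  assumes I: "poly_ideal n I" and a: "a \<in> polys n" and big: "big n x e I"
  shows "big n x e (add_elem n I a) \<or> big n x e (colon n I a)"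
proof (rule ccontr)
  let ?q = "qdim n x (add_elem n I a)" and ?r = "qdim n x (colon n I a)"
  assume no: "\<not> ?thesis"
  obtain C where C: "\<And>k. \<exists>j>k. j ^ e \<le> C * qdim n x I j" using big unfolding big_def by blast
  \<comment> \<open>Failure is applied with the constant \<open>2 * C\<close>, so that both
    contributions together stay below \<open>j ^ e\<close>.\<close>
  obtain k where k: "\<And>j. j > k \<Longrightarrow> (2 * C) * ?q j < j ^ e"
    using no unfolding big_def by (meson not_le)
  obtain l where l: "\<And>j. j > l \<Longrightarrow> (2 * C) * ?r j < j ^ e"
    using no unfolding big_def by (meson not_le)
  obtain j where j: "j > max k l" "j ^ e \<le> C * qdim n x I j" using C by blast
  have "qdim n x I j \<le> ?q j + ?r (j - 0)"
    by (rule qdim_split[OF I]) (use a poly_ideal_colon[OF I a] in \<open>auto simp: colon_def\<close>)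
  then have "C * qdim n x I j \<le> C * (?q j + ?r j)" by (intro mult_left_mono) auto
  then have "2 * j ^ e \<le> 2 * C * ?q j + 2 * C * ?r j" using j(2) by (simp add: algebra_simps)
  then show False using k[of j] l[of j] j(1) by simp
qed

text \<open>As \<open>a\<close> lies in \<open>\<mm>\<close>, multiplication by \<open>a\<close>
  shifts the filtration, so each step from \<open>j\<close> to \<open>j + 1\<close> raises
  \<open>qdim\<close> of \<open>I\<close> by at most the value for the enlarged ideal. Summation
  over the steps costs one factor \<open>j\<close>.\<close>

lemma big_cut:
  assumes I: "poly_ideal n I" and a: "a \<in> ord_ge n x 1" and big: "big n x (Suc e) I"
  shows "big n x e (add_elem n I a)"
proof -
  let ?J = "add_elem n I a"
  have ap: "a \<in> polys n" using a by (auto simp: ord_ge_def)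
  have J: "poly_ideal n ?J" by (rule poly_ideal_add_elem(1)[OF I ap])
  have bound: "qdim n x I j \<le> j * qdim n x ?J j" for j
  proof (induction j)
    case 0
    then show ?case by (simp add: qdim_0[OF I])
  next
    case (Suc j)
    have "qdim n x I (Suc j) \<le> qdim n x ?J (Suc j) + qdim n x I (Suc j - 1)"
      by (rule qdim_split[OF I a]) (use I poly_idealD(4)[OF I _ ap] in auto)
    also have "\<dots> \<le> qdim n x ?J (Suc j) + j * qdim n x ?J j" using Suc by simp
    also have "\<dots> \<le> qdim n x ?J (Suc j) + j * qdim n x ?J (Suc j)"
      using qdim_antimono[OF J order_refl, of j "Suc j"] by simp
    finally show ?case by simp
  qed
  obtain C where C: "\<And>k. \<exists>j>k. j ^ Suc e \<le> C * qdim n x I j" using big unfolding big_def by blast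
  have "\<exists>j>k. j ^ e \<le> C * qdim n x ?J j" for k
  proof -
    obtain j where j: "j > k" "j ^ Suc e \<le> C * qdim n x I j" using C by blast
    note j(2)
    also have "\<dots> \<le> C * (j * qdim n x ?J j)" using bound by (intro mult_left_mono) auto
    finally have "j * j ^ e \<le> j * (C * qdim n x ?J j)" by (simp add: mult_ac)
    then have "j ^ e \<le> C * qdim n x ?J j" using j(1) by (simp only: mult_le_cancel1)
    then show ?thesis using j(1) by blast
  qed
  then show ?thesis unfolding big_def by blast
qed

text \<open>The \<open>k ^ n\<close> local monomials with all exponents below \<open>k\<close> have
  degree below \<open>n * k\<close> and stay independent modulo \<open>\<mm>^(n*k)\<close>.\<close>

lemma big_zero_ideal:
  assumes "0 < n"
  shows "big n x n {0}"
proof -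
  have I: "poly_ideal n {0}" by (auto simp: poly_ideal_def polys_0)
  have key: "k ^ n \<le> qdim n x {0} (n * k)" if "0 < k" for k
  proof -
    let ?j = "n * k"
    obtain B where B: "finite B" "card B = qdim n x {0} ?j" "spans_mod n x {0} ?j B"
      by (rule qdim_witness[OF I])
    define mon where "mon = (\<lambda>\<beta>. \<Sum>i\<in>{1..n}. single i (\<beta> i) :: nat \<Rightarrow>\<^sub>0 nat)"
    define P where "P = PiE {1..n} (\<lambda>_. {..<k})"
    \<comment> \<open>Taylor coefficients of degree below \<open>n * k\<close>: a linear map that
      kills \<open>\<mm>^(n*k)\<close> and sends the local monomial of \<open>\<beta>\<close> to the
      indicator \<open>\<delta> \<beta>\<close>.\<close>
    define \<pi> where "\<pi> = (\<lambda>p \<alpha>. if mdeg \<alpha> < ?j then lookup (shift x p) \<alpha> else 0)"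
    define \<delta> where "\<delta> = (\<lambda>\<beta> \<alpha>. if \<alpha> = mon \<beta> then 1 else (0::'a))"
    have lmon: "lookup (mon \<beta>) l = (if l \<in> {1..n} then \<beta> l else 0)" for \<beta> l
      by (auto simp: mon_def lookup_sum lookup_single when_def sum.delta')
    have kmon: "keys (mon \<beta>) \<subseteq> {1..n}" for \<beta>
      by (auto simp: in_keys_iff lmon split: if_splits)
    have degmon: "mdeg (mon \<beta>) < ?j" if "\<beta> \<in> P" for \<beta>
    proof -
      have "mdeg (mon \<beta>) = (\<Sum>i=1..n. \<beta> i)"
        using wdeg_superset[OF finite_atLeastAtMost kmon, of "\<lambda>_. 1"] by (simp add: lmon)
      also have "\<dots> < (\<Sum>i=1..n. k)"
        using that \<open>0 < n\<close> by (intro sum_strict_mono) (auto simp: P_def PiE_def Pi_def)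
      finally show ?thesis by simp
    qed
    have inj: "\<beta> = \<gamma>" if "\<beta> \<in> P" "\<gamma> \<in> P" "mon \<beta> = mon \<gamma>" for \<beta> \<gamma>
    proof
      fix l
      show "\<beta> l = \<gamma> l"
      proof (cases "l \<in> {1..n}")
        case True
        then show ?thesis using lmon[of \<beta> l] lmon[of \<gamma> l] that(3) by simp
      next
        case False
        then show ?thesis using that(1,2) by (auto simp: P_def PiE_def extensional_def)
      qed
    qed
    have \<pi>span: "\<pi> b \<in> fun_vs.span (\<pi> ` B)" if "b \<in> mp.span B" for b
      using that
    proof (induction rule: mp.span_induct_alt)
      case base
      have "\<pi> 0 = 0" by (auto simp: \<pi>_def shift.hom_zero)
      then show ?case by (simp only: fun_vs.span_zero)
    next
      case (step c y z)
      have cl: "lookup (Const c * q) \<alpha> = c * lookup q \<alpha>" for q :: "'a mpoly" and \<alpha>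
      proof -
        have "Const c * q = (\<Sum>\<beta>\<in>keys q. single \<beta> (c * lookup q \<beta>))"
          by (subst mpoly_sum_single[of q]) (simp add: sum_distrib_left Const_def mult_single)
        then show ?thesis
          by (auto simp: lookup_sum lookup_single when_def sum.delta' in_keys_iff)
      qed
      have "\<pi> (Const c * y + z) = (\<lambda>i. c * \<pi> y i) + \<pi> z"
        by (auto simp: \<pi>_def shift.hom_add shift.hom_mult lookup_add cl fun_eq_iff)
      moreover have "(\<lambda>i. c * \<pi> y i) + \<pi> z \<in> fun_vs.span (\<pi> ` B)"
        by (intro fun_vs.span_add fun_vs.span_scale fun_vs.span_base imageI step)
      ultimately show ?case by (simp only:)
    qed
    have "card P \<le> card (\<pi> ` B)"
    proof (rule fun_vs.family_card_le[where \<phi> = \<delta>])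
      show "finite P" unfolding P_def by (intro finite_PiE) auto
      show "finite (\<pi> ` B)" using B by simp
      show "\<delta> \<beta> \<in> fun_vs.span (\<pi> ` B)" if \<beta>: "\<beta> \<in> P" for \<beta>
      proof -
        obtain b f where *: "b \<in> mp.span B" "f \<in> ord_ge n x ?j" "lmonom x (mon \<beta>) = b + f"
          using B(3) lmonom_closed[OF kmon, of x \<beta>] unfolding spans_mod_def by auto
        have "\<delta> \<beta> = \<pi> (lmonom x (mon \<beta>))"
          using degmon[OF \<beta>] by (auto simp: \<delta>_def \<pi>_def shift_lmonom[OF kmon] lookup_single when_def fun_eq_iff)
        also have "\<dots> = \<pi> b"
        proof
          fix \<alpha>
          have "lookup (shift x f) \<alpha> = 0" if "mdeg \<alpha> < ?j"
          proof -
            have "\<alpha> \<notin> keys (shift x f)" using *(2) that unfolding ord_ge_def by fastforce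
            then show ?thesis by (simp add: in_keys_iff)
          qed
          then show "\<pi> (lmonom x (mon \<beta>)) \<alpha> = \<pi> b \<alpha>"
            unfolding *(3) by (simp add: \<pi>_def shift.hom_add lookup_add)
        qed
        finally show ?thesis using \<pi>span[OF *(1)] by simp
      qed
      show "c \<beta> = 0" if c: "(\<Sum>\<beta>\<in>P. (\<lambda>\<alpha>. c \<beta> * \<delta> \<beta> \<alpha>)) = 0" "\<beta> \<in> P" for c \<beta>
      proof -
        have "0 = (\<Sum>\<gamma>\<in>P. c \<gamma> * \<delta> \<gamma> (mon \<beta>))"
          using fun_cong[OF c(1), of "mon \<beta>"] by (simp add: sum_fun_apply)
        also have "\<dots> = (\<Sum>\<gamma>\<in>P. if \<gamma> = \<beta> then c \<beta> else 0)"
          using inj c(2) by (intro sum.cong) (auto simp: \<delta>_def)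
        also have "\<dots> = c \<beta>"
          using c(2) by (simp add: P_def finite_PiE)
        finally show ?thesis by simp
      qed
    qed
    also have "\<dots> \<le> card B" using B(1) by (rule card_image_le)
    finally show ?thesis using B(2) by (simp add: P_def card_PiE)
  qed
  have "\<exists>j>k. j ^ n \<le> n ^ n * qdim n x {0} j" for k
  proof (intro exI conjI)
    show "k < n * Suc k" using \<open>0 < n\<close> by (cases n) auto
    show "(n * Suc k) ^ n \<le> n ^ n * qdim n x {0} (n * Suc k)"
      using key[of "Suc k"] by (simp add: power_mult_distrib del: mult_Suc_right)
  qed
  then show ?thesis unfolding big_def by blast
qed

text \<open>If \<open>p * q\<close> lies in a maximal big ideal \<open>P\<close>, then by
  \<open>big_split\<close> adding \<open>p\<close> or passing to the colon ideal keeps the growth,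
  and maximality puts \<open>p\<close> or \<open>q\<close> into \<open>P\<close>. Growth also keeps
  \<open>P\<close> inside \<open>\<mm>\<close>, as otherwise the local quotients vanish.\<close>

lemma big_prime:
  assumes I: "poly_ideal n I" and big: "big n x e I"
  obtains P where "poly_prime n P" "I \<subseteq> P" "big n x e P" "P \<subseteq> ord_ge n x 1"
proof -
  obtain P where P: "poly_ideal n P" "big n x e P" "I \<subseteq> P"
    and max: "\<And>K. poly_ideal n K \<Longrightarrow> big n x e K \<Longrightarrow> P \<subseteq> K \<Longrightarrow> K = P"
    using maximal_ideal_with_property[of n I "big n x e"] I big by blast
  note PD = poly_idealD[OF P(1)]
  have nontriv: "\<exists>j>k. qdim n x P j \<noteq> 0" for k
  proof -
    obtain C where C: "\<And>k. \<exists>j>k. j ^ e \<le> C * qdim n x P j" using P(2) unfolding big_def by blast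
    obtain j where "j > k" "j ^ e \<le> C * qdim n x P j" using C by blast
    moreover from this have "0 < j ^ e" by simp
    ultimately show ?thesis by (intro exI[of _ j]) (cases "qdim n x P j = 0", auto)
  qed
  have one: "1 \<notin> P"
  proof
    assume "1 \<in> P"
    then have "1 - 0 \<in> P" by simp
    then have "qdim n x P j = 0" for j
      using qdim_trivial[OF P(1)] poly_idealD(2)[OF poly_ideal_ord_ge] by blast
    then show False using nontriv[of 0] by simp
  qed
  have prime: "p \<in> P \<or> q \<in> P" if pq: "p \<in> polys n" "q \<in> polys n" "p * q \<in> P" for p q
  proof -
    from big_split[OF P(1) pq(1) P(2)] show ?thesis
    proof
      assume "big n x e (add_elem n P p)"
      then have "add_elem n P p = P"
        by (intro max poly_ideal_add_elem P pq)
      then show ?thesis using poly_ideal_add_elem(3)[OF P(1) pq(1)] by blast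
    next
      assume "big n x e (colon n P p)"
      then have "colon n P p = P"
        by (intro max poly_ideal_colon P pq)
      moreover have "q \<in> colon n P p" using pq by (simp add: colon_def)
      ultimately show ?thesis by blast
    qed
  qed
  have "P \<subseteq> ord_ge n x 1"
  proof
    fix q assume q: "q \<in> P"
    then have qp: "q \<in> polys n" using PD(1) by blast
    have "ev x q = 0"
    proof (rule ccontr)
      assume c: "ev x q \<noteq> 0"
      \<comment> \<open>Scaling gives \<open>u \<in> P\<close> with value 1 at \<open>x\<close>.
        Then \<open>a = 1 - u\<close> lies in \<open>\<mm>\<close> and \<open>1 - a ^ j\<close> in
        \<open>P\<close>, so 1 lies in \<open>P + \<mm>^j\<close> and the quotient is zero.\<close>
      define u where "u = Const (inverse (ev x q)) * q"
      define a where "a = 1 - u"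
      have uP: "u \<in> P" unfolding u_def by (rule PD(4)[OF q polys_Const])
      have up: "u \<in> polys n" using uP PD(1) by blast
      have ap: "a \<in> polys n" unfolding a_def by (rule polys_diff[OF polys_1 up])
      have aF: "a \<in> ord_ge n x 1"
        unfolding ord_ge_1_iff[OF ap] using c by (simp add: a_def u_def ev.hom_minus ev.hom_mult ev.hom_one)
      obtain j where j: "qdim n x P j \<noteq> 0" using nontriv by blast
      have "1 - a ^ j = (1 - a) * (\<Sum>i<j. a ^ i)" by (rule one_diff_power_eq)
      also have "1 - a = u" by (simp add: a_def)
      also have "u * (\<Sum>i<j. a ^ i) \<in> P"
        by (rule PD(5)[OF uP]) (intro polys_sum polys_power ap)
      finally have "qdim n x P j = 0" using qdim_trivial[OF P(1) _ ord_ge_power[OF aF]] by blast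
      then show False using j by blast
    qed
    then show "q \<in> ord_ge n x 1" using ord_ge_1_iff[OF qp] by blast
  qed
  moreover have "poly_prime n P" unfolding poly_prime_def using P(1) one prime by blast
  ultimately show ?thesis using that P(2,3) by blast
qed

lemma big_prime_chain:
  assumes "poly_ideal n I" "big n x e I"
  shows "\<exists>Q. (\<forall>i\<le>e. poly_prime n (Q i) \<and> Q i \<subseteq> ord_ge n x 1 \<and> I \<subseteq> Q i) \<and> (\<forall>i<e. Q (Suc i) \<subset> Q i)"
  using assms
proof (induction e arbitrary: I)
  case 0
  then obtain P where "poly_prime n P" "I \<subseteq> P" "P \<subseteq> ord_ge n x 1" by (rule big_prime)
  then show ?case by (intro exI[of _ "\<lambda>_. P"]) auto
next
  case (Suc e)
  obtain P where P: "poly_prime n P" "I \<subseteq> P" "big n x (Suc e) P" "P \<subseteq> ord_ge n x 1"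
    by (rule big_prime[OF Suc.prems])
  note PI = poly_primeD(1)[OF P(1)]
  \<comment> \<open>Otherwise the constants span every quotient, which excludes growth of positive
    order.\<close>
  have "\<not> ord_ge n x 1 \<subseteq> P"
  proof
    assume sub: "ord_ge n x 1 \<subseteq> P"
    have "spans_mod n x P j {1}" for j unfolding spans_mod_def
    proof
      fix p :: "'a mpoly" assume p: "p \<in> polys n"
      have "p - Const (ev x p) \<in> ord_ge n x 1"
        using p by (subst ord_ge_1_iff) (auto simp: ev.hom_minus intro: polys_intros)
      then have "p - Const (ev x p) \<in> P" using sub by blast
      moreover have "Const (ev x p) * 1 \<in> mp.span {1}" by (intro mp.span_scale mp.span_base) simp
      moreover have "p = Const (ev x p) * 1 + (p - Const (ev x p)) + 0" by simp
      ultimately show "\<exists>b\<in>mp.span {1}. \<exists>i\<in>P. \<exists>f\<in>ord_ge n x j. p = b + i + f"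
        using poly_idealD(2)[OF poly_ideal_ord_ge] by blast
    qed
    then have le1: "qdim n x P j \<le> 1" for j using qdim_le[of "{1}" n x P j] by simp
    obtain C where C: "\<And>k. \<exists>j>k. j ^ Suc e \<le> C * qdim n x P j" using P(3) unfolding big_def by blast
    obtain j where j: "j > C" "j ^ Suc e \<le> C * qdim n x P j" using C by blast
    have "j \<le> j ^ Suc e" using j(1) by (intro self_le_power) auto
    also note j(2)
    also have "C * qdim n x P j \<le> C" using le1[of j] by (cases "qdim n x P j") auto
    finally show False using j(1) by simp
  qed
  then obtain l where l: "l \<in> ord_ge n x 1" "l \<notin> P" by blast
  have lp: "l \<in> polys n" using l(1) by (auto simp: ord_ge_def)
  let ?J = "add_elem n P l"
  have "big n x e ?J" by (rule big_cut[OF PI l(1) P(3)])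
  then obtain Q where Q: "\<forall>i\<le>e. poly_prime n (Q i) \<and> Q i \<subseteq> ord_ge n x 1 \<and> ?J \<subseteq> Q i" "\<forall>i<e. Q (Suc i) \<subset> Q i"
    using Suc.IH[OF poly_ideal_add_elem(1)[OF PI lp]] by blast
  have PQ: "P \<subset> Q e" using Q(1) poly_ideal_add_elem(2,3)[OF PI lp] l(2) by blast
  have PQi: "P \<subseteq> Q i" if "i \<le> e" for i using Q(1) poly_ideal_add_elem(2)[OF PI lp] that by blast
  \<comment> \<open>Chains are indexed downwards, so the smaller prime \<open>P\<close> goes to the
    end.\<close>
  let ?Q = "Q(Suc e := P)"
  have "poly_prime n (?Q i) \<and> ?Q i \<subseteq> ord_ge n x 1 \<and> I \<subseteq> ?Q i" if "i \<le> Suc e" for i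
    using that Q(1) P PQi[of i] by (cases "i = Suc e") auto
  moreover have "?Q (Suc i) \<subset> ?Q i" if "i < Suc e" for i
    using that Q(2) PQ by (cases "i = e") auto
  ultimately show ?case by blast
qed


section \<open>Growth modulo a regular sequence\<close>

lemma poly_ideal_iff_ideal: "poly_ideal n I \<longleftrightarrow> ideal I (mpoly_ring n)"
proof
  interpret cring "mpoly_ring n :: 'a mpoly ring" by (rule cring_mpoly_ring)
  have inv: "\<ominus>\<^bsub>mpoly_ring n\<^esub> p = - p" if "p \<in> polys n" for p :: "'a mpoly"
    using that by (intro minus_equality) (auto simp: mpoly_ring_simps intro: polys_uminus)
  show "ideal I (mpoly_ring n)" if I: "poly_ideal n I"
  proof -
    note ID = poly_idealD[OF I]
    show ?thesis
    proof (rule idealI)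
      show "subgroup I (add_monoid (mpoly_ring n))"
      proof (rule group.subgroupI)
        show "group (add_monoid (mpoly_ring n :: 'a mpoly ring))" by (rule add.group_axioms)
        show "I \<subseteq> carrier (add_monoid (mpoly_ring n))" "I \<noteq> {}" using ID(1,2) by auto
        show "inv\<^bsub>add_monoid (mpoly_ring n)\<^esub> a \<in> I" if "a \<in> I" for a
          using ID(6)[OF that] inv[of a] ID(1) that by (auto simp: a_inv_def)
        show "a \<otimes>\<^bsub>add_monoid (mpoly_ring n)\<^esub> b \<in> I" if "a \<in> I" "b \<in> I" for a b
          using ID(3)[OF that] by (simp add: mpoly_ring_simps)
      qed
    qed (use ID(4,5) ring_axioms in \<open>auto simp: mpoly_ring_simps\<close>)
  qed
  show "poly_ideal n I" if "ideal I (mpoly_ring n)"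
  proof -
    interpret ideal I "mpoly_ring n" by fact
    show ?thesis unfolding poly_ideal_def
      using a_subset zero_closed a_closed I_l_closed by (auto simp: mpoly_ring_simps)
  qed
qed

text \<open>Every variable has weight at least 1, so over a finite field each piece of this
  filtration is finite.\<close>

definition wfil :: "nat \<Rightarrow> nat \<Rightarrow> 'a::comm_ring_1 mpoly set" where
  "wfil n w = {p \<in> polys n. wdeg_le (\<lambda>i. i) p w}"

lemma wfil_mono: "v \<le> w \<Longrightarrow> wfil n v \<subseteq> wfil n w"
  by (auto simp: wfil_def intro: wdeg_le_mono)

lemma wfil_add: "p \<in> wfil n w \<Longrightarrow> q \<in> wfil n w \<Longrightarrow> p + q \<in> wfil n w"
  by (auto simp: wfil_def intro: polys_add wdeg_le_add)

lemma wfil_mult: "p \<in> wfil n v \<Longrightarrow> q \<in> wfil n w \<Longrightarrow> p * q \<in> wfil n (v + w)"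
  by (auto simp: wfil_def intro: polys_mult wdeg_le_mult)

lemma weighted_exponents:
  shows "finite {\<alpha> :: nat \<Rightarrow>\<^sub>0 nat. keys \<alpha> \<subseteq> {1..n} \<and> wdeg (\<lambda>i. i) \<alpha> \<le> w}"
    "card {\<alpha> :: nat \<Rightarrow>\<^sub>0 nat. keys \<alpha> \<subseteq> {1..n} \<and> wdeg (\<lambda>i. i) \<alpha> \<le> w} \<le> (w + 1) ^ n"
proof -
  have sub: "{\<alpha> :: nat \<Rightarrow>\<^sub>0 nat. keys \<alpha> \<subseteq> {1..n} \<and> wdeg (\<lambda>i. i) \<alpha> \<le> w} \<subseteq>
      {\<alpha>. keys \<alpha> \<subseteq> {1..n} \<and> mdeg \<alpha> < w + 1}"
  proof clarify
    fix \<alpha> :: "nat \<Rightarrow>\<^sub>0 nat" assume \<alpha>: "keys \<alpha> \<subseteq> {1..n}" "wdeg (\<lambda>i. i) \<alpha> \<le> w"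
    have "mdeg \<alpha> \<le> wdeg (\<lambda>i. i) \<alpha>"
      unfolding wdeg_def using \<alpha>(1) by (intro sum_mono mult_right_mono) auto
    then show "mdeg \<alpha> < w + 1" using \<alpha>(2) by simp
  qed
  note fin = finite_exponents[of "{1..n}" "w + 1"]
  show "finite {\<alpha> :: nat \<Rightarrow>\<^sub>0 nat. keys \<alpha> \<subseteq> {1..n} \<and> wdeg (\<lambda>i. i) \<alpha> \<le> w}"
    using finite_subset[OF sub] fin(1) by simp
  show "card {\<alpha> :: nat \<Rightarrow>\<^sub>0 nat. keys \<alpha> \<subseteq> {1..n} \<and> wdeg (\<lambda>i. i) \<alpha> \<le> w} \<le> (w + 1) ^ n"
    using card_mono[OF _ sub] fin by simp
qed

lemma finite_wfil:
  fixes n w :: nat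
  shows "finite (wfil n w :: 'q::{finite, field} mpoly set)"
    "card (wfil n w :: 'q mpoly set) \<le> card (UNIV :: 'q set) ^ ((w + 1) ^ n)"
proof -
  let ?E = "{\<alpha> :: nat \<Rightarrow>\<^sub>0 nat. keys \<alpha> \<subseteq> {1..n} \<and> wdeg (\<lambda>i. i) \<alpha> \<le> w}"
  let ?F = "PiE ?E (\<lambda>_. UNIV :: 'q set)"
  have sub: "wfil n w \<subseteq> (\<lambda>f. \<Sum>\<alpha>\<in>?E. single \<alpha> (f \<alpha>)) ` ?F"
  proof
    fix p :: "'q mpoly" assume p: "p \<in> wfil n w"
    have "keys p \<subseteq> ?E" using p by (auto simp: wfil_def wdeg_le_def carrier_mpoly_ring)
    then have "(\<Sum>\<alpha>\<in>keys p. single \<alpha> (lookup p \<alpha>)) = (\<Sum>\<alpha>\<in>?E. single \<alpha> (lookup p \<alpha>))"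
      by (intro sum.mono_neutral_left weighted_exponents) (auto simp: in_keys_iff)
    also have "\<dots> = (\<Sum>\<alpha>\<in>?E. single \<alpha> (restrict (lookup p) ?E \<alpha>))"
      by (intro sum.cong) auto
    finally have eq: "(\<Sum>\<alpha>\<in>?E. single \<alpha> (restrict (lookup p) ?E \<alpha>)) = p"
      using mpoly_sum_single[of p] by simp
    have "restrict (lookup p) ?E \<in> ?F" by auto
    then have "(\<Sum>\<alpha>\<in>?E. single \<alpha> (restrict (lookup p) ?E \<alpha>)) \<in> (\<lambda>f. \<Sum>\<alpha>\<in>?E. single \<alpha> (f \<alpha>)) ` ?F"
      by (rule imageI)
    then show "p \<in> (\<lambda>f. \<Sum>\<alpha>\<in>?E. single \<alpha> (f \<alpha>)) ` ?F" by (simp only: eq)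
  qed
  have fin: "finite ?F" by (intro finite_PiE weighted_exponents) auto
  show "finite (wfil n w :: 'q mpoly set)" using finite_subset[OF sub] fin by blast
  have "card (wfil n w :: 'q mpoly set) \<le> card ((\<lambda>f. \<Sum>\<alpha>\<in>?E. single \<alpha> (f \<alpha>)) ` ?F)"
    using sub fin by (intro card_mono) auto
  also have "\<dots> \<le> card ?F" using fin by (rule card_image_le)
  also have "\<dots> = card (UNIV :: 'q set) ^ card ?E"
    by (simp only: card_PiE[OF weighted_exponents(1)] prod_constant)
  also have "\<dots> \<le> card (UNIV :: 'q set) ^ ((w + 1) ^ n)"
    using weighted_exponents(2)[of n w] finite_UNIV_card_ge_0[OF finite[of "UNIV :: 'q set"]]
    by (intro power_increasing) (auto simp: Suc_le_eq)
  finally show "card (wfil n w :: 'q mpoly set) \<le> card (UNIV :: 'q set) ^ ((w + 1) ^ n)" .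
qed

section \<open>Counting residue classes over a finite field\<close>

definition residue_class :: "'a::comm_ring_1 mpoly set \<Rightarrow> 'a mpoly \<Rightarrow> 'a mpoly set" where
  "residue_class I p = {q. p - q \<in> I}"

lemma residue_class_eq_iff:
  assumes I: "poly_ideal n I"
  shows "residue_class I p = residue_class I q \<longleftrightarrow> p - q \<in> I"
proof
  assume "residue_class I p = residue_class I q"
  moreover have "q \<in> residue_class I q" using poly_idealD(2)[OF I] by (simp add: residue_class_def)
  ultimately show "p - q \<in> I" by (simp add: residue_class_def set_eq_iff)
next
  note ID = poly_idealD[OF I]
  assume pq: "p - q \<in> I"
  have "p - t \<in> I \<longleftrightarrow> q - t \<in> I" for t
    using ID(3)[OF pq, of "q - t"] ID(7)[OF _ pq, of "p - t"] by auto
  then show "residue_class I p = residue_class I q" by (auto simp: residue_class_def)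
qed

text \<open>Over a finite field with \<open>q\<close> elements, the logarithm to the base
  \<open>q\<close> of this number is the dimension of the part of weight at most \<open>w\<close> of
  the quotient. Cardinalities thus stand in for dimensions.\<close>

definition class_count :: "nat \<Rightarrow> 'a::comm_ring_1 mpoly set \<Rightarrow> nat \<Rightarrow> nat" where
  "class_count n I w = card (residue_class I ` wfil n w)"

lemma class_count_mono:
  fixes I :: "'q::{finite, field} mpoly set"
  shows "v \<le> w \<Longrightarrow> class_count n I v \<le> class_count n I w"
  unfolding class_count_def by (intro card_mono image_mono finite_imageI finite_wfil wfil_mono)

lemma class_count_pos:
  fixes I :: "'q::{finite, field} mpoly set"
  shows "0 < class_count n I w"
proof -
  have "0 \<in> wfil n w" by (simp add: wfil_def polys_0 wdeg_le_0)
  then show ?thesis unfolding class_count_def by (subst card_gt_0_iff) (use finite_wfil in blast)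
qed

text \<open>If \<open>F\<close> is a non-zero-divisor modulo \<open>I\<close>, then \<open>(a, b) \<mapsto> a + b F\<close> embeds
  pairs of residue classes modulo \<open>I + (F)\<close> and \<open>I\<close> into residue classes modulo \<open>I\<close>.\<close>

lemma class_count_step:
  fixes I I' :: "'q::{finite, field} mpoly set"
  assumes I: "poly_ideal n I" and I': "poly_ideal n I'" and "I \<subseteq> I'" and F: "F \<in> I'" "F \<in> wfil n d"
    and nzd: "\<And>g. g \<in> polys n \<Longrightarrow> g * F \<in> I \<Longrightarrow> g \<in> I"
  shows "class_count n I' (w + d) * class_count n I w \<le> class_count n I (w + d)"
proof -
  define rep :: "'q mpoly set \<Rightarrow> nat \<Rightarrow> 'q mpoly set \<Rightarrow> 'q mpoly" where
    "rep = (\<lambda>I w. inv_into (wfil n w) (residue_class I))"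
  have rep: "rep I w A \<in> wfil n w" "residue_class I (rep I w A) = A"
    if "A \<in> residue_class I ` wfil n w" for I w A
    unfolding rep_def using that by (rule inv_into_into, rule f_inv_into_f)
  let ?X = "residue_class I' ` wfil n (w + d)" and ?Y = "residue_class I ` wfil n w"
  let ?f = "\<lambda>(A, B). residue_class I (rep I' (w + d) A + rep I w B * F)"
  have "inj_on ?f (?X \<times> ?Y)"
  proof (rule inj_onI)
    fix u v assume uv: "u \<in> ?X \<times> ?Y" "v \<in> ?X \<times> ?Y" "?f u = ?f v"
    obtain A B A' B' where u: "u = (A, B)" and v: "v = (A', B')" by (cases u, cases v) blast
    have mem: "A \<in> ?X" "B \<in> ?Y" "A' \<in> ?X" "B' \<in> ?Y" using uv u v by auto
    have eq: "residue_class I (rep I' (w + d) A + rep I w B * F) = residue_class I (rep I' (w + d) A' + rep I w B' * F)"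
      using uv(3) unfolding u v by simp
    let ?a = "rep I' (w + d) A" and ?a' = "rep I' (w + d) A'" and ?b = "rep I w B" and ?b' = "rep I w B'"
    have bp: "?b - ?b' \<in> polys n" using rep(1)[OF mem(2)] rep(1)[OF mem(4)] by (auto simp: wfil_def intro: polys_diff)
    have "(?a + ?b * F) - (?a' + ?b' * F) \<in> I" using eq residue_class_eq_iff[OF I] by blast
    then have in_I: "(?a - ?a') + (?b - ?b') * F \<in> I" by (simp add: algebra_simps)
    \<comment> \<open>Modulo \<open>I'\<close> the multiple of \<open>F\<close> disappears and
      \<open>A\<close> is recovered; what remains is a multiple of \<open>F\<close> in
      \<open>I\<close>, from which the non-zero-divisor property recovers \<open>B\<close>.\<close>
    then have "(?a - ?a') + (?b - ?b') * F \<in> I'" using \<open>I \<subseteq> I'\<close> by blast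
    moreover have "(?b - ?b') * F \<in> I'" by (rule poly_idealD(4)[OF I' F(1) bp])
    ultimately have "((?a - ?a') + (?b - ?b') * F) - (?b - ?b') * F \<in> I'" by (rule poly_idealD(7)[OF I'])
    then have "?a - ?a' \<in> I'" by simp
    then have A: "A = A'" using residue_class_eq_iff[OF I'] rep(2)[OF mem(1)] rep(2)[OF mem(3)] by metis
    then have "(?b - ?b') * F \<in> I" using in_I by simp
    then have "?b - ?b' \<in> I" by (rule nzd[OF bp])
    then have "B = B'" using residue_class_eq_iff[OF I] rep(2)[OF mem(2)] rep(2)[OF mem(4)] by metis
    with A show "u = v" by (simp add: u v)
  qed
  moreover have "?f ` (?X \<times> ?Y) \<subseteq> residue_class I ` wfil n (w + d)"
  proof
    fix z assume "z \<in> ?f ` (?X \<times> ?Y)"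
    then obtain A B where AB: "A \<in> ?X" "B \<in> ?Y" and z: "z = residue_class I (rep I' (w + d) A + rep I w B * F)"
      by blast
    show "z \<in> residue_class I ` wfil n (w + d)" unfolding z
      by (intro imageI wfil_add wfil_mult rep F AB)
  qed
  ultimately have "card (?X \<times> ?Y) \<le> card (residue_class I ` wfil n (w + d))"
    by (rule card_inj_on_le) (simp add: finite_wfil)
  then show ?thesis by (simp add: class_count_def card_cartesian_product)
qed

text \<open>Iterating the embedding \<open>T\<close> times bounds
  \<open>class_count n I' w ^ T\<close> by \<open>class_count n I (w + T * d)\<close>. With
  \<open>T = w + 1\<close> the exponent on the right is still \<open>O((w+1)^(e+1))\<close>, and
  taking the root of order \<open>w + 1\<close> lowers the power by one.\<close>

lemma class_count_bound_step:
  fixes I I' :: "'q::{finite, field} mpoly set"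
  assumes I: "poly_ideal n I" and I': "poly_ideal n I'" and sub: "I \<subseteq> I'" and F: "F \<in> I'" "F \<in> polys n"
    and nzd: "\<And>g. g \<in> polys n \<Longrightarrow> g * F \<in> I \<Longrightarrow> g \<in> I"
    and C: "\<And>w. class_count n I w \<le> card (UNIV :: 'q set) ^ (C * (w + 1) ^ Suc e)"
  obtains C' where "\<And>w. class_count n I' w \<le> card (UNIV :: 'q set) ^ (C' * (w + 1) ^ e)"
proof -
  obtain d0 where "wdeg_le (\<lambda>i. i) F d0" using wdeg_le_exists by blast
  then obtain d where d: "F \<in> wfil n d" using F(2) by (auto simp: wfil_def)
  have step: "class_count n I' w ^ T * class_count n I w \<le> class_count n I (w + T * d)" for w T
  proof (induction T)
    case (Suc T)
    have "class_count n I' w ^ Suc T * class_count n I w \<le> class_count n I' w * class_count n I (w + T * d)"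
      using Suc by (simp add: mult.assoc)
    also have "\<dots> \<le> class_count n I' (w + T * d + d) * class_count n I (w + T * d)"
      by (intro mult_right_mono class_count_mono) auto
    also have "\<dots> \<le> class_count n I (w + T * d + d)"
      by (rule class_count_step[OF I I' sub F(1) d nzd])
    finally show ?case by (simp add: algebra_simps)
  qed simp
  have "class_count n I' w \<le> card (UNIV :: 'q set) ^ ((C * (1 + d) ^ Suc e) * (w + 1) ^ e)" for w
  proof -
    let ?K = "C * (1 + d) ^ Suc e"
    have "class_count n I' w ^ (w + 1) \<le> class_count n I' w ^ (w + 1) * class_count n I w"
      using class_count_pos[of n I w] by simp
    also have "\<dots> \<le> class_count n I (w + (w + 1) * d)" by (rule step)
    also have "\<dots> \<le> card (UNIV :: 'q set) ^ (C * (w + (w + 1) * d + 1) ^ Suc e)" by (rule C)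
    also have "w + (w + 1) * d + 1 = (1 + d) * (w + 1)" by (simp add: algebra_simps)
    also have "C * ((1 + d) * (w + 1)) ^ Suc e = (?K * (w + 1) ^ e) * (w + 1)"
      unfolding power_mult_distrib by (simp only: power_Suc mult_ac)
    also have "card (UNIV :: 'q set) ^ (?K * (w + 1) ^ e * (w + 1)) = (card (UNIV :: 'q set) ^ (?K * (w + 1) ^ e)) ^ (w + 1)"
      by (rule power_mult)
    finally show ?thesis by (rule power_le_imp_le_base[of _ w, unfolded Suc_eq_plus1]) simp
  qed
  then show ?thesis by (rule that)
qed

text \<open>A spanning set of least size is independent modulo \<open>I\<close>, so its linear
  combinations give \<open>card UNIV ^ card B\<close> distinct residue classes.\<close>

lemma spanning_set_of_class_count:
  fixes I :: "'q::{finite, field} mpoly set"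
  assumes I: "poly_ideal n I" and N: "class_count n I w \<le> card (UNIV :: 'q set) ^ N"
  obtains B where "finite B" "card B \<le> N" "\<And>p. p \<in> wfil n w \<Longrightarrow> \<exists>b\<in>mp.span B. p - b \<in> I"
proof -
  note ID = poly_idealD[OF I]
  define ok where "ok = (\<lambda>B. finite B \<and> B \<subseteq> wfil n w \<and> (\<forall>p\<in>wfil n w. \<exists>b\<in>mp.span B. p - b \<in> I))"
  have "ok (wfil n w)"
    unfolding ok_def using finite_wfil ID(2) by (auto intro!: bexI[of _ p for p] mp.span_base)
  define B where "B = arg_min card ok"
  have B: "ok B" unfolding B_def using \<open>ok (wfil n w)\<close> by (rule arg_min_natI)
  have min: "card B \<le> card B'" if "ok B'" for B' unfolding B_def using that by (rule arg_min_nat_le)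
  have fin: "finite B" using B by (simp add: ok_def)
  let ?comb = "\<lambda>u. \<Sum>b\<in>B. Const (u b) * b"
  have indep: "u b0 = 0" if u: "?comb u \<in> I" "b0 \<in> B" for u b0
  proof (rule ccontr)
    assume nz: "u b0 \<noteq> 0"
    define b1 where "b1 = (\<Sum>b\<in>B - {b0}. Const (u b) * b)"
    have b1: "b1 \<in> mp.span (B - {b0})"
      unfolding b1_def by (intro mp.span_sum mp.span_scale mp.span_base) auto
    have "?comb u = Const (u b0) * b0 + b1" unfolding b1_def using fin u(2) by (simp add: sum.remove)
    then have "Const (inverse (u b0)) * (Const (u b0) * b0 + b1) \<in> I"
      using ID(4)[OF u(1) polys_Const, of "inverse (u b0)"] by simp
    moreover have "Const (inverse (u b0)) * (Const (u b0) * b0 + b1) = b0 + Const (inverse (u b0)) * b1"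
      using nz by (simp add: distrib_left mult.assoc[symmetric] Const_simps(4)[symmetric] Const_simps(2))
    ultimately have b0: "b0 + Const (inverse (u b0)) * b1 \<in> I" by simp
    have "ok (B - {b0})" unfolding ok_def
    proof (intro conjI ballI)
      fix p :: "'q mpoly" assume "p \<in> wfil n w"
      then obtain b where b: "b \<in> mp.span B" "p - b \<in> I" using B unfolding ok_def by blast
      have "B = insert b0 (B - {b0})" using u(2) by blast
      then obtain k where k: "b - Const k * b0 \<in> mp.span (B - {b0})"
        using b(1) mp.span_breakdown_eq[of b b0 "B - {b0}"] by metis
      define b' where "b' = (b - Const k * b0) - Const k * (Const (inverse (u b0)) * b1)"
      have "b' \<in> mp.span (B - {b0})"
        unfolding b'_def by (intro mp.span_diff k mp.span_scale b1)
      moreover have "p - b' = (p - b) + Const k * (b0 + Const (inverse (u b0)) * b1)"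
        unfolding b'_def by (simp add: algebra_simps)
      then have "p - b' \<in> I" using ID(3)[OF b(2) ID(4)[OF b0 polys_Const, of k]] by (simp only:)
      ultimately show "\<exists>b\<in>mp.span (B - {b0}). p - b \<in> I" by blast
    qed (use B in \<open>auto simp: ok_def\<close>)
    from min[OF this] show False using u(2) fin by (simp add: card_gt_0_iff) (metis card_Diff1_less not_le card_Diff_singleton One_nat_def)
  qed
  have "card (UNIV :: 'q set) ^ card B = card (PiE B (\<lambda>_. UNIV :: 'q set))"
    using fin by (simp add: card_PiE)
  also have "\<dots> \<le> card (residue_class I ` wfil n w)"
  proof (rule card_inj_on_le)
    show "inj_on (\<lambda>u. residue_class I (?comb u)) (PiE B (\<lambda>_. UNIV :: 'q set))"
    proof (rule inj_onI)
      fix u v assume uv: "u \<in> PiE B (\<lambda>_. UNIV :: 'q set)" "v \<in> PiE B (\<lambda>_. UNIV :: 'q set)"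
        "residue_class I (?comb u) = residue_class I (?comb v)"
      then have "?comb u - ?comb v \<in> I" using residue_class_eq_iff[OF I] by blast
      also have "?comb u - ?comb v = ?comb (\<lambda>b. u b - v b)"
        by (simp add: Const_simps left_diff_distrib sum_subtractf)
      finally have "u b = v b" if "b \<in> B" for b using indep[OF _ that] by fastforce
      then show "u = v" using uv(1,2) by (intro PiE_ext) auto
    qed
    have "?comb u \<in> wfil n w" for u
    proof -
      have "Const (u b) * b \<in> wfil n w" if "b \<in> B" for b
        using B that wfil_mult[of "Const (u b)" n 0 b w]
        by (auto simp: ok_def wfil_def polys_Const wdeg_le_Const)
      moreover have "0 \<in> wfil n w" by (simp add: wfil_def polys_0 wdeg_le_0)
      ultimately show ?thesis using fin by (induction B rule: infinite_finite_induct) (auto intro: wfil_add)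
    qed
    then show "(\<lambda>u. residue_class I (?comb u)) ` PiE B (\<lambda>_. UNIV) \<subseteq> residue_class I ` wfil n w" by auto
  qed (simp add: finite_wfil)
  also have "\<dots> \<le> card (UNIV :: 'q set) ^ N" using N by (simp add: class_count_def)
  finally have le: "card (UNIV :: 'q set) ^ card B \<le> card (UNIV :: 'q set) ^ N" .
  \<comment> \<open>A field has at least two elements, so the exponents may be compared.\<close>
  have "card {0, 1 :: 'q} \<le> card (UNIV :: 'q set)" by (intro card_mono) auto
  then have "card B \<le> N" using le by (subst (asm) power_increasing_iff) auto
  with that[of B] B show ?thesis by (auto simp: ok_def)
qed

text \<open>Starting from all polynomials, with exponent \<open>n\<close>, each non-zero-divisor
  lowers the order of growth by one. The count is then converted back to spanning sets.\<close>

lemma regular_seq_growth: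
  fixes S :: "nat \<Rightarrow> 'q::{finite, field} mpoly"
  assumes reg: "regular_seq n m S" and "m \<le> n"
  obtains C where "\<And>w. \<exists>B. finite B \<and> card B \<le> C * (w + 1) ^ (n - m) \<and>
    (\<forall>p\<in>wfil n w. \<exists>b\<in>mp.span B. p - b \<in> genideal (mpoly_ring n) (S ` {1..m}))"
proof -
  interpret cring "mpoly_ring n :: 'q mpoly ring" by (rule cring_mpoly_ring)
  define J where "J = (\<lambda>i. genideal (mpoly_ring n) (S ` {1..<Suc i}))"
  have Spoly: "S ` {1..m} \<subseteq> polys n" using reg by (simp add: regular_seq_def)
  have J: "poly_ideal n (J i)" if "i \<le> m" for i
    unfolding J_def poly_ideal_iff_ideal using Spoly that by (intro genideal_ideal) auto
  have "\<exists>C. \<forall>w. class_count n (J i) w \<le> card (UNIV :: 'q set) ^ (C * (w + 1) ^ (n - i))" if "i \<le> m" for i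
    using that
  proof (induction i)
    case 0
    have "class_count n (J 0) w \<le> card (UNIV :: 'q set) ^ (1 * (w + 1) ^ (n - 0))" for w
      unfolding class_count_def using finite_wfil[where 'q = 'q, of n w] card_image_le[OF finite_wfil(1), of "residue_class (J 0)" n w]
      by simp
    then show ?case by blast
  next
    case (Suc i)
    then obtain C where C: "\<And>w. class_count n (J i) w \<le> card (UNIV :: 'q set) ^ (C * (w + 1) ^ (n - i))" by auto
    have ni: "n - i = Suc (n - Suc i)" using Suc.prems \<open>m \<le> n\<close> by simp
    have "J i \<subseteq> J (Suc i)"
      unfolding J_def using Spoly Suc.prems by (intro subset_Idl_subset image_mono) auto
    moreover have "S (Suc i) \<in> J (Suc i)"
    proof -
      have "S ` {1..<Suc (Suc i)} \<subseteq> J (Suc i)"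
        unfolding J_def using Spoly Suc.prems by (intro genideal_self) auto
      then show ?thesis by auto
    qed
    moreover have "S (Suc i) \<in> polys n" using Spoly Suc.prems by auto
    moreover have "g \<in> J i" if "g \<in> polys n" "g * S (Suc i) \<in> J i" for g
      using reg that Suc.prems unfolding regular_seq_def J_def by auto
    ultimately obtain C' where "\<And>w. class_count n (J (Suc i)) w \<le> card (UNIV :: 'q set) ^ (C' * (w + 1) ^ (n - Suc i))"
      using class_count_bound_step[OF J J, of i "Suc i" "S (Suc i)" C "n - Suc i"] C Suc.prems
      unfolding ni by auto
    then show ?case by blast
  qed
  then obtain C where C: "\<And>w. class_count n (J m) w \<le> card (UNIV :: 'q set) ^ (C * (w + 1) ^ (n - m))" by blast
  have Jm: "J m = genideal (mpoly_ring n) (S ` {1..m})"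
    by (simp add: J_def atLeastLessThanSuc_atLeastAtMost)
  show ?thesis
  proof (rule that)
    fix w
    obtain B where "finite B" "card B \<le> C * (w + 1) ^ (n - m)" "\<And>p. p \<in> wfil n w \<Longrightarrow> \<exists>b\<in>mp.span B. p - b \<in> J m"
      using spanning_set_of_class_count[OF J[OF order_refl] C] by blast
    then show "\<exists>B. finite B \<and> card B \<le> C * (w + 1) ^ (n - m) \<and>
      (\<forall>p\<in>wfil n w. \<exists>b\<in>mp.span B. p - b \<in> genideal (mpoly_ring n) (S ` {1..m}))"
      unfolding Jm by blast
  qed
qed

lemma genideal_vanishing:
  assumes h: "comm_ring_hom h" and S: "S \<subseteq> polys n" "\<And>q. q \<in> S \<Longrightarrow> mpoly_subst h y q = 0"
    and p: "p \<in> genideal (mpoly_ring n) S"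
  shows "mpoly_subst h y p = 0"
proof -
  interpret cring "mpoly_ring n :: 'a mpoly ring" by (rule cring_mpoly_ring)
  interpret y: comm_ring_hom "mpoly_subst h y" by (rule comm_ring_hom_mpoly_subst[OF h])
  have "poly_ideal n {q \<in> polys n. mpoly_subst h y q = 0}"
    unfolding poly_ideal_def by (auto simp: y.hom_zero y.hom_add y.hom_mult intro: polys_intros)
  then have "genideal (mpoly_ring n) S \<subseteq> {q \<in> polys n. mpoly_subst h y q = 0}"
    using S unfolding poly_ideal_iff_ideal by (intro genideal_minimal) auto
  with p show ?thesis by auto
qed


section \<open>Elementary symmetric polynomials and rank\<close>

text \<open>Index set and values are arbitrary, so that one formula covers the variables, the
  coordinates of a point, and either of them with one index removed.\<close>

definition esym :: "'i set \<Rightarrow> nat \<Rightarrow> ('i \<Rightarrow> 'a::comm_ring_1) \<Rightarrow> 'a" where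
  "esym A k x = (\<Sum>B | B \<subseteq> A \<and> card B = k. \<Prod>i\<in>B. x i)"

lemma esym_0 [simp]: "finite A \<Longrightarrow> esym A 0 x = 1"
proof -
  assume A: "finite A"
  have "{B. B \<subseteq> A \<and> card B = 0} = {{}}"
    using finite_subset[OF _ A] by (auto simp: card_eq_0_iff)
  then show ?thesis by (simp add: esym_def)
qed

lemma esym_insert:
  assumes A: "finite A" "j \<notin> A"
  shows "esym (insert j A) (Suc k) x = esym A (Suc k) x + x j * esym A k x"
proof -
  let ?S = "\<lambda>k. {B. B \<subseteq> A \<and> card B = k}"
  have eq: "{B. B \<subseteq> insert j A \<and> card B = Suc k} = ?S (Suc k) \<union> insert j ` ?S k" (is "?L = ?R")
  proof (intro equalityI subsetI)
    fix B assume B: "B \<in> ?L"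
    show "B \<in> ?R"
    proof (cases "j \<in> B")
      case True
      have "B = insert j (B - {j})" "B - {j} \<in> ?S k"
        using True B finite_subset[of B "insert j A"] A by (auto simp: card_Diff_singleton)
      then show ?thesis by blast
    qed (use B in auto)
  next
    fix B assume "B \<in> ?R"
    then show "B \<in> ?L"
    proof
      assume "B \<in> insert j ` ?S k"
      then obtain C where C: "C \<subseteq> A" "card C = k" "B = insert j C" by blast
      moreover have "finite C" "j \<notin> C" using C A finite_subset by auto
      ultimately show "B \<in> ?L" by auto
    qed auto
  qed
  have fin: "finite (?S k)" for k using A by simp
  have inj: "inj_on (insert j) (?S k)" using A by (auto intro!: inj_onI)
  have "esym (insert j A) (Suc k) x = (\<Sum>B\<in>?S (Suc k). \<Prod>i\<in>B. x i) + (\<Sum>B\<in>insert j ` ?S k. \<Prod>i\<in>B. x i)"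
    unfolding esym_def eq using fin A by (intro sum.union_disjoint) auto
  also have "(\<Sum>B\<in>insert j ` ?S k. \<Prod>i\<in>B. x i) = (\<Sum>B\<in>?S k. x j * (\<Prod>i\<in>B. x i))"
    unfolding sum.reindex[OF inj] comp_def
  proof (intro sum.cong refl)
    fix B assume "B \<in> ?S k"
    then have "finite B" "j \<notin> B" using A finite_subset by auto
    then show "prod x (insert j B) = x j * prod x B" by simp
  qed
  finally show ?thesis by (simp add: esym_def sum_distrib_left)
qed

lemma esym_eq_0: "finite A \<Longrightarrow> card A < k \<Longrightarrow> esym A k x = 0"
proof -
  assume A: "finite A" "card A < k"
  have "card B \<noteq> k" if "B \<subseteq> A" for B using card_mono[OF A(1) that] A(2) by simp
  then have "{B. B \<subseteq> A \<and> card B = k} = {}" by simp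
  then show ?thesis unfolding esym_def by (simp only: sum.empty)
qed

text \<open>The recursion for splitting off \<open>j\<close>, solved for the smaller set. It
  presents the left side as a polynomial in \<open>x j\<close> whose coefficients do not depend on
  \<open>j\<close>; the root relation and the rank argument both rest on this.\<close>

lemma esym_remove:
  assumes A: "finite A" "j \<in> A"
  shows "esym (A - {j}) k x = (\<Sum>l\<le>k. (- x j) ^ l * esym A (k - l) x)"
proof (induction k)
  case (Suc k)
  have "esym A (Suc k) x = esym (A - {j}) (Suc k) x + x j * esym (A - {j}) k x"
    using esym_insert[of "A - {j}" j k x] A by (simp add: insert_absorb)
  then have "esym (A - {j}) (Suc k) x = esym A (Suc k) x + (- x j) * esym (A - {j}) k x" by simp
  also have "\<dots> = esym A (Suc k) x + (\<Sum>l\<le>k. (- x j) ^ Suc l * esym A (k - l) x)"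
    unfolding Suc sum_distrib_left by (simp add: mult.assoc)
  also have "\<dots> = (\<Sum>l\<le>Suc k. (- x j) ^ l * esym A (Suc k - l) x)"
    by (subst sum.atMost_Suc_shift) simp
  finally show ?case .
qed (use A in simp)

lemma (in comm_ring_hom) hom_esym: "hom (esym A k x) = esym A k (\<lambda>i. hom (x i))"
  by (simp add: esym_def hom_sum hom_prod)

lemma elem_sym_eq_esym: "elem_sym r k = esym {1..r} k Var"
  by (simp add: elem_sym_def esym_def)

lemma mpoly_subst_elem_sym:
  assumes "comm_ring_hom h"
  shows "mpoly_subst h x (elem_sym r k) = esym {1..r} k x"
proof -
  interpret x: comm_ring_hom "mpoly_subst h x" by (rule comm_ring_hom_mpoly_subst[OF assms])
  show ?thesis by (simp add: elem_sym_eq_esym x.hom_esym assms)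
qed

lemma elem_sym_closed: "elem_sym r k \<in> polys r"
  unfolding elem_sym_def by (intro polys_sum polys_prod polys_Var) auto

lemma mpoly_deriv_esym_Var:
  assumes "finite A" "j \<notin> A"
  shows "mpoly_deriv j (esym A k Var) = 0"
proof -
  have "mpoly_deriv j (\<Prod>i\<in>B. Var i) = (0 :: 'a mpoly)" if "B \<subseteq> A" for B
    using finite_subset[OF that assms(1)] that
  proof (induction B)
    case empty
    then show ?case using mpoly_deriv_Const[of j "1 :: 'a"] by (simp add: Const_simps)
  next
    case (insert i B)
    then show ?case using assms by (auto simp: mpoly_deriv_mult)
  qed
  then show ?thesis unfolding esym_def mpoly_deriv_sum by (intro sum.neutral) auto
qed

text \<open>Splitting off the index \<open>j\<close> leaves an expression that is affine in
  \<open>Var j\<close>.\<close>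

lemma mpoly_deriv_elem_sym:
  assumes "j \<in> {1..r}"
  shows "mpoly_deriv j (elem_sym r (Suc k)) = (esym ({1..r} - {j}) k Var :: 'a::comm_ring_1 mpoly)"
proof -
  have "insert j ({1..r} - {j}) = {1..r}" using assms by auto
  then have "elem_sym r (Suc k) = (esym ({1..r} - {j}) (Suc k) Var + Var j * esym ({1..r} - {j}) k Var :: 'a mpoly)"
    using esym_insert[of "{1..r} - {j}" j k Var] by (simp add: elem_sym_eq_esym)
  then show ?thesis by (simp add: mpoly_deriv_add mpoly_deriv_mult mpoly_deriv_esym_Var)
qed

text \<open>With one of the \<open>r\<close> indices removed, the elementary symmetric polynomial of
  degree \<open>r\<close> is 0; expanding it by \<open>esym_remove\<close> gives the equation of
  \<open>x i\<close> as a root of the product of all \<open>T - x l\<close>.\<close>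

lemma esym_root_relation:
  assumes "finite A" "i \<in> A"
  shows "x i ^ card A = (\<Sum>l<card A. (- ((- 1) ^ (card A + l))) * (esym A (card A - l) x * x i ^ l))"
proof -
  let ?r = "card A"
  have "0 = esym (A - {i}) ?r x"
    using card_Diff1_less[OF assms] assms(1) by (subst esym_eq_0) auto
  also have "\<dots> = (\<Sum>l<?r. (- x i) ^ l * esym A (?r - l) x) + (- x i) ^ ?r"
    using assms by (simp add: esym_remove lessThan_Suc_atMost[symmetric])
  finally have "(- x i) ^ ?r = - (\<Sum>l<?r. (- x i) ^ l * esym A (?r - l) x)"
    by (simp add: eq_neg_iff_add_eq_0 add.commute)
  then have "(- 1) ^ ?r * (- x i) ^ ?r = (\<Sum>l<?r. (- 1) ^ ?r * - ((- x i) ^ l * esym A (?r - l) x))"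
    by (simp only: sum_negf[symmetric] sum_distrib_left)
  also have "(- 1) ^ ?r * (- x i) ^ ?r = x i ^ ?r"
    by (simp add: power_mult_distrib[symmetric])
  also have "(\<Sum>l<?r. (- 1) ^ ?r * - ((- x i) ^ l * esym A (?r - l) x)) =
      (\<Sum>l<?r. (- ((- 1) ^ (?r + l))) * (esym A (?r - l) x * x i ^ l))"
    by (intro sum.cong refl) (simp add: power_add power_minus[of "x i"] mult_ac)
  finally show ?thesis .
qed

text \<open>Since \<open>X\<^sub>i\<close> is a root of \<open>\<Prod>\<^sub>j (T - X\<^sub>j)\<close>, its exponent can be kept below \<open>r\<close>; giving
  \<open>\<Pi>\<^sub>j\<close> the weight \<open>j\<close> makes this reduction preserve degrees.\<close>

definition sym_monoms :: "nat \<Rightarrow> nat \<Rightarrow> ((nat \<Rightarrow> 'k::field) \<Rightarrow> 'k) set" where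
  "sym_monoms r t = {\<lambda>x. (\<Prod>i=1..r. x i ^ \<beta> i) * (\<Prod>j=1..r. esym {1..r} j x ^ \<gamma> j) | \<beta> \<gamma>.
     (\<forall>i\<in>{1..r}. \<beta> i < r) \<and> (\<Sum>i=1..r. \<beta> i) + (\<Sum>j=1..r. j * \<gamma> j) \<le> t}"

lemma prod_upd_power:
  fixes x :: "nat \<Rightarrow> 'k::field"
  assumes "i \<in> {1..r}"
  shows "(\<Prod>l=1..r. x l ^ (\<beta>(i := b)) l) = x i ^ b * (\<Prod>l\<in>{1..r} - {i}. x l ^ \<beta> l)"
proof -
  have "(\<Prod>l=1..r. x l ^ (\<beta>(i := b)) l) = x i ^ (\<beta>(i := b)) i * (\<Prod>l\<in>{1..r} - {i}. x l ^ (\<beta>(i := b)) l)"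
    using assms by (intro prod.remove) auto
  also have "(\<Prod>l\<in>{1..r} - {i}. x l ^ (\<beta>(i := b)) l) = (\<Prod>l\<in>{1..r} - {i}. x l ^ \<beta> l)"
    by (intro prod.cong) auto
  finally show ?thesis by simp
qed

lemma sum_upd:
  fixes f :: "nat \<Rightarrow> nat"
  assumes "i \<in> {1..r}"
  shows "(\<Sum>l=1..r. w l * (f(i := b)) l) + w i * f i = (\<Sum>l=1..r. w l * f l) + w i * b"
proof -
  have "(\<Sum>l=1..r. w l * (f(i := b)) l) = w i * (f(i := b)) i + (\<Sum>l\<in>{1..r} - {i}. w l * (f(i := b)) l)"
    using assms by (intro sum.remove) auto
  also have "(\<Sum>l\<in>{1..r} - {i}. w l * (f(i := b)) l) = (\<Sum>l\<in>{1..r} - {i}. w l * f l)"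
    by (intro sum.cong) auto
  finally have "(\<Sum>l=1..r. w l * (f(i := b)) l) = w i * b + (\<Sum>l\<in>{1..r} - {i}. w l * f l)" by simp
  moreover have "(\<Sum>l=1..r. w l * f l) = w i * f i + (\<Sum>l\<in>{1..r} - {i}. w l * f l)"
    using assms by (intro sum.remove) auto
  ultimately show ?thesis by simp
qed

lemma sym_monoms_mult_var:
  fixes f :: "(nat \<Rightarrow> 'k::field) \<Rightarrow> 'k"
  assumes i: "i \<in> {1..r}" and f: "f \<in> fun_vs.span (sym_monoms r t)"
  shows "(\<lambda>x. x i * f x) \<in> fun_vs.span (sym_monoms r (Suc t))"
  using f
proof (induction rule: fun_vs.span_induct_alt)
  case base
  have "(\<lambda>x. x i * 0 x) = (0 :: (nat \<Rightarrow> 'k) \<Rightarrow> 'k)" by auto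
  then show ?case by (simp only: fun_vs.span_zero)
next
  case (step c y z)
  then obtain \<beta> \<gamma> where y: "y = (\<lambda>x. (\<Prod>i=1..r. x i ^ \<beta> i) * (\<Prod>j=1..r. esym {1..r} j x ^ \<gamma> j))"
    and \<beta>: "\<forall>i\<in>{1..r}. \<beta> i < r" and wt: "(\<Sum>i=1..r. \<beta> i) + (\<Sum>j=1..r. j * \<gamma> j) \<le> t"
    unfolding sym_monoms_def by blast
  define P where "P = (\<lambda>x :: nat \<Rightarrow> 'k. \<Prod>l\<in>{1..r} - {i}. x l ^ \<beta> l)"
  define E where "E = (\<lambda>\<gamma> (x :: nat \<Rightarrow> 'k). \<Prod>j=1..r. esym {1..r} j x ^ \<gamma> j)"
  have yP: "y x = x i ^ \<beta> i * P x * E \<gamma> x" for x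
    using prod_upd_power[OF i, of x \<beta> "\<beta> i"] by (simp add: y P_def E_def)
  have mem: "(\<lambda>x. x i ^ b * P x * E \<gamma>' x) \<in> sym_monoms r (Suc t)"
    if "b < r" "(\<Sum>l=1..r. (\<beta>(i := b)) l) + (\<Sum>j=1..r. j * \<gamma>' j) \<le> Suc t" for b \<gamma>'
  proof -
    have "(\<lambda>x. x i ^ b * P x * E \<gamma>' x) = (\<lambda>x. (\<Prod>l=1..r. x l ^ (\<beta>(i := b)) l) * E \<gamma>' x)"
      by (simp only: prod_upd_power[OF i] P_def)
    moreover have "\<forall>l\<in>{1..r}. (\<beta>(i := b)) l < r" using \<beta> that by auto
    ultimately show ?thesis using that unfolding sym_monoms_def E_def by blast
  qed
  have upd: "(\<Sum>l=1..r. (\<beta>(i := b)) l) + \<beta> i = (\<Sum>l=1..r. \<beta> l) + b" for b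
    using sum_upd[OF i, of "\<lambda>_. 1" \<beta> b] by simp
  have "(\<lambda>x. x i * y x) \<in> fun_vs.span (sym_monoms r (Suc t))"
  proof (cases "Suc (\<beta> i) < r")
    case True
    have "(\<lambda>x. x i * y x) = (\<lambda>x. x i ^ Suc (\<beta> i) * P x * E \<gamma> x)" by (simp add: yP mult_ac)
    also have "\<dots> \<in> sym_monoms r (Suc t)"
      by (rule mem[OF True]) (use upd[of "Suc (\<beta> i)"] wt in linarith)
    finally show ?thesis by (rule fun_vs.span_base)
  next
    case False
    \<comment> \<open>The exponent would reach \<open>r\<close>. The root relation replaces the
      power by terms \<open>x i ^ l\<close> times the elementary symmetric polynomial of degree
      \<open>r - l\<close>, and \<open>l + (r - l) = r\<close> keeps the total weight.\<close>
    then have \<beta>i: "Suc (\<beta> i) = r" using \<beta> i by (metis Suc_lessI)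
    let ?c = "\<lambda>l. - ((- 1) ^ (r + l)) :: 'k"
    let ?g = "\<lambda>l. \<gamma>(r - l := Suc (\<gamma> (r - l)))"
    have E: "E (?g l) x = esym {1..r} (r - l) x * E \<gamma> x" if "l < r" for l and x :: "nat \<Rightarrow> 'k"
    proof -
      have rl: "r - l \<in> {1..r}" using that by auto
      show ?thesis unfolding E_def
        using prod_upd_power[OF rl, of "\<lambda>j. esym {1..r} j x" \<gamma> "Suc (\<gamma> (r - l))"]
          prod_upd_power[OF rl, of "\<lambda>j. esym {1..r} j x" \<gamma> "\<gamma> (r - l)"] by (simp add: mult_ac)
    qed
    have "x i * y x = (\<Sum>l<r. ?c l * (x i ^ l * P x * E (?g l) x))" for x
    proof -
      have "x i * y x = x i ^ r * (P x * E \<gamma> x)" unfolding yP \<beta>i[symmetric] by (simp add: mult_ac)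
      also have "\<dots> = (\<Sum>l<r. ?c l * (esym {1..r} (r - l) x * x i ^ l)) * (P x * E \<gamma> x)"
        using esym_root_relation[of "{1..r}" i x] i by simp
      also have "\<dots> = (\<Sum>l<r. ?c l * (x i ^ l * P x * E (?g l) x))"
        unfolding sum_distrib_right by (intro sum.cong refl) (simp add: E mult_ac)
      finally show ?thesis .
    qed
    then have "(\<lambda>x. x i * y x) = (\<Sum>l<r. (\<lambda>x. ?c l * (x i ^ l * P x * E (?g l) x)))"
      by (auto simp: fun_eq_iff sum_fun_apply)
    also have "\<dots> \<in> fun_vs.span (sym_monoms r (Suc t))"
    proof (intro fun_vs.span_sum fun_vs.span_scale fun_vs.span_base mem)
      fix l assume "l \<in> {..<r}"
      then show lr: "l < r" by simp
      have rl: "r - l \<in> {1..r}" using lr by auto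
      have "(\<Sum>j=1..r. j * (?g l) j) = (\<Sum>j=1..r. j * \<gamma> j) + (r - l)"
        using sum_upd[OF rl, of "\<lambda>j. j" \<gamma> "Suc (\<gamma> (r - l))"] by (simp add: algebra_simps)
      then show "(\<Sum>l'=1..r. (\<beta>(i := l)) l') + (\<Sum>j=1..r. j * (?g l) j) \<le> Suc t"
        using upd[of l] wt \<beta>i lr by linarith
    qed
    finally show ?thesis .
  qed
  then have "(\<lambda>x. c * (x i * y x)) + (\<lambda>x. x i * z x) \<in> fun_vs.span (sym_monoms r (Suc t))"
    using step by (intro fun_vs.span_add fun_vs.span_scale)
  also have "(\<lambda>x. c * (x i * y x)) + (\<lambda>x. x i * z x) = (\<lambda>x. x i * ((\<lambda>x. c * y x) + z) x)"
    by (auto simp: algebra_simps)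
  finally show ?case .
qed

lemma monomial_in_span_sym_monoms:
  assumes "0 < r" "keys \<alpha> \<subseteq> {1..r}"
  shows "(\<lambda>x :: nat \<Rightarrow> 'k::field. \<Prod>i\<in>keys \<alpha>. x i ^ lookup \<alpha> i) \<in> fun_vs.span (sym_monoms r (mdeg \<alpha>))"
  using assms(2)
proof (induction "mdeg \<alpha>" arbitrary: \<alpha>)
  case 0
  then have "lookup \<alpha> i = 0" if "i \<in> keys \<alpha>" for i using that by (simp add: wdeg_def)
  then have "keys \<alpha> = {}" using in_keys_iff by blast
  moreover have "(\<lambda>x. (\<Prod>i=1..r. x i ^ 0) * (\<Prod>j=1..r. esym {1..r} j x ^ 0)) \<in> (sym_monoms r (mdeg \<alpha>) :: ((nat \<Rightarrow> 'k) \<Rightarrow> 'k) set)"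
    unfolding sym_monoms_def using \<open>0 < r\<close> by (intro CollectI exI[of _ "\<lambda>_. 0"]) auto
  ultimately show ?case by (auto intro: fun_vs.span_base)
next
  case (Suc d)
  have "keys \<alpha> \<noteq> {}" using Suc(2) by (auto simp: wdeg_def)
  then obtain i where i: "i \<in> keys \<alpha>" by blast
  define \<beta> where "\<beta> = \<alpha> - single i 1"
  have \<alpha>\<beta>: "\<alpha> = single i 1 + \<beta>"
    by (rule poly_mapping_eqI) (use i in \<open>auto simp: \<beta>_def lookup_add lookup_minus lookup_single when_def in_keys_iff\<close>)
  then have "keys \<beta> \<subseteq> keys \<alpha>" by (auto simp: in_keys_iff lookup_add)
  then have \<beta>: "keys \<beta> \<subseteq> {1..r}" using Suc.prems by blast
  have d: "mdeg \<alpha> = Suc (mdeg \<beta>)" unfolding \<alpha>\<beta> wdeg_add wdeg_single by simp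
  have "(\<lambda>x :: nat \<Rightarrow> 'k. \<Prod>i\<in>keys \<alpha>. x i ^ lookup \<alpha> i) = (\<lambda>x. x i * (\<Prod>i\<in>keys \<beta>. x i ^ lookup \<beta> i))"
    unfolding \<alpha>\<beta> monom_subst_add by simp
  moreover have "i \<in> {1..r}" using i Suc.prems by blast
  ultimately show ?case
    unfolding d using sym_monoms_mult_var[OF _ Suc(1)[OF _ \<beta>]] Suc(2) d by simp
qed

text \<open>Three independent choices are counted: bounded exponents of the \<open>X_i\<close>
  (\<open>r ^ r\<close> in number), a spanning set for polynomials in the first \<open>s\<close>
  elementary symmetric polynomials modulo the relations (exponent \<open>s - m\<close>), and
  exponents of the remaining \<open>r - s\<close> ones. The powers of \<open>t + 1\<close> add up to
  \<open>r - m\<close>.\<close>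

lemma pullback_growth:
  fixes S :: "nat \<Rightarrow> 'q::{finite, field} mpoly" and V :: "(nat \<Rightarrow> 'k::field) set"
  assumes h: "comm_ring_hom (h :: 'q \<Rightarrow> 'k)" and reg: "regular_seq s m S" and "m \<le> s" "s \<le> r" "0 < r"
    and V: "\<And>x i. x \<in> V \<Longrightarrow> i \<in> {1..m} \<Longrightarrow> mpoly_subst h (\<lambda>j. esym {1..r} j x) (S i) = 0"
  shows "growth_le r V (r - m)"
proof -
  interpret h: comm_ring_hom h by (rule h)
  interpret y: comm_ring_hom "mpoly_subst h y" for y by (rule comm_ring_hom_mpoly_subst[OF h])
  obtain C where C: "\<And>w. \<exists>B. finite B \<and> card B \<le> C * (w + 1) ^ (s - m) \<and>
      (\<forall>p\<in>wfil s w. \<exists>b\<in>mp.span B. p - b \<in> genideal (mpoly_ring s) (S ` {1..m}))"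
    using regular_seq_growth[OF reg \<open>m \<le> s\<close>] by blast
  let ?y = "\<lambda>x j. esym {1..r} j x :: 'k"
  have vanish: "mpoly_subst h (?y x) p = 0" if "x \<in> V" "p \<in> genideal (mpoly_ring s) (S ` {1..m})" for x p
    using reg V[OF that(1)] by (intro genideal_vanishing[OF h _ _ that(2)]) (auto simp: regular_seq_def)
  have "\<exists>B. finite B \<and> card B \<le> (r ^ r * C) * (t + 1) ^ (r - m) \<and>
     (\<forall>\<alpha>. keys \<alpha> \<subseteq> {1..r} \<and> mdeg \<alpha> \<le> t \<longrightarrow>
       (\<exists>g\<in>fun_vs.span B. \<forall>x\<in>V. (\<Prod>i\<in>keys \<alpha>. x i ^ lookup \<alpha> i) = g x))" for t
  proof -
    obtain B where B: "finite B" "card B \<le> C * (t + 1) ^ (s - m)"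
      "\<And>p. p \<in> wfil s t \<Longrightarrow> \<exists>b\<in>mp.span B. p - b \<in> genideal (mpoly_ring s) (S ` {1..m})"
      using C[of t] by blast
    define I where "I = PiE {1..r} (\<lambda>_. {..<r}) \<times> B \<times> PiE {s+1..r} (\<lambda>_. {..t})"
    define G where "G = (\<lambda>(\<beta>, b, \<gamma>) x. (\<Prod>i=1..r. x i ^ \<beta> i) * mpoly_subst h (?y x) b * (\<Prod>j=s+1..r. ?y x j ^ \<gamma> j))"
    have fI: "finite I" unfolding I_def using B(1) by (intro finite_cartesian_product finite_PiE) auto
    have "card (G ` I) \<le> card I" using fI by (rule card_image_le)
    also have "\<dots> = r ^ r * (card B * (t + 1) ^ (r - s))"
      by (simp add: I_def card_cartesian_product card_PiE)
    also have "\<dots> \<le> r ^ r * ((C * (t + 1) ^ (s - m)) * (t + 1) ^ (r - s))"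
      using B(2) by (intro mult_left_mono mult_right_mono) auto
    also have "\<dots> = (r ^ r * C) * ((t + 1) ^ (s - m) * (t + 1) ^ (r - s))" by (simp only: mult.assoc)
    also have "(t + 1) ^ (s - m) * (t + 1) ^ (r - s) = (t + 1) ^ (r - m)"
      using \<open>m \<le> s\<close> \<open>s \<le> r\<close> by (simp add: power_add[symmetric])
    finally have card: "card (G ` I) \<le> (r ^ r * C) * (t + 1) ^ (r - m)" .
    have gen: "\<exists>g\<in>fun_vs.span (G ` I). \<forall>x\<in>V. f x = g x" if f: "f \<in> sym_monoms r t" for f
    proof -
      obtain \<beta> \<gamma> where fdef: "f = (\<lambda>x. (\<Prod>i=1..r. x i ^ \<beta> i) * (\<Prod>j=1..r. ?y x j ^ \<gamma> j))"
        and \<beta>: "\<forall>i\<in>{1..r}. \<beta> i < r" and wt: "(\<Sum>i=1..r. \<beta> i) + (\<Sum>j=1..r. j * \<gamma> j) \<le> t"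
        using f unfolding sym_monoms_def by blast
      have \<gamma>t: "\<gamma> j \<le> t" if "j \<in> {1..r}" for j
      proof -
        have "\<gamma> j \<le> j * \<gamma> j" using that by simp
        also have "\<dots> \<le> (\<Sum>j=1..r. j * \<gamma> j)" using that by (intro member_le_sum) auto
        finally show ?thesis using wt by simp
      qed
      \<comment> \<open>The first \<open>s\<close> symmetric factors form a monomial over the finite
        field; its reduction modulo the ideal of the \<open>S i\<close> is carried to points of
        \<open>V\<close> by \<open>h\<close>.\<close>
      define \<mu> where "\<mu> = (\<Sum>j\<in>{1..s}. single j (\<gamma> j) :: nat \<Rightarrow>\<^sub>0 nat)"
      have lmu: "lookup \<mu> l = (if l \<in> {1..s} then \<gamma> l else 0)" for l
        by (auto simp: \<mu>_def lookup_sum lookup_single when_def sum.delta')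
      have kmu: "keys \<mu> \<subseteq> {1..s}" by (auto simp: in_keys_iff lmu split: if_splits)
      have "wdeg (\<lambda>i. i) \<mu> = (\<Sum>j=1..s. j * \<gamma> j)"
        using wdeg_superset[OF finite_atLeastAtMost kmu, of "\<lambda>i. i"] by (simp add: lmu)
      also have "\<dots> \<le> (\<Sum>j=1..r. j * \<gamma> j)" using \<open>s \<le> r\<close> by (intro sum_mono2) auto
      finally have "single \<mu> (1::'q) \<in> wfil s t"
        using wt polys_single[OF kmu] by (auto simp: wfil_def wdeg_le_def)
      then obtain b where b: "b \<in> mp.span B" "single \<mu> 1 - b \<in> genideal (mpoly_ring s) (S ` {1..m})"
        using B(3) by blast
      have "finite B" by (rule B(1))
      then obtain u where u: "b = (\<Sum>c\<in>B. Const (u c) * c)" using b(1) by (auto simp: mp.span_finite)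
      have ev\<mu>: "(\<Prod>j=1..s. ?y x j ^ \<gamma> j) = (\<Sum>c\<in>B. h (u c) * mpoly_subst h (?y x) c)" if "x \<in> V" for x
      proof -
        have "mpoly_subst h (?y x) (single \<mu> 1) = (\<Prod>j=1..s. ?y x j ^ \<gamma> j)"
          using monom_subst_superset[OF finite_atLeastAtMost kmu, of "?y x"]
          by (simp add: mpoly_subst_single_hom[OF h] h.hom_one lmu)
        moreover have "mpoly_subst h (?y x) (single \<mu> 1) = mpoly_subst h (?y x) b"
          using vanish[OF that b(2)] by (simp add: y.hom_minus)
        ultimately show ?thesis by (simp add: u y.hom_sum y.hom_mult h)
      qed
      let ?\<beta> = "restrict \<beta> {1..r}" and ?\<gamma> = "restrict \<gamma> {s+1..r}"
      have mem: "(?\<beta>, c, ?\<gamma>) \<in> I" if "c \<in> B" for c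
        using \<beta> \<gamma>t that by (auto simp: I_def)
      have "(\<Sum>c\<in>B. (\<lambda>x. h (u c) * G (?\<beta>, c, ?\<gamma>) x)) \<in> fun_vs.span (G ` I)"
        by (intro fun_vs.span_sum fun_vs.span_scale fun_vs.span_base imageI mem)
      moreover have "f x = (\<Sum>c\<in>B. (\<lambda>x. h (u c) * G (?\<beta>, c, ?\<gamma>) x)) x" if "x \<in> V" for x
      proof -
        have "{1..r} = {1..s} \<union> {s+1..r}" using \<open>s \<le> r\<close> by auto
        then have "(\<Prod>j=1..r. ?y x j ^ \<gamma> j) = (\<Prod>j=1..s. ?y x j ^ \<gamma> j) * (\<Prod>j=s+1..r. ?y x j ^ \<gamma> j)"
          by (simp add: prod.union_disjoint)
        also have "\<dots> = (\<Sum>c\<in>B. h (u c) * (mpoly_subst h (?y x) c * (\<Prod>j=s+1..r. ?y x j ^ \<gamma> j)))"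
          unfolding ev\<mu>[OF that] sum_distrib_right by (simp add: mult.assoc)
        finally show ?thesis
          unfolding fdef G_def sum_fun_apply prod.case
          by (simp add: sum_distrib_left mult_ac)
      qed
      ultimately show ?thesis by blast
    qed
    have spn: "\<exists>g\<in>fun_vs.span (G ` I). \<forall>x\<in>V. f x = g x" if "f \<in> fun_vs.span (sym_monoms r t)" for f
      using that
    proof (induction rule: fun_vs.span_induct_alt)
      case base
      then show ?case using fun_vs.span_zero by blast
    next
      case (step c a f)
      then obtain g g' where g: "g \<in> fun_vs.span (G ` I)" "g' \<in> fun_vs.span (G ` I)"
          "\<forall>x\<in>V. a x = g x" "\<forall>x\<in>V. f x = g' x"
        using gen by blast
      have "(\<lambda>x. c * g x) + g' \<in> fun_vs.span (G ` I)" using g by (intro fun_vs.span_add fun_vs.span_scale)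
      then show ?case using g(3,4) by (intro bexI[of _ "(\<lambda>x. c * g x) + g'"]) auto
    qed
    have "\<exists>g\<in>fun_vs.span (G ` I). \<forall>x\<in>V. (\<Prod>i\<in>keys \<alpha>. x i ^ lookup \<alpha> i) = g x"
      if \<alpha>: "keys \<alpha> \<subseteq> {1..r}" "mdeg \<alpha> \<le> t" for \<alpha>
    proof -
      have "(sym_monoms r (mdeg \<alpha>) :: ((nat \<Rightarrow> 'k) \<Rightarrow> 'k) set) \<subseteq> sym_monoms r t"
        using \<alpha>(2) unfolding sym_monoms_def by (blast intro: order_trans)
      then have "(\<lambda>x :: nat \<Rightarrow> 'k. \<Prod>i\<in>keys \<alpha>. x i ^ lookup \<alpha> i) \<in> fun_vs.span (sym_monoms r t)"
        using monomial_in_span_sym_monoms[OF \<open>0 < r\<close> \<alpha>(1)] fun_vs.span_mono by blast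
      from spn[OF this] show ?thesis .
    qed
    then show ?thesis using fI card by blast
  qed
  then show ?thesis unfolding growth_le_def by blast
qed

text \<open>The points are sorted by the pattern of equal coordinates. On each of at most
  \<open>r ^ r\<close> patterns a polynomial depends on at most \<open>k\<close> coordinates, and
  piecewise functions combine the patterns.\<close>

lemma few_values_growth:
  fixes W :: "(nat \<Rightarrow> 'k::field) set"
  assumes W: "\<And>x. x \<in> W \<Longrightarrow> card (x ` {1..r}) \<le> k"
  shows "growth_le r W k"
proof -
  define \<sigma> where "\<sigma> = (\<lambda>(x :: nat \<Rightarrow> 'k). restrict (\<lambda>i. LEAST l. l \<in> {1..r} \<and> x l = x i) {1..r})"
  have \<sigma>: "\<sigma> x i \<in> {1..r}" "x (\<sigma> x i) = x i" if "i \<in> {1..r}" for x i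
    using LeastI[of "\<lambda>l. l \<in> {1..r} \<and> x l = x i" i] that by (auto simp: \<sigma>_def)
  have \<sigma>eq: "\<sigma> x i = \<sigma> x j" if "i \<in> {1..r}" "j \<in> {1..r}" "x i = x j" for x i j
    using that by (simp add: \<sigma>_def)
  define \<Sigma> where "\<Sigma> = {\<rho> \<in> PiE {1..r} (\<lambda>_. {1..r}). card (\<rho> ` {1..r}) \<le> k}"
  have f\<Sigma>: "finite \<Sigma>" unfolding \<Sigma>_def by (intro finite_subset[OF _ finite_PiE[of "{1..r}" "\<lambda>_. {1..r}"]]) auto
  have c\<Sigma>: "card \<Sigma> \<le> r ^ r"
    using card_mono[OF finite_PiE[of "{1..r}" "\<lambda>_. {1..r}"], of \<Sigma>] by (auto simp: \<Sigma>_def card_PiE)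
  have \<sigma>\<Sigma>: "\<sigma> x \<in> \<Sigma>" if "x \<in> W" for x
  proof -
    have "inj_on x (\<sigma> x ` {1..r})"
    proof (rule inj_onI)
      fix a b assume "a \<in> \<sigma> x ` {1..r}" "b \<in> \<sigma> x ` {1..r}" and eq: "x a = x b"
      then obtain i j where ij: "i \<in> {1..r}" "j \<in> {1..r}" "a = \<sigma> x i" "b = \<sigma> x j" by blast
      then have "x i = x j" using eq \<sigma>(2)[of i x] \<sigma>(2)[of j x] by simp
      then show "a = b" unfolding ij(3,4) by (rule \<sigma>eq[OF ij(1,2)])
    qed
    moreover have "x ` \<sigma> x ` {1..r} = x ` {1..r}"
      unfolding image_image by (rule image_cong[OF refl]) (rule \<sigma>(2))
    ultimately have "card (\<sigma> x ` {1..r}) = card (x ` {1..r})" by (metis card_image)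
    then show ?thesis using W[OF that] \<sigma>(1) by (auto simp: \<Sigma>_def \<sigma>_def)
  qed
  have "\<exists>B. finite B \<and> card B \<le> r ^ r * (t + 1) ^ k \<and>
     (\<forall>\<alpha>. keys \<alpha> \<subseteq> {1..r} \<and> mdeg \<alpha> \<le> t \<longrightarrow>
       (\<exists>g\<in>fun_vs.span B. \<forall>x\<in>W. (\<Prod>i\<in>keys \<alpha>. x i ^ lookup \<alpha> i) = g x))" for t
  proof -
    define G where "G = (\<lambda>\<rho> \<gamma> x. if \<sigma> x = \<rho> then \<Prod>l\<in>\<rho> ` {1..r}. x l ^ \<gamma> l else 0)"
    define B where "B = (\<Union>\<rho>\<in>\<Sigma>. G \<rho> ` PiE (\<rho> ` {1..r}) (\<lambda>_. {..t}))"
    have fin: "finite (PiE (\<rho> ` {1..r}) (\<lambda>_. {..t}))" for \<rho> :: "nat \<Rightarrow> nat" by (intro finite_PiE) auto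
    have "finite B" unfolding B_def using f\<Sigma> fin by auto
    have "card B \<le> (\<Sum>\<rho>\<in>\<Sigma>. card (G \<rho> ` PiE (\<rho> ` {1..r}) (\<lambda>_. {..t})))"
      unfolding B_def using f\<Sigma> by (rule card_UN_le)
    also have "\<dots> \<le> (\<Sum>\<rho>\<in>\<Sigma>. (t + 1) ^ k)"
    proof (rule sum_mono)
      fix \<rho> assume \<rho>: "\<rho> \<in> \<Sigma>"
      have "card (G \<rho> ` PiE (\<rho> ` {1..r}) (\<lambda>_. {..t})) \<le> card (PiE (\<rho> ` {1..r}) (\<lambda>_. {..t}))"
        using fin by (rule card_image_le)
      also have "\<dots> = (t + 1) ^ card (\<rho> ` {1..r})" by (simp add: card_PiE)
      also have "\<dots> \<le> (t + 1) ^ k" using \<rho> by (intro power_increasing) (auto simp: \<Sigma>_def)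
      finally show "card (G \<rho> ` PiE (\<rho> ` {1..r}) (\<lambda>_. {..t})) \<le> (t + 1) ^ k" .
    qed
    also have "\<dots> \<le> r ^ r * (t + 1) ^ k" using c\<Sigma> by simp
    finally have card: "card B \<le> r ^ r * (t + 1) ^ k" .
    have "\<exists>g\<in>fun_vs.span B. \<forall>x\<in>W. (\<Prod>i\<in>keys \<alpha>. x i ^ lookup \<alpha> i) = g x"
      if \<alpha>: "keys \<alpha> \<subseteq> {1..r}" "mdeg \<alpha> \<le> t" for \<alpha>
    proof -
      \<comment> \<open>Exponents of coordinates identified by the pattern \<open>\<rho>\<close> are
        added up at their representative.\<close>
      define \<gamma> where "\<gamma> = (\<lambda>\<rho>. restrict (\<lambda>l. \<Sum>i | i \<in> {1..r} \<and> \<rho> i = l. lookup \<alpha> i) (\<rho> ` {1..r}) :: nat \<Rightarrow> nat)"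
      have "(\<Sum>i\<in>{1..r}. lookup \<alpha> i) \<le> t"
        using wdeg_superset[OF finite_atLeastAtMost \<alpha>(1), of "\<lambda>_. 1"] \<alpha>(2) by simp
      moreover have "(\<Sum>i | i \<in> {1..r} \<and> \<rho> i = l. lookup \<alpha> i) \<le> (\<Sum>i\<in>{1..r}. lookup \<alpha> i)" for \<rho> and l :: nat
        by (intro sum_mono2) auto
      ultimately have "(\<Sum>i | i \<in> {1..r} \<and> \<rho> i = l. lookup \<alpha> i) \<le> t" for \<rho> and l :: nat
        using order_trans by blast
      then have "\<gamma> \<rho> \<in> PiE (\<rho> ` {1..r}) (\<lambda>_. {..t})" for \<rho>
        by (auto simp: \<gamma>_def)
      then have "G \<rho> (\<gamma> \<rho>) \<in> B" if "\<rho> \<in> \<Sigma>" for \<rho> using that unfolding B_def by blast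
      then have "(\<Sum>\<rho>\<in>\<Sigma>. G \<rho> (\<gamma> \<rho>)) \<in> fun_vs.span B"
        by (intro fun_vs.span_sum fun_vs.span_base)
      moreover have "(\<Prod>i\<in>keys \<alpha>. x i ^ lookup \<alpha> i) = (\<Sum>\<rho>\<in>\<Sigma>. G \<rho> (\<gamma> \<rho>)) x" if "x \<in> W" for x
      proof -
        let ?\<rho> = "\<sigma> x"
        have "(\<Prod>i\<in>keys \<alpha>. x i ^ lookup \<alpha> i) = (\<Prod>i=1..r. x i ^ lookup \<alpha> i)"
          by (rule monom_subst_superset[OF finite_atLeastAtMost \<alpha>(1)])
        also have "\<dots> = (\<Prod>l\<in>?\<rho> ` {1..r}. \<Prod>i | i \<in> {1..r} \<and> ?\<rho> i = l. x i ^ lookup \<alpha> i)"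
          by (rule prod.image_gen) simp
        also have "\<dots> = (\<Prod>l\<in>?\<rho> ` {1..r}. x l ^ \<gamma> ?\<rho> l)"
        proof (rule prod.cong[OF refl])
          fix l assume l: "l \<in> ?\<rho> ` {1..r}"
          have "(\<Prod>i | i \<in> {1..r} \<and> ?\<rho> i = l. x i ^ lookup \<alpha> i) = (\<Prod>i | i \<in> {1..r} \<and> ?\<rho> i = l. x l ^ lookup \<alpha> i)"
          proof (intro prod.cong refl)
            fix i assume "i \<in> {i \<in> {1..r}. ?\<rho> i = l}"
            then have "x l = x i" using \<sigma>(2)[of i x] by auto
            then show "x i ^ lookup \<alpha> i = x l ^ lookup \<alpha> i" by simp
          qed
          also have "\<dots> = x l ^ \<gamma> ?\<rho> l" using l by (simp add: \<gamma>_def power_sum)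
          finally show "(\<Prod>i | i \<in> {1..r} \<and> ?\<rho> i = l. x i ^ lookup \<alpha> i) = x l ^ \<gamma> ?\<rho> l" .
        qed
        also have "\<dots> = (\<Sum>\<rho>\<in>\<Sigma>. if \<rho> = ?\<rho> then \<Prod>l\<in>?\<rho> ` {1..r}. x l ^ \<gamma> ?\<rho> l else 0)"
          using f\<Sigma> \<sigma>\<Sigma>[OF that] by simp
        also have "\<dots> = (\<Sum>\<rho>\<in>\<Sigma>. G \<rho> (\<gamma> \<rho>)) x"
          unfolding sum_fun_apply by (intro sum.cong) (auto simp: G_def)
        finally show ?thesis .
      qed
      ultimately show ?thesis by blast
    qed
    then show ?thesis using \<open>finite B\<close> card by blast
  qed
  then show ?thesis unfolding growth_le_def by blast
qed

section \<open>Full row rank and annihilating vectors\<close>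

context vec_space
begin

lemma rank_le_n:
  assumes "A \<in> carrier_mat n nc"
  shows "rank A \<le> n"
proof -
  obtain S where S: "maximal S (\<lambda>T. T \<subseteq> set (cols A) \<and> lin_indpt T)"
    using maximal_exists_superset[of "set (cols A)" "\<lambda>T. T \<subseteq> set (cols A) \<and> lin_indpt T" "{}"]
    by (auto simp: lin_dep_def)
  then have "S \<subseteq> carrier_vec n" "lin_indpt S" using cols_dim[of A] assms by (auto simp: maximal_def)
  then show ?thesis using li_le_dim(2)[OF fin_dim] rank_card_indpt[OF assms S] by (simp add: dim_is_n)
qed

text \<open>A maximal independent set of columns spans the column space. With \<open>n\<close>
  members, only 0 annihilates it; with fewer, some nonzero vector annihilates it and hence all
  columns.\<close>

lemma rank_eq_n_iff:
  assumes A: "A \<in> carrier_mat n nc"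
  shows "rank A = n \<longleftrightarrow> (\<forall>w\<in>carrier_vec n. (\<forall>c\<in>set (cols A). w \<bullet> c = 0) \<longrightarrow> w = 0\<^sub>v n)"
proof -
  obtain S where S: "maximal S (\<lambda>T. T \<subseteq> set (cols A) \<and> lin_indpt T)"
    using maximal_exists_superset[of "set (cols A)" "\<lambda>T. T \<subseteq> set (cols A) \<and> lin_indpt T" "{}"]
    by (auto simp: lin_dep_def)
  have colsA: "set (cols A) \<subseteq> carrier_vec n" using cols_dim[of A] A by auto
  have Sc: "S \<subseteq> carrier_vec n" "lin_indpt S" "S \<subseteq> set (cols A)" "finite S"
    using S colsA finite_subset[of S "set (cols A)"] by (auto simp: maximal_def)
  have rank: "rank A = card S" by (rule rank_card_indpt[OF A S])
  show ?thesis
  proof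
    assume "rank A = n"
    then have "basis S" using dim_li_is_basis[OF fin_dim Sc(4) _ Sc(2)] Sc(1) rank by (simp add: dim_is_n)
    then have span: "span S = carrier_vec n" by (simp add: basis_def)
    show "\<forall>w\<in>carrier_vec n. (\<forall>c\<in>set (cols A). w \<bullet> c = 0) \<longrightarrow> w = 0\<^sub>v n"
    proof (intro ballI impI)
      fix w assume w: "w \<in> carrier_vec n" "\<forall>c\<in>set (cols A). w \<bullet> c = 0"
      then have "w \<in> orthogonal_complement S" using Sc(3) by (auto simp: orthogonal_complement_def)
      then have "w \<in> orthogonal_complement (carrier_vec n)"
        using in_orthogonal_complement_span[OF Sc(1)] span by simp
      then have *: "w \<bullet> unit_vec n i = 0" for i by (simp add: orthogonal_complement_def)
      have "w $ i = 0" if "i < n" for i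
        using *[of i] w(1) that by simp
      then show "w = 0\<^sub>v n" using w(1) by (intro eq_vecI) auto
    qed
  next
    assume ann: "\<forall>w\<in>carrier_vec n. (\<forall>c\<in>set (cols A). w \<bullet> c = 0) \<longrightarrow> w = 0\<^sub>v n"
    show "rank A = n"
    proof (rule ccontr)
      assume "rank A \<noteq> n"
      then have less: "card S < n" using rank_le_n[OF A] rank by simp
      obtain ss where ss: "set ss = S" "distinct ss" using finite_distinct_list[OF Sc(4)] by blast
      have len: "length ss = card S" using ss distinct_card by metis
      \<comment> \<open>The columns in \<open>S\<close>, padded with zero columns to a square
        matrix; it is singular, and so is its transpose, whose kernel supplies
        \<open>w\<close>.\<close>
      define M where "M = mat n n (\<lambda>(i, j). if j < card S then (ss ! j) $ i else 0)"
      have M: "M \<in> carrier_mat n n" by (simp add: M_def)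
      have "M *\<^sub>v unit_vec n (n - 1) = 0\<^sub>v n"
        using less by (intro eq_vecI) (auto simp: M_def scalar_prod_right_unit)
      moreover have "unit_vec n (n - 1) \<noteq> (0\<^sub>v n :: 'a vec)" using less by simp
      ultimately have "det M = 0" using det_0_iff_vec_prod_zero_field[OF M] unit_vec_carrier by blast
      then have "det (transpose_mat M) = 0" using det_transpose[OF M] by simp
      then obtain w where w: "w \<in> carrier_vec n" "w \<noteq> 0\<^sub>v n" "transpose_mat M *\<^sub>v w = 0\<^sub>v n"
        using det_0_iff_vec_prod_zero_field[of "transpose_mat M" n] M by auto
      have "w \<bullet> c = 0" if c: "c \<in> S" for c
      proof -
        obtain j where j: "j < card S" "c = ss ! j" using c ss len by (metis in_set_conv_nth)
        have "col M j = c"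
          using j less c Sc(1) by (intro eq_vecI) (auto simp: M_def)
        moreover have "(transpose_mat M *\<^sub>v w) $ j = 0" using w(3) j less by simp
        ultimately have "c \<bullet> w = 0" using j less M by simp
        then show ?thesis using comm_scalar_prod[OF w(1)] c Sc(1) by auto
      qed
      then have "w \<in> orthogonal_complement (span S)"
        unfolding in_orthogonal_complement_span[OF Sc(1)] using w(1) by (simp add: orthogonal_complement_def)
      moreover have "set (cols A) \<subseteq> span S"
      proof
        fix c assume c: "c \<in> set (cols A)"
        show "c \<in> span S"
        proof (cases "c \<in> S")
          case True
          then show ?thesis using in_own_span[of S] Sc(1) by auto
        next
          case False
          have "lin_dep (S \<union> {c})"
          proof (rule ccontr)
            assume "lin_indpt (S \<union> {c})"
            then have "S \<union> {c} = S" using S c Sc(3) unfolding maximal_def by blast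
            then show False using False by blast
          qed
          then show ?thesis using lin_dep_iff_in_span[of S c] Sc c colsA False by auto
        qed
      qed
      ultimately have "\<forall>c\<in>set (cols A). w \<bullet> c = 0" by (auto simp: orthogonal_complement_def)
      then show False using ann w by blast
    qed
  qed
qed

end

text \<open>Full rank means that the gradients are linearly independent; the shift between entries
  numbered from 0 and variables numbered from 1 is handled here once.\<close>

lemma jacobian_rank_iff:
  fixes h :: "'a::comm_ring_1 \<Rightarrow> 'k::field"
  shows "vec_space.rank m (jacobian h m n F x) = m \<longleftrightarrow>
    (\<forall>w. (\<forall>j\<in>{1..n}. (\<Sum>i=1..m. w i * mpoly_subst h x (mpoly_deriv j (F i))) = 0) \<longrightarrow> (\<forall>i\<in>{1..m}. w i = 0))"
    (is "_ \<longleftrightarrow> ?R")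
proof -
  interpret vec_space "TYPE('k)" m .
  let ?J = "jacobian h m n F x"
  let ?D = "\<lambda>i j. mpoly_subst h x (mpoly_deriv j (F i))"
  have J: "?J \<in> carrier_mat m n" by (simp add: jacobian_def)
  have prod: "(\<forall>c\<in>set (cols ?J). vec m (\<lambda>i. w (Suc i)) \<bullet> c = 0) \<longleftrightarrow> (\<forall>j\<in>{1..n}. (\<Sum>i=1..m. w i * ?D i j) = 0)" for w
  proof -
    have "vec m (\<lambda>i. w (Suc i)) \<bullet> col ?J j = (\<Sum>i=1..m. w i * ?D i (Suc j))" if "j < n" for j
      using that by (simp add: scalar_prod_def jacobian_def sum.atLeast_Suc_atMost_Suc_shift atLeast0LessThan
          lessThan_Suc_atMost[symmetric] sum.atLeast1_atMost_eq)
    moreover have "(\<forall>j\<in>{1..n}. P j) \<longleftrightarrow> (\<forall>j<n. P (Suc j))" for P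
      by (auto simp: Suc_le_eq) (metis Suc_pred' Suc_le_eq less_eq_Suc_le)
    moreover have "set (cols ?J) = col ?J ` {..<n}" using J by (auto simp: cols_def)
    ultimately show ?thesis by auto
  qed
  have zero: "vec m (\<lambda>i. w (Suc i)) = 0\<^sub>v m \<longleftrightarrow> (\<forall>i\<in>{1..m}. w i = 0)" for w :: "nat \<Rightarrow> 'k"
  proof -
    have "vec m (\<lambda>i. w (Suc i)) = 0\<^sub>v m \<longleftrightarrow> (\<forall>i<m. w (Suc i) = 0)" by (auto simp: vec_eq_iff)
    also have "\<dots> \<longleftrightarrow> (\<forall>i\<in>{1..m}. w i = 0)"
      by (auto simp: Suc_le_eq) (metis Suc_pred' Suc_le_eq less_eq_Suc_le)
    finally show ?thesis .
  qed
  have "rank ?J = m \<longleftrightarrow> (\<forall>w. (\<forall>c\<in>set (cols ?J). vec m (\<lambda>i. w (Suc i)) \<bullet> c = 0) \<longrightarrow> vec m (\<lambda>i. w (Suc i)) = 0\<^sub>v m)"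
    unfolding rank_eq_n_iff[OF J]
  proof (intro iffI allI ballI)
    fix v :: "'k vec" assume R: "\<forall>w. (\<forall>c\<in>set (cols ?J). vec m (\<lambda>i. w (Suc i)) \<bullet> c = 0) \<longrightarrow> vec m (\<lambda>i. w (Suc i)) = 0\<^sub>v m"
      and v: "v \<in> carrier_vec m"
    have "v = vec m (\<lambda>i. (\<lambda>i. v $ (i - 1)) (Suc i))" using v by (intro eq_vecI) auto
    then show "(\<forall>c\<in>set (cols ?J). v \<bullet> c = 0) \<longrightarrow> v = 0\<^sub>v m"
      using R[rule_format, of "\<lambda>i. v $ (i - 1)"] by metis
  qed simp
  then show ?thesis unfolding prod zero .
qed


section \<open>Smooth points\<close>

text \<open>A proper closed subset lies in the zero set of some polynomial outside \<open>P\<close>.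
  For two such subsets the product is outside \<open>P\<close>, and by the Nullstellensatz it is
  nonzero at some point of the locus, which neither subset contains.\<close>

lemma irreducible_zero_locus:
  fixes P :: "'k::alg_closed_field mpoly set"
  assumes P: "poly_prime n P"
  shows "irreducible_space (subtopology (zariski n) (zero_locus (\<lambda>c. c) n P))"
proof -
  let ?Z = "zero_locus (\<lambda>c. c) n P"
  have top: "topspace (subtopology (zariski n) ?Z) = ?Z"
    by (auto simp: topspace_zariski zero_locus_def)
  obtain x where x: "x \<in> ?Z" using nullstellensatz_prime[OF P polys_1 poly_primeD(2)[OF P]] by blast
  have witness: "\<exists>p\<in>polys n. p \<notin> P \<and> (\<forall>y\<in>A. ev y p = 0)"
    if A: "closedin (subtopology (zariski n) ?Z) A" "A \<noteq> ?Z" for A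
  proof -
    obtain F where F: "F \<subseteq> polys n" "A = zero_locus (\<lambda>c. c) n F \<inter> ?Z"
      using A(1) unfolding closedin_subtopology closedin_zariski by blast
    then obtain y p where y: "y \<in> ?Z" "p \<in> F" "ev y p \<noteq> 0"
      using A(2) by (auto simp: zero_locus_def)
    have "p \<notin> P" using y by (auto simp: zero_locus_def)
    moreover have "\<forall>y\<in>A. ev y p = 0" using F(2) y(2) by (auto simp: zero_locus_def)
    ultimately show ?thesis using F(1) y(2) by blast
  qed
  show ?thesis unfolding irreducible_space_def top
  proof (intro conjI allI impI)
    show "?Z \<noteq> {}" using x by blast
    fix A B assume AB: "closedin (subtopology (zariski n) ?Z) A \<and> closedin (subtopology (zariski n) ?Z) B \<and> A \<union> B = ?Z"
    show "A = ?Z \<or> B = ?Z"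
    proof (rule ccontr)
      assume no: "\<not> (A = ?Z \<or> B = ?Z)"
      obtain p where p: "p \<in> polys n" "p \<notin> P" "\<forall>y\<in>A. ev y p = 0" using witness[of A] AB no by blast
      obtain q where q: "q \<in> polys n" "q \<notin> P" "\<forall>y\<in>B. ev y q = 0" using witness[of B] AB no by blast
      have "p * q \<notin> P" using poly_primeD(3)[OF P p(1) q(1)] p(2) q(2) by blast
      then obtain y where y: "y \<in> ?Z" "ev y (p * q) \<noteq> 0"
        using nullstellensatz_prime[OF P polys_mult[OF p(1) q(1)]] by blast
      then have "y \<in> A \<union> B" using AB by blast
      then show False using y(2) p(3) q(3) by (auto simp: ev.hom_mult)
    qed
  qed
qed

text \<open>Zorn's lemma applies because the union of a chain of irreducible sets is irreducible:
  two points that show two closed subsets to be proper already lie in a common member of the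
  chain.\<close>

lemma irreducible_component_superset:
  assumes Y: "Y \<subseteq> topspace T" "irreducible_space (subtopology T Y)"
  obtains Z where "Z \<in> irreducible_components T" "Y \<subseteq> Z"
proof -
  define F where "F = {Z. Y \<subseteq> Z \<and> Z \<subseteq> topspace T \<and> irreducible_space (subtopology T Z)}"
  have top: "topspace (subtopology T Z) = Z" if "Z \<subseteq> topspace T" for Z using that by auto
  have "\<exists>M\<in>F. \<forall>Z'\<in>F. M \<subseteq> Z' \<longrightarrow> Z' = M"
  proof (rule subset_Zorn_nonempty)
    show "F \<noteq> {}" using Y by (auto simp: F_def)
    fix D assume D: "D \<noteq> {}" "subset.chain F D"
    define U where "U = \<Union>D"
    have CA: "C \<in> F" if "C \<in> D" for C using D(2) that by (auto simp: subset.chain_def)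
    have lin: "C \<subseteq> C' \<or> C' \<subseteq> C" if "C \<in> D" "C' \<in> D" for C C'
      using D(2) that by (auto simp: subset_chain_def)
    have U: "Y \<subseteq> U" "U \<subseteq> topspace T" using CA D(1) by (auto simp: F_def U_def)
    have "irreducible_space (subtopology T U)"
      unfolding irreducible_space_def top[OF U(2)]
    proof (intro conjI allI impI)
      obtain C where C: "C \<in> D" using D(1) by blast
      then have "topspace (subtopology T C) \<noteq> {}" "C \<subseteq> topspace T"
        using CA[OF C] by (auto simp: F_def irreducible_space_def)
      then show "U \<noteq> {}" using C by (auto simp: U_def)
      fix A B assume AB: "closedin (subtopology T U) A \<and> closedin (subtopology T U) B \<and> A \<union> B = U"
      show "A = U \<or> B = U"
      proof (rule ccontr)
        assume "\<not> (A = U \<or> B = U)"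
        moreover have "A \<subseteq> U" "B \<subseteq> U" using AB by blast+
        ultimately obtain a b where ab: "a \<in> U" "a \<notin> A" "b \<in> U" "b \<notin> B" by blast
        obtain C1 C2 where C12: "C1 \<in> D" "a \<in> C1" "C2 \<in> D" "b \<in> C2" using ab(1,3) by (auto simp: U_def)
        obtain C where C: "C \<in> D" "a \<in> C" "b \<in> C" using lin[OF C12(1,3)] C12 by blast
        have CU: "C \<subseteq> U" using C(1) by (auto simp: U_def)
        have CT: "C \<subseteq> topspace T" "irreducible_space (subtopology T C)" using CA[OF C(1)] by (auto simp: F_def)
        have cl: "closedin (subtopology T C) (Z' \<inter> C)" if "closedin (subtopology T U) Z'" for Z'
        proof -
          obtain E where "closedin T E" "Z' = E \<inter> U" using \<open>closedin (subtopology T U) Z'\<close> by (auto simp: closedin_subtopology)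
          moreover from this have "Z' \<inter> C = E \<inter> C" using CU by blast
          ultimately show ?thesis by (auto simp: closedin_subtopology)
        qed
        have "(A \<inter> C) \<union> (B \<inter> C) = C" using AB CU by blast
        then have "A \<inter> C = C \<or> B \<inter> C = C"
          using CT(2) cl AB unfolding irreducible_space_def top[OF CT(1)] by blast
        then show False using ab C by blast
      qed
    qed
    then show "\<Union>D \<in> F" using U unfolding U_def[symmetric] by (simp add: F_def)
  qed
  then obtain M where M: "M \<in> F" and max: "\<And>Z'. Z' \<in> F \<Longrightarrow> M \<subseteq> Z' \<Longrightarrow> Z' = M" by blast
  have "M \<in> irreducible_components T"
    unfolding irreducible_components_def
  proof (intro CollectI conjI allI impI)
    show "M \<subseteq> topspace T" "irreducible_space (subtopology T M)" using M by (auto simp: F_def)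
    fix Z' assume "M \<subseteq> Z' \<and> Z' \<subseteq> topspace T \<and> irreducible_space (subtopology T Z')"
    then show "Z' = M" using M by (intro max) (auto simp: F_def)
  qed
  then show ?thesis using that M by (auto simp: F_def)
qed

lemma growth_le_subset: "growth_le n V e \<Longrightarrow> W \<subseteq> V \<Longrightarrow> growth_le n W e"
  unfolding growth_le_def by (meson subsetD)

section \<open>Linear algebra with coordinate vectors\<close>

definition unit_fun :: "nat \<Rightarrow> nat \<Rightarrow> 'k::field" where
  "unit_fun i j = (if j = i then 1 else 0)"

lemma sum_unit_fun: "finite A \<Longrightarrow> (\<Sum>i\<in>A. v i * unit_fun i j) = (if j \<in> A then v j else 0)"
proof -
  assume "finite A"
  moreover have "v i * unit_fun i j = (if j = i then v i else 0)" for i by (simp add: unit_fun_def)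
  ultimately show ?thesis by simp
qed

lemma affine_space_expand:
  assumes "v \<in> affine_space r"
  shows "v = (\<Sum>i=1..r. (\<lambda>j. v i * unit_fun i j))"
  using assms by (auto simp: fun_eq_iff sum_fun_apply sum_unit_fun affine_space_def)

lemma affine_space_span: "affine_space r \<subseteq> fun_vs.span (unit_fun ` {1..r} :: (nat \<Rightarrow> 'k::field) set)"
proof
  fix v :: "nat \<Rightarrow> 'k" assume "v \<in> affine_space r"
  then have "v = (\<Sum>i=1..r. (\<lambda>j. v i * unit_fun i j))" by (rule affine_space_expand)
  also have "\<dots> \<in> fun_vs.span (unit_fun ` {1..r})"
    by (intro fun_vs.span_sum fun_vs.span_scale fun_vs.span_base imageI)
  finally show "v \<in> fun_vs.span (unit_fun ` {1..r})" .
qed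

lemma card_unit_fun: "card (unit_fun ` U :: (nat \<Rightarrow> 'k::field) set) = card U"
proof (rule card_image)
  show "inj_on (unit_fun :: nat \<Rightarrow> nat \<Rightarrow> 'k) U"
    by (auto intro!: inj_onI simp: unit_fun_def fun_eq_iff split: if_splits)
qed

text \<open>Basis completion: the independent vectors are extended by coordinate vectors, and
  \<open>U\<close> records which ones are taken.\<close>

lemma exchange_unit_funs:
  fixes a :: "'i \<Rightarrow> nat \<Rightarrow> 'k::field"
  assumes I: "finite I" and a: "\<And>i. i \<in> I \<Longrightarrow> a i \<in> affine_space r"
    and indep: "\<And>c i. (\<And>j. j \<in> {1..r} \<Longrightarrow> (\<Sum>i\<in>I. c i * a i j) = 0) \<Longrightarrow> i \<in> I \<Longrightarrow> c i = 0"
  obtains U where "U \<subseteq> {1..r}" "card I + card U \<le> r"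
    "\<And>v. v \<in> affine_space r \<Longrightarrow> v \<in> fun_vs.span (a ` I \<union> unit_fun ` U)"
proof -
  have *: "\<forall>c. (\<Sum>i\<in>I. (\<lambda>j. c i * a i j)) = 0 \<longrightarrow> (\<forall>i\<in>I. c i = 0)"
  proof (intro allI impI ballI)
    fix c i assume c: "(\<Sum>i\<in>I. (\<lambda>j. c i * a i j)) = 0" and i: "i \<in> I"
    have "(\<Sum>i\<in>I. c i * a i j) = 0" for j using fun_cong[OF c, of j] by (simp add: sum_fun_apply)
    then show "c i = 0" using indep i by blast
  qed
  note ind = fun_vs.family_independent[OF I *]
  let ?E = "unit_fun ` {1..r} :: (nat \<Rightarrow> 'k) set"
  obtain B where B: "a ` I \<subseteq> B" "B \<subseteq> a ` I \<union> ?E" "fun_vs.independent B" "a ` I \<union> ?E \<subseteq> fun_vs.span B"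
    using fun_vs.maximal_independent_subset_extend[of "a ` I" "a ` I \<union> ?E"] ind(2) by blast
  have fB: "finite B" using B(2) I finite_subset by auto
  have uE: "(unit_fun i :: nat \<Rightarrow> 'k) \<in> affine_space r" if "i \<in> {1..r}" for i
    using that by (auto simp: affine_space_def unit_fun_def)
  have "B \<subseteq> fun_vs.span ?E" using B(2) a affine_space_span uE by blast
  then have "card B \<le> card ?E" using fun_vs.independent_span_bound[OF _ B(3)] by simp
  then have cB: "card B \<le> r" by (simp add: card_unit_fun)
  define U where "U = {i \<in> {1..r}. unit_fun i \<in> B - a ` I}"
  have UB: "(unit_fun ` U :: (nat \<Rightarrow> 'k) set) = B - a ` I" using B(2) by (auto simp: U_def)
  show ?thesis
  proof (rule that[of U])
    show "U \<subseteq> {1..r}" by (auto simp: U_def)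
    have "card B = card (a ` I) + card (B - a ` I)"
      using fB B(1) by (metis card_Diff_subset card_mono finite_subset le_add_diff_inverse)
    then show "card I + card U \<le> r" using cB ind(1) UB card_unit_fun[of U, where 'k = 'k] by (simp add: card_image)
    fix v :: "nat \<Rightarrow> 'k" assume "v \<in> affine_space r"
    then have "v \<in> fun_vs.span ?E" using affine_space_span by blast
    moreover have "fun_vs.span ?E \<subseteq> fun_vs.span B"
      using B(4) by (intro fun_vs.span_minimal fun_vs.subspace_span) blast
    moreover have "a ` I \<union> unit_fun ` U = B" unfolding UB using B(1) by blast
    ultimately show "v \<in> fun_vs.span (a ` I \<union> unit_fun ` U)" by auto
  qed
qed

text \<open>Upper bound: by exchange, a kernel vector is determined by its coordinates in a set
  \<open>U\<close> of size at most \<open>r - m\<close>. Lower bound: each equation cuts a subspace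
  down by at most one dimension.\<close>

lemma dim_kernel:
  fixes d :: "nat \<Rightarrow> nat \<Rightarrow> 'k::field"
  assumes indep: "\<And>c i. (\<And>j. j \<in> {1..r} \<Longrightarrow> (\<Sum>i=1..m. c i * d i j) = 0) \<Longrightarrow> i \<in> {1..m} \<Longrightarrow> c i = 0"
  shows "fun_vs.dim {v \<in> affine_space r. \<forall>i\<in>{1..m}. (\<Sum>j=1..r. d i j * v j) = 0} = r - m"
proof -
  define K where "K = (\<lambda>l. {v \<in> affine_space r. \<forall>i\<in>{1..l}. (\<Sum>j=1..r. d i j * v j) = 0})"
  define a where "a = (\<lambda>i j. if j \<in> {1..r} then d i j else 0)"
  obtain U where U: "U \<subseteq> {1..r}" "card {1..m} + card U \<le> r"
    "\<And>v. v \<in> affine_space r \<Longrightarrow> v \<in> fun_vs.span (a ` {1..m} \<union> unit_fun ` U)"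
  proof (rule exchange_unit_funs[of "{1..m}" a r])
    show "a i \<in> affine_space r" for i by (auto simp: a_def affine_space_def)
    show "c i = 0" if "\<And>j. j \<in> {1..r} \<Longrightarrow> (\<Sum>i\<in>{1..m}. c i * a i j) = 0" "i \<in> {1..m}" for c i
      by (rule indep[OF _ that(2)]) (use that(1) in \<open>simp add: a_def\<close>)
  qed auto
  obtain C where C: "C \<subseteq> K m" "fun_vs.independent C" "K m \<subseteq> fun_vs.span C" "card C = fun_vs.dim (K m)"
    using fun_vs.basis_exists by blast
  have fC: "finite C"
    using fun_vs.independent_span_bound[OF _ C(2), of "unit_fun ` {1..r}"] C(1) affine_space_span by (auto simp: K_def)
  \<comment> \<open>A kernel vector vanishing on \<open>U\<close> is orthogonal to the spanning set
    obtained by exchange, hence to all of affine space.\<close>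
  have dot: "(\<Sum>j=1..r. w j * v j) = 0"
    if v: "v \<in> K m" "\<And>u. u \<in> U \<Longrightarrow> v u = 0" and w: "w \<in> fun_vs.span (a ` {1..m} \<union> unit_fun ` U)" for v w
    using w
  proof (induction rule: fun_vs.span_induct_alt)
    case (step c y z)
    have "(\<Sum>j=1..r. y j * v j) = 0" using step(1)
    proof
      assume "y \<in> a ` {1..m}"
      then obtain i where "i \<in> {1..m}" "y = a i" by blast
      then show ?thesis using v(1) by (simp add: K_def a_def)
    next
      assume "y \<in> unit_fun ` U"
      then obtain u where "u \<in> U" "y = unit_fun u" by blast
      then show ?thesis using v(2) by (auto simp: unit_fun_def if_distrib[of "\<lambda>c. c * _"] cong: if_cong)
    qed
    then show ?case using step by (simp add: distrib_right sum.distrib mult.assoc sum_distrib_left[symmetric])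
  qed simp
  have "card C \<le> card (unit_fun ` U :: (nat \<Rightarrow> 'k) set)"
  proof (rule fun_vs.family_card_le[where \<phi> = "\<lambda>b j. if j \<in> U then b j else 0"])
    show "finite (unit_fun ` U :: (nat \<Rightarrow> 'k) set)" using U(1) finite_subset by auto
    show "(\<lambda>j. if j \<in> U then b j else 0) \<in> fun_vs.span (unit_fun ` U)" for b :: "nat \<Rightarrow> 'k"
    proof -
      have "finite U" using U(1) finite_subset by auto
      then have "(\<lambda>j. if j \<in> U then b j else 0) = (\<Sum>u\<in>U. (\<lambda>j. b u * unit_fun u j))"
        by (auto simp: fun_eq_iff sum_fun_apply sum_unit_fun)
      also have "\<dots> \<in> fun_vs.span (unit_fun ` U)"
        by (intro fun_vs.span_sum fun_vs.span_scale fun_vs.span_base imageI)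
      finally show ?thesis .
    qed
    show "c b = 0" if 0: "(\<Sum>b\<in>C. (\<lambda>j. c b * (if j \<in> U then b j else 0))) = 0" and b: "b \<in> C" for c b
    proof -
      define v where "v = (\<Sum>b\<in>C. (\<lambda>j. c b * b j))"
      have lin: "(\<Sum>j=1..r. d i j * v j) = (\<Sum>b\<in>C. c b * (\<Sum>j=1..r. d i j * b j))" for i
      proof -
        have "(\<Sum>j=1..r. d i j * v j) = (\<Sum>j=1..r. \<Sum>b\<in>C. c b * (d i j * b j))"
          by (simp add: v_def sum_fun_apply sum_distrib_left mult_ac)
        also have "\<dots> = (\<Sum>b\<in>C. \<Sum>j=1..r. c b * (d i j * b j))" by (rule sum.swap)
        finally show ?thesis by (simp add: sum_distrib_left)
      qed
      have "v \<in> affine_space r"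
        using C(1) by (auto simp: v_def affine_space_def sum_fun_apply K_def intro!: sum.neutral)
      moreover have "(\<Sum>j=1..r. d i j * v j) = 0" if "i \<in> {1..m}" for i
        unfolding lin using C(1) that by (intro sum.neutral) (auto simp: K_def)
      ultimately have vK: "v \<in> K m" by (simp add: K_def)
      have vU: "v u = 0" if "u \<in> U" for u
        using fun_cong[OF 0, of u] that by (simp add: v_def sum_fun_apply)
      have "v i = 0" for i
      proof (cases "i \<in> {1..r}")
        case True
        then have "unit_fun i \<in> (affine_space r :: (nat \<Rightarrow> 'k) set)" by (auto simp: affine_space_def unit_fun_def)
        then have "(\<Sum>j=1..r. unit_fun i j * v j) = 0" using dot[OF vK vU] U(3) by blast
        then show ?thesis using True by (auto simp: unit_fun_def if_distrib[of "\<lambda>c. c * _"] cong: if_cong)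
      next
        case False
        then show ?thesis using \<open>v \<in> affine_space r\<close> by (simp add: affine_space_def)
      qed
      then have "(\<Sum>b\<in>C. (\<lambda>j. c b * b j)) = 0" unfolding v_def[symmetric] by (simp add: fun_eq_iff)
      then show ?thesis using C(2) fC b by (auto simp: fun_vs.dependent_finite)
    qed
  qed (rule fC)
  then have upper: "fun_vs.dim (K m) \<le> r - m" using U(2) C(4) by (simp add: card_unit_fun)
  have "\<exists>D. finite D \<and> card D \<le> l \<and> affine_space r \<subseteq> fun_vs.span (K l \<union> D)" for l
  proof (induction l)
    case 0
    show ?case by (intro exI[of _ "{}"]) (auto simp: K_def intro: fun_vs.span_base)
  next
    case (Suc l)
    then obtain D where D: "finite D" "card D \<le> l" "affine_space r \<subseteq> fun_vs.span (K l \<union> D)" by blast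
    let ?\<phi> = "\<lambda>v. \<Sum>j=1..r. d (Suc l) j * v j"
    have KS: "v \<in> K (Suc l) \<longleftrightarrow> v \<in> K l \<and> ?\<phi> v = 0" for v
      by (auto simp: K_def atLeastAtMostSuc_conv)
    show ?case
    proof (cases "\<forall>v\<in>K l. ?\<phi> v = 0")
      case True
      then have "K (Suc l) = K l" using KS by blast
      then show ?thesis using D by (intro exI[of _ D]) auto
    next
      case False
      then obtain u where u: "u \<in> K l" "?\<phi> u \<noteq> 0" by blast
      let ?S = "fun_vs.span (K (Suc l) \<union> insert u D)"
      have "K l \<subseteq> ?S"
      proof
        fix v assume v: "v \<in> K l"
        \<comment> \<open>With this factor, subtracting \<open>t\<close> times \<open>u\<close> from
          \<open>v\<close> satisfies the new equation.\<close>
        define t where "t = ?\<phi> v / ?\<phi> u"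
        define w where "w = v - (\<lambda>j. t * u j)"
        have lin: "(\<Sum>j=1..r. d i j * w j) = (\<Sum>j=1..r. d i j * v j) - t * (\<Sum>j=1..r. d i j * u j)" for i
          by (simp add: w_def right_diff_distrib sum_subtractf sum_distrib_left mult_ac)
        have "w \<in> K l" using v u(1) lin by (auto simp: K_def w_def affine_space_def)
        moreover have "?\<phi> w = 0" unfolding lin using u(2) by (simp add: t_def)
        ultimately have "w \<in> K (Suc l)" using KS by blast
        then have "w + (\<lambda>j. t * u j) \<in> ?S"
          by (intro fun_vs.span_add fun_vs.span_scale fun_vs.span_base) auto
        moreover have "w + (\<lambda>j. t * u j) = v" by (simp add: w_def)
        ultimately show "v \<in> ?S" by (simp only:)
      qed
      moreover have "D \<subseteq> ?S" by (auto intro: fun_vs.span_base)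
      ultimately have "fun_vs.span (K l \<union> D) \<subseteq> ?S"
        by (intro fun_vs.span_minimal fun_vs.subspace_span) auto
      then have "affine_space r \<subseteq> ?S" using D(3) by blast
      moreover have "card (insert u D) \<le> Suc l" using D by (simp add: card_insert_if)
      ultimately show ?thesis using D(1) by blast
    qed
  qed
  then obtain D where D: "finite D" "card D \<le> m" "affine_space r \<subseteq> fun_vs.span (K m \<union> D)" by blast
  have "K m \<union> D \<subseteq> fun_vs.span (C \<union> D)"
    using C(3) fun_vs.span_mono[of C "C \<union> D"] by (auto intro: fun_vs.span_base)
  then have sp: "affine_space r \<subseteq> fun_vs.span (C \<union> D)"
    using D(3) fun_vs.span_minimal[OF _ fun_vs.subspace_span] by blast
  have "card {1..r} \<le> card (C \<union> D)"
  proof (rule fun_vs.family_card_le[where \<phi> = unit_fun])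
    show "unit_fun i \<in> fun_vs.span (C \<union> D)" if "i \<in> {1..r}" for i
      using that by (intro subsetD[OF sp]) (auto simp: affine_space_def unit_fun_def)
    show "c i = 0" if "(\<Sum>i\<in>{1..r}. (\<lambda>j. c i * unit_fun i j)) = 0" "i \<in> {1..r}" for c and i :: nat
      using fun_cong[OF that(1), of i] that(2) by (simp add: sum_fun_apply sum_unit_fun)
  qed (use fC D(1) in auto)
  also have "\<dots> \<le> card C + card D" by (rule card_Un_le)
  finally have "r \<le> fun_vs.dim (K m) + m" using D(2) C(4) by simp
  then have "fun_vs.dim (K m) = r - m" using upper by simp
  then show ?thesis by (simp add: K_def)
qed

text \<open>Independent gradients of elements of \<open>P\<close> remove \<open>card I\<close>
  directions from \<open>\<mm>\<close> modulo \<open>\<mm>^2\<close>; local monomials in the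
  remaining coordinates, at most \<open>r - card I\<close> in number, span.\<close>

lemma qdim_le_of_gradients:
  fixes g :: "'i \<Rightarrow> 'k::field mpoly"
  assumes P: "poly_ideal r P" and I: "finite I" and g: "\<And>i. i \<in> I \<Longrightarrow> g i \<in> P" "\<And>i. i \<in> I \<Longrightarrow> ev x (g i) = 0"
    and indep: "\<And>c i. (\<And>j. j \<in> {1..r} \<Longrightarrow> (\<Sum>i\<in>I. c i * ev x (mpoly_deriv j (g i))) = 0) \<Longrightarrow> i \<in> I \<Longrightarrow> c i = 0"
    and j: "0 < j"
  shows "card I \<le> r \<and> qdim r x P j \<le> j ^ (r - card I)"
proof -
  note PD = poly_idealD[OF P]
  define a where "a = (\<lambda>i j. ev x (mpoly_deriv j (g i)))"
  have gp: "g i \<in> polys r" if "i \<in> I" for i using g(1)[OF that] PD(1) by blast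
  have aff: "a i \<in> affine_space r" if "i \<in> I" for i
    using mpoly_deriv_notin_polys[OF gp[OF that]] by (auto simp: a_def affine_space_def ev.hom_zero)
  obtain U where U: "U \<subseteq> {1..r}" "card I + card U \<le> r"
    "\<And>v. v \<in> affine_space r \<Longrightarrow> v \<in> fun_vs.span (a ` I \<union> unit_fun ` U)"
    using exchange_unit_funs[of I a r] I aff indep unfolding a_def by blast
  have fU: "finite U" using U(1) finite_subset by auto
  let ?L = "mp.span ((\<lambda>u. Var u - Const (x u)) ` U)"
  \<comment> \<open>\<open>v\<close> is attained as the gradient at \<open>x\<close> of some
    \<open>l + q\<close> vanishing there, with \<open>l\<close> from the coordinates in
    \<open>U\<close> and \<open>q \<in> P\<close>; this property passes from generators to the
    span.\<close>
  define ok where "ok = (\<lambda>v. \<exists>l\<in>?L. \<exists>q\<in>P. ev x q = 0 \<and> l \<in> polys r \<and> ev x l = 0 \<and>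
    (\<forall>j\<in>{1..r}. ev x (mpoly_deriv j (l + q)) = v j))"
  have ok: "ok v" if "v \<in> fun_vs.span (a ` I \<union> unit_fun ` U)" for v
    using that
  proof (induction rule: fun_vs.span_induct_alt)
    case base
    show ?case unfolding ok_def
      by (intro bexI[of _ 0]) (auto simp: ev.hom_zero mp.span_zero PD(2) polys_0)
  next
    case (step c y z)
    obtain l q where lq: "l \<in> ?L" "q \<in> P" "ev x q = 0" "l \<in> polys r" "ev x l = 0"
      "\<forall>j\<in>{1..r}. ev x (mpoly_deriv j (l + q)) = z j" using step(2) unfolding ok_def by blast
    have deriv_c: "mpoly_deriv j (Const c * p) = Const c * mpoly_deriv j p" for j and p :: "'k mpoly"
      by (simp add: mpoly_deriv_mult)
    show ?case using step(1)
    proof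
      assume "y \<in> a ` I"
      then obtain i where i: "i \<in> I" "y = a i" by blast
      have "Const c * g i + q \<in> P" using PD(3)[OF PD(4)[OF g(1)[OF i(1)] polys_Const] lq(2)] .
      moreover have "ev x (Const c * g i + q) = 0" using g(2)[OF i(1)] lq(3) by (simp add: ev.hom_add ev.hom_mult)
      moreover have "ev x (mpoly_deriv j (l + (Const c * g i + q))) = ((\<lambda>j. c * y j) + z) j" if "j \<in> {1..r}" for j
        using lq(6) that i(2) by (simp add: mpoly_deriv_add deriv_c ev.hom_add ev.hom_mult a_def algebra_simps)
      ultimately show ?thesis unfolding ok_def using lq(1,4,5) by blast
    next
      assume "y \<in> unit_fun ` U"
      then obtain u where u: "u \<in> U" "y = unit_fun u" by blast
      let ?l = "Const c * (Var u - Const (x u)) + l"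
      have "?l \<in> ?L" using u(1) lq(1) by (intro mp.span_add mp.span_scale) (auto intro: mp.span_base)
      moreover have "?l \<in> polys r" using u(1) U(1) lq(4) by (intro polys_add polys_mult polys_diff polys_Var polys_Const) auto
      moreover have "ev x ?l = 0" using lq(5) by (simp add: ev.hom_add ev.hom_mult ev.hom_minus)
      moreover have "ev x (mpoly_deriv j (?l + q)) = ((\<lambda>j. c * y j) + z) j" if "j \<in> {1..r}" for j
      proof -
        have "mpoly_deriv j (Var u - Const (x u)) = (if u = j then 1 else 0 :: 'k mpoly)"
        proof -
          have "Var u - Const (x u) = Var u + Const (- x u)" by (simp add: Const_simps)
          then show ?thesis by (simp only: mpoly_deriv_add mpoly_deriv_Var mpoly_deriv_Const add_0_right)
        qed
        note D = this
        have "?l + q = Const c * (Var u - Const (x u)) + (l + q)" by (simp only: add.assoc)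
        then have "mpoly_deriv j (?l + q) = Const c * (if u = j then 1 else 0) + mpoly_deriv j (l + q)"
          by (simp only: mpoly_deriv_add[of j "Const c * (Var u - Const (x u))"] deriv_c D)
        then have "ev x (mpoly_deriv j (?l + q)) = c * (if u = j then 1 else 0) + z j"
          using lq(6) that by (simp add: ev.hom_add[of x _ "mpoly_deriv j (l + q)"] ev.hom_mult ev.hom_one ev.hom_zero)
        then show ?thesis by (simp add: u(2) unit_fun_def)
      qed
      ultimately show ?thesis unfolding ok_def using lq(2,3) by blast
    qed
  qed
  have lin: "\<exists>l\<in>?L. \<exists>q\<in>P. \<exists>f\<in>ord_ge r x 2. Var i - Const (x i) = l + q + f" if i: "i \<in> {1..r}" for i
  proof -
    have "(unit_fun i :: nat \<Rightarrow> 'k) \<in> affine_space r" using i by (auto simp: affine_space_def unit_fun_def)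
    then have "ok (unit_fun i)" using ok U(3) by blast
    then obtain l q where lq: "l \<in> ?L" "q \<in> P" "ev x q = 0" "l \<in> polys r" "ev x l = 0"
      "\<forall>j\<in>{1..r}. ev x (mpoly_deriv j (l + q)) = unit_fun i j" unfolding ok_def by blast
    \<comment> \<open>Value and gradient at \<open>x\<close> cancel, so the error lies in
      \<open>\<mm>^2\<close>.\<close>
    define f where "f = Var i - Const (x i) - (l + q)"
    have qp: "q \<in> polys r" using lq(2) PD(1) by blast
    have "f \<in> ord_ge r x 2"
    proof (rule ord_ge_2I)
      show "f \<in> polys r" unfolding f_def using i by (intro polys_diff polys_add polys_Var polys_Const lq qp)
      show "ev x f = 0" using lq by (simp add: f_def ev.hom_minus ev.hom_add)
      show "ev x (mpoly_deriv j f) = 0" if "j \<in> {1..r}" for j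
      proof -
        have "l + q + f = Var i + Const (- x i)" by (simp add: f_def Const_simps)
        then have "mpoly_deriv j (l + q + f) = mpoly_deriv j (Var i + Const (- x i))" by simp
        then have "mpoly_deriv j (l + q) + mpoly_deriv j f = (if i = j then 1 else 0)"
          by (simp add: mpoly_deriv_add)
        then have "ev x (mpoly_deriv j (l + q)) + ev x (mpoly_deriv j f) = (if i = j then 1 else 0)"
          unfolding ev.hom_add[symmetric] by (simp add: ev.hom_one ev.hom_zero)
        then show ?thesis using lq(6) that by (auto simp: unit_fun_def split: if_splits)
      qed
    qed
    moreover have "Var i - Const (x i) = l + q + f" by (simp add: f_def)
    ultimately show ?thesis using lq by blast
  qed
  have "qdim r x P j \<le> card (lmonom x ` {\<beta>. keys \<beta> \<subseteq> U \<and> mdeg \<beta> < j})"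
    by (rule qdim_le[OF _ spans_mod_lmonom[OF P U(1) lin]]) (use finite_exponents(1)[OF fU] in auto)
  also have "\<dots> \<le> card {\<beta> :: nat \<Rightarrow>\<^sub>0 nat. keys \<beta> \<subseteq> U \<and> mdeg \<beta> < j}"
    using finite_exponents(1)[OF fU] by (rule card_image_le)
  also have "\<dots> \<le> j ^ card U" by (rule finite_exponents(2)[OF fU])
  also have "\<dots> \<le> j ^ (r - card I)" using j U(2) by (intro power_increasing) auto
  finally show ?thesis using U(2) by simp
qed

text \<open>Cutting the full polynomial ring, of order \<open>r\<close>, by one equation after the
  other loses at most one order each time.\<close>

lemma big_ideal_of_equations:
  fixes R :: "nat \<Rightarrow> 'k::field mpoly"
  assumes "0 < r" "m \<le> r" and R: "\<And>i. i \<in> {1..m} \<Longrightarrow> R i \<in> polys r" "\<And>i. i \<in> {1..m} \<Longrightarrow> ev x (R i) = 0"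
  obtains I where "poly_ideal r I" "R ` {1..m} \<subseteq> I" "big r x (r - m) I"
proof -
  have "\<exists>I. poly_ideal r I \<and> R ` {1..l} \<subseteq> I \<and> big r x (r - l) I" if "l \<le> m" for l
    using that
  proof (induction l)
    case 0
    have "poly_ideal r ({0} :: 'k mpoly set)" by (auto simp: poly_ideal_def polys_0)
    then show ?case using big_zero_ideal[OF \<open>0 < r\<close>, of x] by auto
  next
    case (Suc l)
    then obtain I where I: "poly_ideal r I" "R ` {1..l} \<subseteq> I" "big r x (r - l) I" by auto
    have Rp: "R (Suc l) \<in> polys r" using R(1) Suc.prems by auto
    have "R (Suc l) \<in> ord_ge r x 1" using ord_ge_1_iff[OF Rp] R(2) Suc.prems by auto
    moreover have "r - l = Suc (r - Suc l)" using Suc.prems \<open>m \<le> r\<close> by simp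
    ultimately have "big r x (r - Suc l) (add_elem r I (R (Suc l)))"
      using big_cut[OF I(1)] I(3) by simp
    moreover have "R ` {1..Suc l} \<subseteq> add_elem r I (R (Suc l))"
      using I(2) poly_ideal_add_elem(2,3)[OF I(1) Rp] by (auto simp: atLeastAtMostSuc_conv)
    ultimately show ?case using poly_ideal_add_elem(1)[OF I(1) Rp] by blast
  qed
  then show ?thesis using that by blast
qed

text \<open>The tangent space lies in the kernel of the Jacobian since the \<open>R i\<close> vanish
  on \<open>V\<close>; the converse must exclude further linear conditions from the vanishing ideal.
  For the local dimension, \<open>growth\<close> gives the upper bound and a chain of primes the
  lower one.\<close>

theorem smooth_point:
  fixes R :: "nat \<Rightarrow> 'k::alg_closed_field mpoly"
  assumes "0 < r" "m \<le> r" and R: "\<And>i. i \<in> {1..m} \<Longrightarrow> R i \<in> polys r"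
    and V: "V = zero_locus (\<lambda>c. c) r (R ` {1..m})" and x: "x \<in> V" and growth: "growth_le r V (r - m)"
    and indep: "\<And>c i. (\<And>j. j \<in> {1..r} \<Longrightarrow> (\<Sum>i=1..m. c i * ev x (mpoly_deriv j (R i))) = 0) \<Longrightarrow> i \<in> {1..m} \<Longrightarrow> c i = 0"
  shows "fun_vs.dim (tangent_space r V x) = r - m" "local_dim r V x = ereal (real (r - m))"
proof -
  have R0: "ev y (R i) = 0" if "y \<in> V" "i \<in> {1..m}" for y i using that V by (auto simp: zero_locus_def)
  have Vaff: "V \<subseteq> affine_space r" using V by (auto simp: zero_locus_def)
  obtain I where I: "poly_ideal r I" "R ` {1..m} \<subseteq> I" "big r x (r - m) I"
    using big_ideal_of_equations[of r m R x] assms(1,2) R R0[OF x] by blast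
  have locV: "zero_locus (\<lambda>c. c) r P \<subseteq> V" if "I \<subseteq> P" for P
    using that I(2) unfolding V by (auto simp: zero_locus_def)
  let ?K = "{v \<in> affine_space r. \<forall>i\<in>{1..m}. (\<Sum>j=1..r. ev x (mpoly_deriv j (R i)) * v j) = 0}"
  have "tangent_space r V x = ?K"
  proof (intro equalityI subsetI)
    fix v assume "v \<in> tangent_space r V x"
    moreover have "R i \<in> vanishing_ideal r V" if "i \<in> {1..m}" for i
      using R R0 that by (auto simp: vanishing_ideal_def)
    ultimately show "v \<in> ?K" by (auto simp: tangent_space_def)
  next
    fix v assume v: "v \<in> ?K"
    have "(\<Sum>j=1..r. ev x (mpoly_deriv j p) * v j) = 0" if p: "p \<in> vanishing_ideal r V" for p
    proof (rule ccontr)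
      assume nz: "(\<Sum>j=1..r. ev x (mpoly_deriv j p) * v j) \<noteq> 0"
      obtain P where P: "poly_prime r P" "I \<subseteq> P" "big r x (r - m) P" "P \<subseteq> ord_ge r x 1"
        by (rule big_prime[OF I(1,3)])
      have pp: "p \<in> polys r" "\<And>y. y \<in> V \<Longrightarrow> ev y p = 0" using p by (auto simp: vanishing_ideal_def)
      \<comment> \<open>By the Nullstellensatz, because the zero locus of \<open>P\<close> is
        contained in \<open>V\<close>.\<close>
      have "p \<in> P"
      proof (rule ccontr)
        assume "p \<notin> P"
        then obtain y where "y \<in> zero_locus (\<lambda>c. c) r P" "ev y p \<noteq> 0"
          using nullstellensatz_prime[OF P(1) pp(1)] by blast
        then show False using locV[OF P(2)] pp(2) by blast
      qed
      \<comment> \<open>Index 0 is free for \<open>p\<close>, as the equations are numbered from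
        1.\<close>
      define g where "g = (\<lambda>i. if i = 0 then p else R i)"
      have g: "g i \<in> P" "ev x (g i) = 0" if "i \<in> {0..m}" for i
      proof -
        have "i = 0 \<or> i \<in> {1..m}" using that by auto
        moreover have "R i \<in> P" if "i \<in> {1..m}" using I(2) P(2) that by blast
        ultimately show "g i \<in> P" "ev x (g i) = 0"
          using \<open>p \<in> P\<close> pp(2)[OF x] R0[OF x, of i] by (auto simp: g_def)
      qed
      have split: "(\<Sum>i\<in>{0..m}. c i * ev x (mpoly_deriv j (g i))) =
          c 0 * ev x (mpoly_deriv j p) + (\<Sum>i=1..m. c i * ev x (mpoly_deriv j (R i)))" for c j
        by (simp add: sum.atLeast_Suc_atMost g_def)
      \<comment> \<open>Pairing a relation with \<open>v\<close> removes the gradients of the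
        \<open>R i\<close>, because \<open>v\<close> is in their kernel, and forces
        \<open>c 0 = 0\<close>.\<close>
      have ind: "c i = 0" if c: "\<And>j. j \<in> {1..r} \<Longrightarrow> (\<Sum>i\<in>{0..m}. c i * ev x (mpoly_deriv j (g i))) = 0" and i: "i \<in> {0..m}" for c i
      proof -
        have "0 = (\<Sum>j=1..r. (c 0 * ev x (mpoly_deriv j p) + (\<Sum>i=1..m. c i * ev x (mpoly_deriv j (R i)))) * v j)"
          using c unfolding split by simp
        also have "\<dots> = c 0 * (\<Sum>j=1..r. ev x (mpoly_deriv j p) * v j) +
            (\<Sum>j=1..r. \<Sum>i=1..m. c i * (ev x (mpoly_deriv j (R i)) * v j))"
          by (simp add: distrib_right sum.distrib sum_distrib_left sum_distrib_right mult.assoc)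
        also have "(\<Sum>j=1..r. \<Sum>i=1..m. c i * (ev x (mpoly_deriv j (R i)) * v j)) =
            (\<Sum>i=1..m. c i * (\<Sum>j=1..r. ev x (mpoly_deriv j (R i)) * v j))"
          by (subst sum.swap) (simp add: sum_distrib_left)
        also have "\<dots> = 0" using v by simp
        finally have c0: "c 0 = 0" using nz by simp
        have "(\<Sum>i=1..m. c i * ev x (mpoly_deriv j (R i))) = 0" if "j \<in> {1..r}" for j
          using c[OF that] unfolding split c0 by simp
        then show ?thesis using indep[of c i] c0 i by (cases "i = 0") auto
      qed
      have q: "Suc m \<le> r" "qdim r x P j \<le> j ^ (r - Suc m)" if "0 < j" for j
      proof -
        have "card {0..m} \<le> r \<and> qdim r x P j \<le> j ^ (r - card {0..m})"
        proof (rule qdim_le_of_gradients[where g = g])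
          show "c i = 0" if "\<And>j. j \<in> {1..r} \<Longrightarrow> (\<Sum>i\<in>{0..m}. c i * ev x (mpoly_deriv j (g i))) = 0"
            "i \<in> {0..m}" for c i by (rule ind[OF that])
        qed (use poly_primeD(1)[OF P(1)] g that in auto)
        then show "Suc m \<le> r" "qdim r x P j \<le> j ^ (r - Suc m)" by auto
      qed
      obtain C where C: "\<And>k. \<exists>j>k. j ^ (r - m) \<le> C * qdim r x P j" using P(3) unfolding big_def by blast
      obtain j where j: "j > C" "j ^ (r - m) \<le> C * qdim r x P j" using C by blast
      have j0: "0 < j" using j(1) by simp
      \<comment> \<open>The exponents differ by one, so growth of order \<open>r - m\<close> would
        give \<open>j \<le> C\<close>, against the choice of \<open>j\<close>.\<close>
      have e: "r - m = Suc (r - Suc m)" using q(1)[OF j0] by simp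
      have "j * j ^ (r - Suc m) \<le> C * qdim r x P j" using j(2) unfolding e by simp
      also have "\<dots> \<le> C * j ^ (r - Suc m)" using q(2)[OF j0] by (intro mult_left_mono) auto
      finally show False using j(1) j0 by simp
    qed
    then show "v \<in> tangent_space r V x" using v by (auto simp: tangent_space_def)
  qed
  moreover have "fun_vs.dim ?K = r - m"
  proof (rule dim_kernel)
    show "c i = 0" if "\<And>j. j \<in> {1..r} \<Longrightarrow> (\<Sum>i=1..m. c i * ev x (mpoly_deriv j (R i))) = 0"
      "i \<in> {1..m}" for c i by (rule indep[OF that])
  qed
  ultimately show "fun_vs.dim (tangent_space r V x) = r - m" by simp
  show "local_dim r V x = ereal (real (r - m))"
  proof (rule antisym)
    have sub: "Z \<subseteq> V" if "Z \<in> irreducible_components (subtopology (zariski r) V)" for Z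
      using that by (auto simp: irreducible_components_def)
    have "zdim r Z \<le> ereal (real (r - m))" if "Z \<subseteq> V" for Z
      using that Vaff growth_le_subset[OF growth that] by (intro zdim_le_growth) auto
    then show "local_dim r V x \<le> ereal (real (r - m))"
      unfolding local_dim_def using sub by (intro Sup_least) auto
    \<comment> \<open>Zero loci reverse inclusions, so the descending primes become an ascending
      chain of irreducible sets through \<open>x\<close>.\<close>
    obtain Q where Q: "\<And>i. i \<le> r - m \<Longrightarrow> poly_prime r (Q i) \<and> Q i \<subseteq> ord_ge r x 1 \<and> I \<subseteq> Q i"
      "\<And>i. i < r - m \<Longrightarrow> Q (Suc i) \<subset> Q i"
      using big_prime_chain[OF I(1,3)] by blast
    define Z where "Z = (\<lambda>i. zero_locus (\<lambda>c. c) r (Q i))"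
    have ZV: "Z i \<subseteq> V" and xZ: "x \<in> Z i" and irr: "irreducible_space (subtopology (zariski r) (Z i))"
      and closed: "closedin (zariski r) (Z i)" if i: "i \<le> r - m" for i
    proof -
      note Qi = Q(1)[OF i]
      note QD = poly_idealD[OF poly_primeD(1)[OF conjunct1[OF Qi]]]
      show "Z i \<subseteq> V" unfolding Z_def using Qi by (intro locV) blast
      show "x \<in> Z i" unfolding Z_def zero_locus_def
        using Qi QD(1) x Vaff ord_ge_1_iff[of _ r x] by auto
      show "irreducible_space (subtopology (zariski r) (Z i))" unfolding Z_def
        using Qi by (intro irreducible_zero_locus) blast
      show "closedin (zariski r) (Z i)" unfolding Z_def closedin_zariski using QD(1) by blast
    qed
    have strict: "Z i \<subset> Z (Suc i)" if i: "i < r - m" for i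
    proof -
      obtain f where f: "f \<in> Q i" "f \<notin> Q (Suc i)" using Q(2)[OF i] by blast
      have "Q i \<subseteq> polys r" using Q(1)[of i] i poly_idealD(1) poly_primeD(1) by (metis less_imp_le)
      then have "f \<in> polys r" using f(1) by blast
      then obtain y where "y \<in> Z (Suc i)" "ev y f \<noteq> 0"
        using nullstellensatz_prime[of r "Q (Suc i)" f] Q(1)[of "Suc i"] i f(2) unfolding Z_def by auto
      moreover have "Z i \<subseteq> Z (Suc i)" using Q(2)[OF i] by (auto simp: Z_def zero_locus_def)
      ultimately show ?thesis using f(1) by (auto simp: Z_def zero_locus_def)
    qed
    have "Z (r - m) \<subseteq> topspace (subtopology (zariski r) V)"
      using ZV[OF order_refl] Vaff by (auto simp: topspace_zariski)
    moreover have "irreducible_space (subtopology (subtopology (zariski r) V) (Z (r - m)))"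
      using irr[OF order_refl] by (simp add: subtopology_subtopology Int_absorb1[OF ZV[OF order_refl]])
    \<comment> \<open>A component through \<open>x\<close> that contains the whole chain.\<close>
    ultimately obtain Y where Y: "Y \<in> irreducible_components (subtopology (zariski r) V)" "Z (r - m) \<subseteq> Y"
      by (rule irreducible_component_superset)
    have mono: "Z i \<subseteq> Z j" if "i \<le> j" "j \<le> r - m" for i j
      using that
    proof (induction j rule: dec_induct)
      case (step l)
      then show ?case using strict[of l] by auto
    qed simp
    have ZY: "Z i \<subseteq> Y" if "i \<le> r - m" for i using mono[OF that order_refl] Y(2) by blast
    have chain: "\<forall>i\<le>r - m. closedin (subtopology (zariski r) Y) (Z i) \<and>
        irreducible_space (subtopology (subtopology (zariski r) Y) (Z i))"
    proof (intro allI impI conjI)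
      fix i assume i: "i \<le> r - m"
      show "closedin (subtopology (zariski r) Y) (Z i)"
        unfolding closedin_subtopology using closed[OF i] ZY[OF i] by (intro exI[of _ "Z i"]) auto
      show "irreducible_space (subtopology (subtopology (zariski r) Y) (Z i))"
        using irr[OF i] by (simp add: subtopology_subtopology Int_absorb1[OF ZY[OF i]])
    qed
    have "ereal (real (r - m)) \<le> zdim r Y"
      unfolding zdim_def krull_dim_def by (rule Sup_upper) (use chain strict in blast)
    also have "\<dots> \<le> local_dim r V x"
      unfolding local_dim_def using Y xZ[OF order_refl] by (intro Sup_upper) auto
    finally show "ereal (real (r - m)) \<le> local_dim r V x" .
  qed
qed


section \<open>The singular locus\<close>

definition mpoly_map :: "('a::comm_ring_1 \<Rightarrow> 'b::comm_ring_1) \<Rightarrow> 'a mpoly \<Rightarrow> 'b mpoly" where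
  "mpoly_map h = mpoly_subst (\<lambda>c. Const (h c)) Var"

context comm_ring_hom
begin

lemma comm_ring_hom_mpoly_map: "comm_ring_hom (mpoly_map hom)"
  unfolding mpoly_map_def
  by (rule comm_ring_hom_mpoly_subst[OF comm_ring_hom_comp[OF comm_ring_hom_Const comm_ring_hom_axioms]])

lemma mpoly_map_Const [simp]: "mpoly_map hom (Const c) = Const (hom c)"
  and mpoly_map_Var [simp]: "mpoly_map hom (Var i) = Var i"
  unfolding mpoly_map_def
  using comm_ring_hom_comp[OF comm_ring_hom_Const comm_ring_hom_axioms] by simp_all

lemma mpoly_map_closed: "p \<in> polys n \<Longrightarrow> mpoly_map hom p \<in> polys n"
proof (induction rule: polys_induct)
  interpret M: comm_ring_hom "mpoly_map hom" by (rule comm_ring_hom_mpoly_map)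
  show "mpoly_map hom (p + q) \<in> polys n" if "mpoly_map hom p \<in> polys n" "mpoly_map hom q \<in> polys n" for p q
    using that by (simp add: M.hom_add polys_add)
  show "mpoly_map hom (p * q) \<in> polys n" if "mpoly_map hom p \<in> polys n" "mpoly_map hom q \<in> polys n" for p q
    using that by (simp add: M.hom_mult polys_mult)
qed (auto intro: polys_Const polys_Var)

lemma ev_mpoly_map:
  assumes "p \<in> polys n"
  shows "ev x (mpoly_map hom p) = mpoly_subst hom x p"
  using assms comm_ring_hom_comp[OF ev.comm_ring_hom_axioms comm_ring_hom_mpoly_map]
    comm_ring_hom_mpoly_subst[OF comm_ring_hom_axioms]
  by (rule mpoly_hom_eq) (simp_all add: comm_ring_hom_axioms)

lemma mpoly_deriv_mpoly_map: "p \<in> polys n \<Longrightarrow> mpoly_deriv j (mpoly_map hom p) = mpoly_map hom (mpoly_deriv j p)"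
proof (induction rule: polys_induct)
  interpret M: comm_ring_hom "mpoly_map hom" by (rule comm_ring_hom_mpoly_map)
  case (add p q)
  then show ?case by (simp add: M.hom_add mpoly_deriv_add)
next
  interpret M: comm_ring_hom "mpoly_map hom" by (rule comm_ring_hom_mpoly_map)
  case (mult p q)
  then show ?case by (simp add: M.hom_add M.hom_mult mpoly_deriv_mult)
next
  interpret M: comm_ring_hom "mpoly_map hom" by (rule comm_ring_hom_mpoly_map)
  case (Const c)
  show ?case by (simp add: M.hom_zero)
next
  interpret M: comm_ring_hom "mpoly_map hom" by (rule comm_ring_hom_mpoly_map)
  case (Var i)
  show ?case by (simp add: M.hom_zero M.hom_one)
qed

end

text \<open>A linear relation \<open>\<Sum> v l * \<partial>e\<^sub>l/\<partial>X\<^sub>j = 0\<close> says that a nonzero univariate polynomial of degree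
  less than s vanishes at every coordinate \<open>x j\<close>.\<close>

lemma few_values_of_relation:
  fixes x :: "nat \<Rightarrow> 'k::field"
  assumes rel: "\<And>j. j \<in> {1..r} \<Longrightarrow> (\<Sum>l=1..s. v l * esym ({1..r} - {j}) (l - 1) x) = 0"
    and nz: "\<exists>l\<in>{1..s}. v l \<noteq> 0"
  shows "card (x ` {1..r}) \<le> s - 1"
proof -
  \<comment> \<open>By \<open>esym_remove\<close>, the single polynomial \<open>G k\<close> takes
    the value \<open>esym ({1..r} - {j}) k x\<close> at \<open>x j\<close> for every
    \<open>j\<close>; its degree is exactly \<open>k\<close>.\<close>
  define G where "G = (\<lambda>k. \<Sum>i\<le>k. monom ((- 1) ^ i * esym {1..r} (k - i) x) i)"
  have degG: "degree (G k) \<le> k" for k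
    unfolding G_def by (intro degree_sum_le) (auto intro: order_trans[OF degree_monom_le])
  have coeffG: "coeff (G k) k = (- 1) ^ k" for k
    unfolding G_def by (simp add: coeff_sum coeff_monom)
  have polyG: "poly (G k) (x j) = esym ({1..r} - {j}) k x" if "j \<in> {1..r}" for j k
    unfolding G_def using esym_remove[of "{1..r}" j k x] that
    by (simp add: poly_sum poly_monom power_minus[of "x j"] mult_ac)
  define q where "q = (\<Sum>l=1..s. smult (v l) (G (l - 1)))"
  \<comment> \<open>The largest index with a nonzero coefficient fixes the top term of
    \<open>q\<close>, since the degrees \<open>l - 1\<close> are distinct.\<close>
  define l0 where "l0 = Max {l \<in> {1..s}. v l \<noteq> 0}"
  have "l0 \<in> {l \<in> {1..s}. v l \<noteq> 0}" unfolding l0_def using nz by (intro Max_in) auto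
  then have l0: "l0 \<in> {1..s}" "v l0 \<noteq> 0" by auto
  have above: "v l = 0" if "l \<in> {1..s}" "l0 < l" for l
  proof (rule ccontr)
    assume "v l \<noteq> 0"
    then have "l \<le> l0" unfolding l0_def using that(1) by (intro Max_ge) auto
    then show False using that(2) by simp
  qed
  have "coeff q (l0 - 1) = (\<Sum>l=1..s. if l = l0 then v l0 * (- 1) ^ (l0 - 1) else 0)"
    unfolding q_def coeff_sum
  proof (intro sum.cong refl)
    fix l assume l: "l \<in> {1..s}"
    consider "l = l0" | "l < l0" | "l0 < l" by linarith
    then show "coeff (smult (v l) (G (l - 1))) (l0 - 1) = (if l = l0 then v l0 * (- 1) ^ (l0 - 1) else 0)"
    proof cases
      case 2
      then have "degree (G (l - 1)) < l0 - 1" using degG[of "l - 1"] l by (auto intro: le_less_trans)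
      then show ?thesis using 2 by (simp add: coeff_eq_0)
    qed (use coeffG above[OF l] in auto)
  qed
  also have "\<dots> = v l0 * (- 1) ^ (l0 - 1)" using l0(1) by simp
  finally have q0: "q \<noteq> 0" using l0(2) by auto
  have "degree q \<le> s - 1"
    unfolding q_def
  proof (intro degree_sum_le)
    fix l assume "l \<in> {1..s}"
    then show "degree (smult (v l) (G (l - 1))) \<le> s - 1"
      using degree_smult_le[of "v l" "G (l - 1)"] degG[of "l - 1"] by auto
  qed simp
  moreover have "x ` {1..r} \<subseteq> {t. poly q t = 0}"
    using rel by (auto simp: q_def poly_sum polyG simp del: One_nat_def)
  then have "card (x ` {1..r}) \<le> card {t. poly q t = 0}"
    using q0 by (intro card_mono poly_roots_finite)
  moreover have "card {t. poly q t = 0} \<le> degree q" using q0 by (rule card_poly_roots_bound)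
  ultimately show ?thesis by linarith
qed

lemma few_values_of_rank_drop:
  fixes h :: "'a::comm_ring_1 \<Rightarrow> 'k::field"
  assumes h: "comm_ring_hom h"
    and S: "\<And>i. i \<in> {1..m} \<Longrightarrow> S i \<in> polys s"
    and R: "\<And>i. i \<in> {1..m} \<Longrightarrow> R i = mpoly_subst Const (elem_sym r) (S i)"
    and y: "\<And>i. i \<in> {1..s} \<Longrightarrow> y i = esym {1..r} i x"
    and full: "vec_space.rank m (jacobian h m s S y) = m"
    and drop: "vec_space.rank m (jacobian h m r R x) \<noteq> m"
  shows "card (x ` {1..r}) \<le> s - 1"
proof -
  interpret x: comm_ring_hom "mpoly_subst h x" by (rule comm_ring_hom_mpoly_subst[OF h])
  obtain w i0 where w: "\<And>j. j \<in> {1..r} \<Longrightarrow> (\<Sum>i=1..m. w i * mpoly_subst h x (mpoly_deriv j (R i))) = 0"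
    and i0: "i0 \<in> {1..m}" "w i0 \<noteq> 0"
    using drop unfolding jacobian_rank_iff by blast
  \<comment> \<open>The dependency \<open>w\<close> times the Jacobian of the \<open>S i\<close>;
    full row rank of the latter makes it nonzero.\<close>
  define v where "v = (\<lambda>l. \<Sum>i=1..m. w i * mpoly_subst h y (mpoly_deriv l (S i)))"
  have "\<exists>l\<in>{1..s}. v l \<noteq> 0"
    using full i0 unfolding jacobian_rank_iff v_def by blast
  moreover have "(\<Sum>l=1..s. v l * esym ({1..r} - {j}) (l - 1) x) = 0" if j: "j \<in> {1..r}" for j
  proof -
    have D: "mpoly_subst h x (mpoly_deriv j (R i)) =
        (\<Sum>l=1..s. mpoly_subst h y (mpoly_deriv l (S i)) * esym ({1..r} - {j}) (l - 1) x)" if i: "i \<in> {1..m}" for i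
    proof -
      have "mpoly_subst h x (mpoly_deriv j (R i)) =
          (\<Sum>l=1..s. mpoly_subst h (\<lambda>i. mpoly_subst h x (elem_sym r i)) (mpoly_deriv l (S i)) *
            mpoly_subst h x (mpoly_deriv j (elem_sym r l)))"
        unfolding R[OF i] by (rule mpoly_deriv_chain[OF h S[OF i]])
      also have "\<dots> = (\<Sum>l=1..s. mpoly_subst h y (mpoly_deriv l (S i)) * esym ({1..r} - {j}) (l - 1) x)"
      proof (intro sum.cong refl arg_cong2[where f = "(*)"])
        fix l assume l: "l \<in> {1..s}"
        show "mpoly_subst h (\<lambda>i. mpoly_subst h x (elem_sym r i)) (mpoly_deriv l (S i)) = mpoly_subst h y (mpoly_deriv l (S i))"
          by (rule mpoly_subst_cong[OF h mpoly_deriv_closed[OF S[OF i]]]) (simp add: mpoly_subst_elem_sym[OF h] y)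
        have "elem_sym r l = (elem_sym r (Suc (l - 1)) :: 'a mpoly)" using l by simp
        then show "mpoly_subst h x (mpoly_deriv j (elem_sym r l)) = esym ({1..r} - {j}) (l - 1) x"
          by (simp only: mpoly_deriv_elem_sym[OF j] x.hom_esym mpoly_subst_Var[OF h])
      qed
      finally show ?thesis .
    qed
    have "(\<Sum>l=1..s. v l * esym ({1..r} - {j}) (l - 1) x) =
        (\<Sum>l=1..s. \<Sum>i=1..m. w i * (mpoly_subst h y (mpoly_deriv l (S i)) * esym ({1..r} - {j}) (l - 1) x))"
      by (simp add: v_def sum_distrib_right mult.assoc)
    also have "\<dots> = (\<Sum>i=1..m. \<Sum>l=1..s. w i * (mpoly_subst h y (mpoly_deriv l (S i)) * esym ({1..r} - {j}) (l - 1) x))"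
      by (rule sum.swap)
    also have "\<dots> = (\<Sum>i=1..m. w i * mpoly_subst h x (mpoly_deriv j (R i)))"
      by (intro sum.cong refl) (simp add: D sum_distrib_left)
    also have "\<dots> = 0" by (rule w[OF j])
    finally show ?thesis .
  qed
  ultimately show ?thesis by (intro few_values_of_relation)
qed

theorem theorem3p5:
  fixes s r m :: nat
    and S R :: "nat \<Rightarrow> 'q::{finite, field} mpoly"
    and V :: "(nat \<Rightarrow> 'q alg_closure) set"
  assumes "0 < s" and "0 < r" and "0 < m" and "m \<le> s" and "s + m + 2 \<le> r"
    and S_poly: "\<And>i. i \<in> {1..m} \<Longrightarrow> S i \<in> carrier (mpoly_ring s)"
    and H1: "regular_seq s m S"
    and H2: "jacobian_full_rank_on_locus (to_ac :: 'q \<Rightarrow> 'q alg_closure) s m S"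
    and H3_1: "regular_seq s m (\<lambda>i. top_wt (S i))"
    and H3_2: "jacobian_full_rank_on_locus (to_ac :: 'q \<Rightarrow> 'q alg_closure) s m (\<lambda>i. top_wt (S i))"
    and R_def: "\<And>i. i \<in> {1..m} \<Longrightarrow> R i = mpoly_subst Const (elem_sym r) (S i)"
    and V_def: "V = zero_locus to_ac r (R ` {1..m})"
  shows "zdim r {x \<in> V. vec_space.rank m (jacobian to_ac m r R x) < m} \<le> ereal (real s - 1) \<and>
         zdim r (singular_locus r V) \<le> ereal (real s - 1)"
proof -
  interpret h: comm_ring_hom "to_ac :: 'q \<Rightarrow> 'q alg_closure" by (rule comm_ring_hom_to_ac)
  let ?h = "to_ac :: 'q \<Rightarrow> 'q alg_closure"
  let ?W = "{x \<in> V. vec_space.rank m (jacobian ?h m r R x) < m}"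
  have V_aff: "V \<subseteq> affine_space r" by (auto simp: V_def zero_locus_def)
  have vanish: "mpoly_subst ?h (\<lambda>j. esym {1..r} j x) (S i) = 0" if "x \<in> V" "i \<in> {1..m}" for x i
  proof -
    have "mpoly_subst ?h x (R i) = 0" using that by (auto simp: V_def zero_locus_def)
    then show ?thesis
      by (simp add: R_def[OF that(2)] mpoly_subst_mpoly_subst[OF h.comm_ring_hom_axioms S_poly[OF that(2)]]
          mpoly_subst_elem_sym[OF h.comm_ring_hom_axioms])
  qed
  have few: "card (x ` {1..r}) \<le> s - 1"
    if x: "x \<in> V" and drop: "vec_space.rank m (jacobian ?h m r R x) \<noteq> m" for x
  proof -
    \<comment> \<open>The image of \<open>x\<close> under the first \<open>s\<close> elementary
      symmetric polynomials, set to 0 beyond \<open>s\<close> so as to be a point of affine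
      \<open>s\<close>-space, where (H2) applies.\<close>
    define y where "y = (\<lambda>i. if i \<in> {1..s} then esym {1..r} i x else 0)"
    have "mpoly_subst ?h y (S i) = 0" if "i \<in> {1..m}" for i
      using vanish[OF x that] mpoly_subst_cong[OF h.comm_ring_hom_axioms S_poly[OF that], of y "\<lambda>j. esym {1..r} j x"]
      by (simp add: y_def)
    then have "y \<in> zero_locus ?h s (S ` {1..m})"
      by (auto simp: zero_locus_def affine_space_def y_def)
    then have full: "vec_space.rank m (jacobian ?h m s S y) = m"
      using H2 unfolding jacobian_full_rank_on_locus_def by blast
    show ?thesis
    proof (rule few_values_of_rank_drop[where S = S and R = R and m = m, OF h.comm_ring_hom_axioms S_poly R_def])
      show "y i = esym {1..r} i x" if "i \<in> {1..s}" for i using that by (simp add: y_def)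
    qed (assumption | rule full drop)+
  qed
  have small: "zdim r Z \<le> ereal (real s - 1)"
    if Z: "Z \<subseteq> V" "\<And>x. x \<in> Z \<Longrightarrow> vec_space.rank m (jacobian ?h m r R x) \<noteq> m" for Z
  proof -
    have "growth_le r Z (s - 1)" using Z few by (intro few_values_growth) auto
    then have "zdim r Z \<le> ereal (real (s - 1))" using Z(1) V_aff by (intro zdim_le_growth) auto
    \<comment> \<open>Positivity of \<open>s\<close> makes the truncated difference
      \<open>s - 1\<close> agree with the real one.\<close>
    then show ?thesis using \<open>0 < s\<close> by (simp add: of_nat_diff)
  qed
  \<comment> \<open>\<open>smooth_point\<close> takes equations over the closed field; extension of
    coefficients keeps zeros and gradients.\<close>
  define R' where "R' = (\<lambda>i. mpoly_map ?h (R i))"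
  have Rp: "R i \<in> polys r" if "i \<in> {1..m}" for i
    unfolding R_def[OF that] by (rule mpoly_subst_Const_closed[OF S_poly[OF that] elem_sym_closed])
  have R'p: "R' i \<in> polys r" if "i \<in> {1..m}" for i
    unfolding R'_def by (rule h.mpoly_map_closed[OF Rp[OF that]])
  have evR': "ev x (R' i) = mpoly_subst ?h x (R i)"
    "ev x (mpoly_deriv j (R' i)) = mpoly_subst ?h x (mpoly_deriv j (R i))" if "i \<in> {1..m}" for x i j
    unfolding R'_def h.mpoly_deriv_mpoly_map[OF Rp[OF that]]
    using h.ev_mpoly_map[OF Rp[OF that]] h.ev_mpoly_map[OF mpoly_deriv_closed[OF Rp[OF that]]] by auto
  have V': "V = zero_locus (\<lambda>c. c) r (R' ` {1..m})"
    unfolding V_def zero_locus_def using evR'(1) by auto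
  have growth: "growth_le r V (r - m)"
    using pullback_growth[OF h.comm_ring_hom_axioms H1] vanish assms(2,4,5) by auto
  have "singular_locus r V \<subseteq> V" by (auto simp: singular_locus_def)
  \<comment> \<open>At a point of full rank, the tangent dimension and the local dimension both
    equal \<open>r - m\<close>, so the point is regular; the singular locus thus lies in the rank
    drop locus.\<close>
  moreover have "vec_space.rank m (jacobian ?h m r R x) \<noteq> m" if x: "x \<in> singular_locus r V" for x
  proof
    assume full: "vec_space.rank m (jacobian ?h m r R x) = m"
    have xV: "x \<in> V" using x by (simp add: singular_locus_def)
    have indep: "c i = 0" if "\<And>j. j \<in> {1..r} \<Longrightarrow> (\<Sum>i=1..m. c i * ev x (mpoly_deriv j (R' i))) = 0" "i \<in> {1..m}" for c i
    proof -
      have "(\<Sum>i=1..m. c i * mpoly_subst ?h x (mpoly_deriv j (R i))) = 0" if "j \<in> {1..r}" for j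
        using \<open>\<And>j. j \<in> {1..r} \<Longrightarrow> (\<Sum>i=1..m. c i * ev x (mpoly_deriv j (R' i))) = 0\<close>[OF that]
        by (simp add: evR'(2))
      then show ?thesis using full that(2) unfolding jacobian_rank_iff by blast
    qed
    have mr: "m \<le> r" using assms(5) by simp
    have "fun_vs.dim (tangent_space r V x) = r - m"
    proof (rule smooth_point(1)[OF \<open>0 < r\<close> mr R'p V' xV growth])
      show "c i = 0" if "\<And>j. j \<in> {1..r} \<Longrightarrow> (\<Sum>i=1..m. c i * ev x (mpoly_deriv j (R' i))) = 0"
        "i \<in> {1..m}" for c i by (rule indep[OF that])
    qed assumption
    moreover have "local_dim r V x = ereal (real (r - m))"
    proof (rule smooth_point(2)[OF \<open>0 < r\<close> mr R'p V' xV growth])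
      show "c i = 0" if "\<And>j. j \<in> {1..r} \<Longrightarrow> (\<Sum>i=1..m. c i * ev x (mpoly_deriv j (R' i))) = 0"
        "i \<in> {1..m}" for c i by (rule indep[OF that])
    qed assumption
    ultimately show False using x by (simp add: singular_locus_def)
  qed
  ultimately have "zdim r (singular_locus r V) \<le> ereal (real s - 1)" by (rule small)
  moreover have "zdim r ?W \<le> ereal (real s - 1)" by (rule small) auto
  ultimately show ?thesis by blast
qed

end
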